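(* Let $1\le s<\infty$, $1\le p\le\infty$, let $r_1\ge r_2\ge 1$ be integers and let $\mu>2r_1+1/2-1/s$. The following holds for all sufficiently small $\delta\in(0,1)$. I) If $r_1=r_2$, then for $N\asymp\left(\delta/\ln^{\mu}\frac1\delta\right)^{-\frac{1}{\mu-1/p+1/s}}$ $$N^{-\mu+2r_1-1/s+1/2}\preceq R^{(r_1,r_1)}_{N,\delta}(L^\mu_{s,2},L_2,\ell_p)\preceq N^{-\mu+2r_1-1/s+1/2}\ln^{\mu-2r_1+1}N,$$ $$\left(\delta/\ln^{\mu}\tfrac1\delta\right)^{\frac{\mu-2r_1+1/s-1/2}{\mu-1/p+1/s}}\preceq R^{(r_1,r_1)}_{N,\delta}(L^\mu_{s,2},L_2,\ell_p)\preceq\left(\delta\ln^{1/s-1/p}\tfrac1\delta\right)^{\frac{\mu-2r_1+1/s-1/2}{\mu-1/p+1/s}}\ln^{3/2-1/s}\tfrac1\delta .$$ The upper bounds are implemented by the method $\mathcal D^{(r_1,r_1)}_{n,\gamma}$ with $n\asymp\left(\delta^{-1}\ln^{1/p-1/s}\frac1\delta\right)^{\frac{1}{\mu-1/p+1/s}}$ and $\gamma=1$. II) If $r_1>r_2$, then for $N\asymp\delta^{-\frac{1}{\mu-1/p+1/s}}$ $$R^{(r_1,r_2)}_{N,\delta}(L^\mu_{s,2},L_2,\ell_p)\asymp N^{-\mu+2r_1-1/s+1/2}\asymp\delta^{\frac{\mu-2r_1+1/s-1/2}{\mu-1/p+1/s}} .$$ The order-optimal bounds are implemented by the method $\mathcal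 D^{(r_1,r_2)}_{n,\gamma}$ with $n\asymp\delta^{-\frac{1}{\mu-1/p+1/s}}$ and any $$\gamma\in\left(1,\tfrac{\mu-2r_2+1/s-1/2}{\mu-2r_1+1/s+1/2}\right)\cup\left(\tfrac{\mu-2r_2+1/s-1/2}{\mu-2r_1+1/s+1/2},\tfrac{\mu-2r_2+1/s+1/2}{\mu-2r_1+1/s+1/2}\right)\cup\left(\tfrac{\mu-2r_2+1/s+1/2}{\mu-2r_1+1/s+1/2},\tfrac{\mu-2r_2+1/s-1/2}{\mu-2r_1+1/s-1/2}\right).$$
   Context: Convention: $1/\infty=0$. Let $\varphi_k(t)=\sqrt{k+1/2}\,(2^kk!)^{-1}\frac{d^k}{dt^k}[(t^2-1)^k]$, $k=0,1,2,\dots$, be the Legendre polynomials orthonormal on $[-1,1]$, let $Q=[-1,1]^2$, $L_2=L_2(Q)$, and for $f\in L_2(Q)$ let $\langle f,\varphi_{k,j}\rangle=\int_{-1}^1\int_{-1}^1 f(t,\tau)\varphi_k(t)\varphi_j(\tau)\,d\tau\,dt$. With $\underline{k}=\max\{1,k\}$, for $\mu>0$, $1\le s<\infty$, $$L^\mu_{s,2}=\Big\{f\in L_2(Q):\ \|f\|_{s,\mu}^s:=\sum_{k,j=0}^\infty(\underline{k}\cdot\underline{j})^{s\mu}|\langle f,\varphi_{k,j}\rangle|^s<\infty\Big\}.$$ The mixed derivative of $f=\sum_{k,j\ge0}\langle f,\varphi_{k,j}\rangle\varphi_k(t)\varphi_j(\tau)$ is the series $f^{(r_1,r_2)}(t,\tau)=\sum_{k=r_1}^\infty\sum_{j=r_2}^\infty\langle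 f,\varphi_{k,j}\rangle\varphi_k^{(r_1)}(t)\varphi_j^{(r_2)}(\tau)$. Perturbed data: $\overline{f^\delta}=\{\langle f_\delta,\varphi_{k,j}\rangle\}_{k,j\ge0}$ is any numerical sequence such that $\overline\xi=\{\langle f,\varphi_{k,j}\rangle-\langle f_\delta,\varphi_{k,j}\rangle\}_{k,j\ge0}$ satisfies $\|\overline\xi\|_{\ell_p}\le\delta$, $0<\delta<1$ ($\ell_p$ is the usual norm on double sequences). Minimal radius: for a bounded (finite) set $\Omega$ of integer points of $[r_1,\infty)\times[r_2,\infty)$, let $\mathrm{card}(\Omega)$ be the number of its points and let $G(\Omega,\overline f^\delta)=\{\langle f_\delta,\varphi_{k,j}\rangle\}_{(k,j)\in\Omega}\in\mathbb R^{\mathrm{card}(\Omega)}$. For $X=C(Q)$ or $X=L_2(Q)$, $\Psi(\Omega)$ is the set of all mappings $\psi^{(r_1,r_2)}=\psi^{(r_1,r_2)}(\Omega):\mathbb R^{\mathrm{card}(\Omega)}\to X$ (no linearity, continuity or stability required). The error is $$\varepsilon_\delta(L^\mu_{s,2},\psi^{(r_1,r_2)}(\Omega),X,\ell_p)=\sup_{\|f\|_{s,\mu}\le1}\ \sup_{\overline{f^\delta}:\,\|\overline\xi\|_{\ell_p}\le\delta}\|f^{(r_1,r_2)}-\psi^{(r_1,r_2)}(G(\Omega,\overline f^\delta))\|_X,$$ and $$R^{(r_1,r_2)}_{N,\delta}(L^\mu_{s,2},X,\ell_p)=\inf_{\Omega:\,\mathrm{card}(\Omega)\le N}\ \inf_{\psi^{(r_1,r_2)}\in\Psi(\Omega)}\varepsilon_\delta(L^\mu_{s,2},\psi^{(r_1,r_2)}(\Omega),X,\ell_p).$$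 Truncation method: for $\gamma\ge1$ and $n>0$ let $\Gamma_{n,\gamma}=\{(k,j)\in\mathbb N^2:\ k\ge r_1,\ j\ge r_2,\ k\,j^\gamma\le n\}$ and $$\mathcal D^{(r_1,r_2)}_{n,\gamma}f_\delta(t,\tau)=\sum_{(k,j)\in\Gamma_{n,\gamma}}\langle f_\delta,\varphi_{k,j}\rangle\varphi_k^{(r_1)}(t)\varphi_j^{(r_2)}(\tau).$$ A bound is "implemented" by $\mathcal D^{(r_1,r_2)}_{n,\gamma}$ if this algorithm, with $\Omega=\Gamma_{n,\gamma}$ and $\mathrm{card}(\Gamma_{n,\gamma})\preceq N$, has error $\varepsilon_\delta$ satisfying that upper bound. $a\preceq b$ means $a\le cb$ with $c>0$ depending only on $\mu,s,p,r_1,r_2,\gamma$ and on the constants implied in the choices of $N$ and $n$ (not on $\delta$, $N$, $n$); $a\asymp b$ means $a\preceq b$ and $b\preceq a$. *)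

theory Defs
  imports "HOL-Analysis.Analysis" "HOL-Computational_Algebra.Polynomial"
begin

definition legendre :: "nat \<Rightarrow> real poly" where
  "legendre k = smult (sqrt (real k + 1/2) / (2 ^ k * fact k))
                      ((pderiv ^^ k) ([:-1, 0, 1:] ^ k))"

definition legendre_deriv :: "nat \<Rightarrow> nat \<Rightarrow> real \<Rightarrow> real" where
  "legendre_deriv r k t = poly ((pderiv ^^ r) (legendre k)) t"

definition Q :: "(real \<times> real) set" where
  "Q = {-1..1} \<times> {-1..1}"

text \<open>Elements of \<open>L\<^sub>2(Q)\<close> are represented by functions on the plane; their values outside
  \<open>Q\<close> and on null sets are irrelevant.\<close>

definition L2_Q :: "(real \<times> real \<Rightarrow> real) set" where
  "L2_Q = {f \<in> borel_measurable (lebesgue_on Q). integrable (lebesgue_on Q) (\<lambda>z. (f z)\<^sup>2)}"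

definition L2_norm :: "(real \<times> real \<Rightarrow> real) \<Rightarrow> real" where
  "L2_norm f = sqrt (LINT z|lebesgue_on Q. (f z)\<^sup>2)"

definition legendre_coeff :: "(real \<times> real \<Rightarrow> real) \<Rightarrow> nat \<times> nat \<Rightarrow> real" where
  "legendre_coeff f = (\<lambda>(k, j).
     LINT z|lebesgue_on Q. f z * poly (legendre k) (fst z) * poly (legendre j) (snd z))"

definition smoothness_term :: "real \<Rightarrow> real \<Rightarrow> (real \<times> real \<Rightarrow> real) \<Rightarrow> nat \<times> nat \<Rightarrow> real" where
  "smoothness_term s \<mu> f = (\<lambda>(k, j).
     (real (max 1 k) * real (max 1 j)) powr (s * \<mu>) * \<bar>legendre_coeff f (k, j)\<bar> powr s)"

definition smoothness_class :: "real \<Rightarrow> real \<Rightarrow> (real \<times> real \<Rightarrow> real) set" where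
  "smoothness_class s \<mu> = {f \<in> L2_Q. smoothness_term s \<mu> f summable_on UNIV}"

definition smoothness_norm :: "real \<Rightarrow> real \<Rightarrow> (real \<times> real \<Rightarrow> real) \<Rightarrow> real" where
  "smoothness_norm s \<mu> f = (\<Sum>\<^sub>\<infinity>i. smoothness_term s \<mu> f i) powr (1 / s)"

definition lp_space :: "ereal \<Rightarrow> (nat \<times> nat \<Rightarrow> real) set" where
  "lp_space p = (if p = \<infinity> then {x. bounded (range x)}
                 else {x. (\<lambda>i. \<bar>x i\<bar> powr real_of_ereal p) summable_on UNIV})"

definition lp_norm :: "ereal \<Rightarrow> (nat \<times> nat \<Rightarrow> real) \<Rightarrow> real" where
  "lp_norm p x = (if p = \<infinity> then (SUP i. \<bar>x i\<bar>)
                  else (\<Sum>\<^sub>\<infinity>i. \<bar>x i\<bar> powr real_of_ereal p) powr (1 / real_of_ereal p))"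

definition perturbed_data :: "ereal \<Rightarrow> real \<Rightarrow> (real \<times> real \<Rightarrow> real) \<Rightarrow> (nat \<times> nat \<Rightarrow> real) set" where
  "perturbed_data p \<delta> f =
     {y. (\<lambda>i. legendre_coeff f i - y i) \<in> lp_space p \<and>
         lp_norm p (\<lambda>i. legendre_coeff f i - y i) \<le> \<delta>}"

definition deriv_sum :: "nat \<Rightarrow> nat \<Rightarrow> (nat \<times> nat) set \<Rightarrow> (nat \<times> nat \<Rightarrow> real) \<Rightarrow> real \<times> real \<Rightarrow> real" where
  "deriv_sum r1 r2 \<Omega> c = (\<lambda>(t, \<tau>).
     \<Sum>(k, j)\<in>\<Omega>. c (k, j) * legendre_deriv r1 k t * legendre_deriv r2 j \<tau>)"

text \<open>\<open>g\<close> is the mixed derivative of \<open>f\<close>: the differentiated Fourier-Legendre series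
  converges (unconditionally) in \<open>L\<^sub>2(Q)\<close> to \<open>g\<close>.\<close>

definition has_mixed_deriv ::
    "nat \<Rightarrow> nat \<Rightarrow> (real \<times> real \<Rightarrow> real) \<Rightarrow> (real \<times> real \<Rightarrow> real) \<Rightarrow> bool" where
  "has_mixed_deriv r1 r2 f g \<longleftrightarrow> g \<in> L2_Q \<and>
     ((\<lambda>F. L2_norm (\<lambda>z. g z - deriv_sum r1 r2 F (legendre_coeff f) z)) \<longlongrightarrow> 0)
       (finite_subsets_at_top ({r1..} \<times> {r2..}))"

definition information :: "(nat \<times> nat) set \<Rightarrow> (nat \<times> nat \<Rightarrow> real) \<Rightarrow> nat \<times> nat \<Rightarrow> real" where
  "information \<Omega> y = restrict y \<Omega>"

definition recovery_maps ::
    "(nat \<times> nat) set \<Rightarrow> ((nat \<times> nat \<Rightarrow> real) \<Rightarrow> real \<times> real \<Rightarrow> real) set" where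
  "recovery_maps \<Omega> = (\<Omega> \<rightarrow>\<^sub>E UNIV) \<rightarrow> L2_Q"

text \<open>Since \<open>g\<close> is unique up to null sets, the inner infimum is the norm of the difference
  between the mixed derivative and its reconstruction when the derivative exists, and it is
  \<open>\<infinity>\<close> when the differentiated series diverges in \<open>L\<^sub>2(Q)\<close>.\<close>

definition recovery_error ::
    "nat \<Rightarrow> nat \<Rightarrow> real \<Rightarrow> real \<Rightarrow> ereal \<Rightarrow> real \<Rightarrow> (nat \<times> nat) set \<Rightarrow>
     ((nat \<times> nat \<Rightarrow> real) \<Rightarrow> real \<times> real \<Rightarrow> real) \<Rightarrow> ennreal" where
  "recovery_error r1 r2 s \<mu> p \<delta> \<Omega> \<psi> =
     (SUP f \<in> {f \<in> smoothness_class s \<mu>. smoothness_norm s \<mu> f \<le> 1}.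
        SUP y \<in> perturbed_data p \<delta> f.
          INF g \<in> {g. has_mixed_deriv r1 r2 f g}.
            ennreal (L2_norm (\<lambda>z. g z - \<psi> (information \<Omega> y) z)))"

definition minimal_radius ::
    "nat \<Rightarrow> nat \<Rightarrow> real \<Rightarrow> real \<Rightarrow> ereal \<Rightarrow> nat \<Rightarrow> real \<Rightarrow> ennreal" where
  "minimal_radius r1 r2 s \<mu> p N \<delta> =
     (INF \<Omega> \<in> {\<Omega>. \<Omega> \<subseteq> {r1..} \<times> {r2..} \<and> finite \<Omega> \<and> card \<Omega> \<le> N}.
        INF \<psi> \<in> recovery_maps \<Omega>. recovery_error r1 r2 s \<mu> p \<delta> \<Omega> \<psi>)"

definition hyp_cross :: "nat \<Rightarrow> nat \<Rightarrow> real \<Rightarrow> real \<Rightarrow> (nat \<times> nat) set" where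
  "hyp_cross r1 r2 n \<gamma> = {(k, j). r1 \<le> k \<and> r2 \<le> j \<and> real k * real j powr \<gamma> \<le> n}"

text \<open>Error of the truncation method, which uses the data indexed by the hyperbolic cross.\<close>

definition truncation_error ::
    "nat \<Rightarrow> nat \<Rightarrow> real \<Rightarrow> real \<Rightarrow> ereal \<Rightarrow> real \<Rightarrow> real \<Rightarrow> real \<Rightarrow> ennreal" where
  "truncation_error r1 r2 s \<mu> p \<delta> n \<gamma> =
     recovery_error r1 r2 s \<mu> p \<delta> (hyp_cross r1 r2 n \<gamma>) (deriv_sum r1 r2 (hyp_cross r1 r2 n \<gamma>))"

text \<open>\<open>x \<asymp> y\<close> with the implied constants made explicit.\<close>

definition within_factors :: "real \<Rightarrow> real \<Rightarrow> real \<Rightarrow> real \<Rightarrow> bool" where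
  "within_factors a b x y \<longleftrightarrow> a * y \<le> x \<and> x \<le> b * y"

end

theory Submission
  imports Defs "HOL-Real_Asymp.Real_Asymp"
begin

text \<open>
  The \<open>r\<close>-th derivative of the \<open>k\<close>-th normalized Legendre polynomial has \<open>L\<^sub>2\<close>-norm of order at most
  \<open>k\<^bsup>2r-1/2\<^esup>\<close>: its derivatives at the endpoints are known from Legendre's differential equation, and
  repeated integration by parts expresses the norm through them. For the upper bounds the triangle
  inequality in \<open>L\<^sub>2\<close> then suffices. The coefficients outside the hyperbolic cross are controlled by
  the smoothness norm and the noise inside it by its \<open>\<ell>\<^sub>p\<close>-norm, both through Hoelder's inequality and
  power sums over the cross or its complement. With \<open>\<gamma> = 1\<close> these sums carry a harmonic sum,
  hence a logarithm; if \<open>r1 > r2\<close> any admissible \<open>\<gamma> > 1\<close> makes them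
  convergent in \<open>j\<close> and the logarithm disappears.
  For the lower bound, about \<open>N\<close> unobserved coefficients of degree about \<open>N\<close> in one row are given the
  same value. All derivatives of Legendre polynomials are positive at \<open>1\<close>, so that the derivative of
  this function is large there, and Nikolskii's inequality makes its \<open>L\<^sub>2\<close>-norm large.
\<close>

subsection \<open>Legendre polynomials and their derivatives\<close>

text \<open>Derivatives of Legendre polynomials are not orthogonal. At the endpoint 1 they all have
  the same sign, and a sum of N of them with degrees about N has norm of the same order as the sum
  of their norms, N^(2r+1/2): the value at 1 gains a factor N from the N summands, and Nikolskii's
  inequality takes back one factor N. Hence the triangle inequality can be sharp in order, and one
  point suffices to judge the extremal function. The error of truncation at n is n^(-B) plus
  \<delta> n^e with e = 2 r1 + 1/2 - 1/p. Since A = B + e, both parts agree at n of order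
  \<delta>^(-1/A). For \<gamma> = 1 they carry the powers 1 - 1/s and 1 - 1/p of a logarithm, and
  the difference of these powers is the logarithmic correction in the choice of n. The recovery
  error is infinite as soon as some function of the class has no mixed derivative. The upper bound
  must therefore construct the derivative, whereas the lower bound only uses its uniqueness. The
  radius allows at most N data, without a constant, so its upper bounds use a cross shrunk by a
  suitable constant.\<close>

definition ipoly :: "real poly \<Rightarrow> real" where
  "ipoly p = integral {-1..1} (poly p)"

lemma poly_integrable [simp]: "poly p integrable_on {-1..1::real}"
  by (intro integrable_continuous_real continuous_intros)

lemma ipoly_add: "ipoly (p + q) = ipoly p + ipoly q"
proof -
  have "poly (p + q) = (\<lambda>x. poly p x + poly q x)" by auto
  thus ?thesis by (simp add: ipoly_def integral_add)
qed

lemma ipoly_smult: "ipoly (smult c p) = c * ipoly p"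
proof -
  have "poly (smult c p) = (\<lambda>x. c * poly p x)" by auto
  thus ?thesis by (simp add: ipoly_def)
qed

lemma ipoly_0 [simp]: "ipoly 0 = 0"
  using ipoly_smult[of 0 0] by simp

lemma ipoly_diff: "ipoly (p - q) = ipoly p - ipoly q"
  using ipoly_add[of p "smult (-1) q"] ipoly_smult[of "-1" q] by simp

lemma ipoly_sum: "ipoly (sum f A) = (\<Sum>a\<in>A. ipoly (f a))"
  by (induction A rule: infinite_finite_induct) (auto simp: ipoly_add)

lemma ipoly_pderiv: "ipoly (pderiv p) = poly p 1 - poly p (-1)"
proof -
  have "(poly (pderiv p) has_integral (poly p 1 - poly p (-1))) {-1..1}"
    by (rule fundamental_theorem_of_calculus)
       (auto intro: DERIV_subset[OF poly_DERIV]
             simp: has_real_derivative_iff_has_vector_derivative[symmetric])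
  thus ?thesis unfolding ipoly_def by (rule integral_unique)
qed

lemma ipoly_square_nonneg: "0 \<le> ipoly (p * p)"
  unfolding ipoly_def by (rule integral_nonneg) auto

lemma ipoly_by_parts:
  "ipoly (pderiv p * q) = poly p 1 * poly q 1 - poly p (-1) * poly q (-1) - ipoly (p * pderiv q)"
proof -
  have "pderiv p * q = pderiv (p * q) - p * pderiv q"
    by (simp add: pderiv_mult algebra_simps)
  thus ?thesis by (simp add: ipoly_diff ipoly_pderiv)
qed

section \<open>Higher derivatives of products and of the polynomial in Rodrigues' formula\<close>

lemma higher_pderiv_eq_0:
  fixes p :: "real poly"
  assumes "degree p < m"
  shows "(pderiv ^^ m) p = 0"
proof -
  obtain j where j: "m = Suc j" "degree p \<le> j" using assms by (cases m) auto
  have "degree ((pderiv ^^ j) p) = 0" using j by (simp add: degree_higher_pderiv)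
  thus ?thesis using j pderiv_eq_0_iff[of "(pderiv ^^ j) p"] by simp
qed

text \<open>One derivative of (x - a)^(k+1) q is (x - a)^k times a polynomial whose value at a is
  (k+1) q(a), so the shape survives the induction. The product rule is applied to an abstract
  \<open>A\<close> with derivative 1, which keeps the powers folded.\<close>

lemma poly_higher_pderiv_root_power:
  fixes a :: real
  assumes "i \<le> k"
  shows "poly ((pderiv ^^ i) ([:-a, 1:] ^ k * q)) a = (if i = k then fact k * poly q a else 0)"
  using assms
proof (induction k arbitrary: i q)
  case 0
  then show ?case by simp
next
  case (Suc k)
  show ?case
  proof (cases i)
    case 0
    then show ?thesis by simp
  next
    case (Suc i')
    have "pderiv (A ^ Suc k * q) = A ^ k * (smult (of_nat (Suc k)) q + A * pderiv q)"
      if "pderiv A = 1" for A :: "real poly"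
      unfolding pderiv_mult pderiv_power_Suc that by (simp add: algebra_simps del: of_nat_Suc)
    from this[of "[:-a, 1:]"] have "pderiv ([:-a, 1:] ^ Suc k * q)
          = [:-a, 1:] ^ k * (smult (of_nat (Suc k)) q + [:-a, 1:] * pderiv q)"
      by (simp add: pderiv_pCons one_pCons)
    hence "(pderiv ^^ i) ([:-a, 1:] ^ Suc k * q)
          = (pderiv ^^ i') ([:-a, 1:] ^ k * (smult (of_nat (Suc k)) q + [:-a, 1:] * pderiv q))"
      by (simp only: Suc funpow_Suc_right o_apply)
    moreover have "i' \<le> k" using Suc.prems Suc by simp
    ultimately show ?thesis
      by (simp only: Suc.IH) (simp add: Suc algebra_simps)
  qed
qed

definition rodrigues :: "nat \<Rightarrow> real poly" where
  "rodrigues k = [:-1, 0, 1:] ^ k"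

text \<open>Each factorization isolates the k-fold root at one endpoint; the second keeps the form
  \<open>[:-(-1), 1:]\<close> so that \<open>poly_higher_pderiv_root_power\<close> matches with a =
  -1.\<close>

lemma rodrigues_factor:
  "rodrigues k = [:-1, 1:] ^ k * [:1, 1:] ^ k" "rodrigues k = [:-(-1), 1:] ^ k * [:-1, 1:] ^ k"
  by (simp_all add: rodrigues_def power_mult_distrib[symmetric])

lemma degree_rodrigues: "degree (rodrigues k) = 2 * k"
  by (simp add: rodrigues_def degree_power_eq)

lemma rodrigues_endpoints:
  assumes "i \<le> k"
  shows "poly ((pderiv ^^ i) (rodrigues k)) 1 = (if i = k then 2 ^ k * fact k else 0)"
    and "poly ((pderiv ^^ i) (rodrigues k)) (-1) = (if i = k then (-2) ^ k * fact k else 0)"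
  using poly_higher_pderiv_root_power[OF assms, of 1 "[:1, 1:] ^ k"]
        poly_higher_pderiv_root_power[OF assms, of "-1" "[:-1, 1:] ^ k"]
  unfolding rodrigues_factor(1)[symmetric] rodrigues_factor(2)[symmetric]
  by (simp_all add: mult.commute)

text \<open>Leibniz' rule stops after three terms because the third derivative of \<open>w\<close>
  vanishes. Keeping \<open>w\<close> and \<open>z\<close> as variables prevents the concrete
  polynomials from being expanded in the induction.\<close>

lemma higher_pderiv_quadratic_mult:
  fixes w v :: "real poly"
  assumes "pderiv w = smult 2 z" "pderiv z = 1"
  shows "(pderiv ^^ Suc (Suc n)) (w * v)
    = w * (pderiv ^^ Suc (Suc n)) v + smult (2 * real (Suc (Suc n))) (z * (pderiv ^^ Suc n) v)
      + smult (real (Suc (Suc n)) * real (Suc n)) ((pderiv ^^ n) v)"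
proof (induction n)
  case 0
  show ?case
    by (rule poly_ext) (simp add: pderiv_mult pderiv_add pderiv_smult assms algebra_simps)
next
  case (Suc n)
  show ?case
    unfolding funpow.simps(2)[of "Suc (Suc n)" pderiv] o_apply Suc
    by (rule poly_ext) (simp add: pderiv_mult pderiv_add pderiv_smult assms algebra_simps)
qed

lemma higher_pderiv_linear_mult:
  fixes z v :: "real poly"
  assumes "pderiv z = 1"
  shows "(pderiv ^^ Suc n) (z * v) = z * (pderiv ^^ Suc n) v + smult (real (Suc n)) ((pderiv ^^ n) v)"
proof (induction n)
  case 0
  show ?case by (rule poly_ext) (simp add: pderiv_mult assms algebra_simps)
next
  case (Suc n)
  show ?case
    unfolding funpow.simps(2)[of "Suc n" pderiv] o_apply Suc
    by (rule poly_ext) (simp add: pderiv_mult pderiv_add pderiv_smult assms algebra_simps)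
qed

text \<open>Legendre's differential equation, differentiated \<open>m\<close> times and evaluated at an endpoint,
  where the leading coefficient \<open>x\<^sup>2 - 1\<close> vanishes.\<close>

lemma rodrigues_recurrence:
  fixes x :: real
  assumes x: "x\<^sup>2 = 1"
  shows "2 * (real m + 1) * x * poly ((pderiv ^^ (k + Suc m)) (rodrigues k)) x
       = (real k + real m + 1) * (real k - real m) * poly ((pderiv ^^ (k + m)) (rodrigues k)) x"
proof (cases "k + m")
  case 0
  then show ?thesis by (simp add: rodrigues_def)
next
  case (Suc l)
  let ?u = "rodrigues k"
  \<comment> \<open>The power u = (x^2 - 1)^k satisfies the first-order equation (x^2 - 1) u' = 2 k
    x u. Differentiating it k + m + 1 times gives Legendre's equation for the k-th derivative of u,
    differentiated m more times.\<close>
  have "[:-1, 0, 1:] * pderiv ?u = smult (2 * real k) ([:0, 1:] * ?u)"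
  proof (cases k)
    case 0
    thus ?thesis by (simp add: rodrigues_def)
  next
    case (Suc k')
    have "pderiv ?u = smult (2 * real k) ([:0,1:] * [:-1, 0, 1:] ^ k')"
      unfolding rodrigues_def Suc pderiv_power_Suc by (simp add: pderiv_pCons algebra_simps)
    thus ?thesis by (simp add: rodrigues_def Suc algebra_simps)
  qed
  hence "(pderiv ^^ Suc (Suc l)) ([:-1, 0, 1:] * pderiv ?u)
       = (pderiv ^^ Suc (Suc l)) (smult (2 * real k) ([:0, 1:] * ?u))" by simp
  hence "poly ((pderiv ^^ Suc (Suc l)) ([:-1, 0, 1:] * pderiv ?u)) x
       = 2 * real k * poly ((pderiv ^^ Suc (Suc l)) ([:0, 1:] * ?u)) x"
    by (simp only: higher_pderiv_smult poly_smult)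
  moreover have D: "pderiv [:-1, 0, 1:] = smult 2 ([:0, 1:] :: real poly)" "pderiv [:0, 1:] = (1 :: real poly)"
    by (simp_all add: pderiv_pCons one_pCons)
  moreover have "(pderiv ^^ i) (pderiv ?u) = (pderiv ^^ Suc i) ?u" for i
    by (simp only: funpow_Suc_right o_apply)
  moreover have w: "poly [:-1, 0, 1:] x = 0" and z: "poly [:0, 1:] x = x"
    using x by (simp_all add: power2_eq_square)
  ultimately have "2 * real (Suc (Suc l)) * x * poly ((pderiv ^^ Suc (Suc l)) ?u) x
       + real (Suc (Suc l)) * real (Suc l) * poly ((pderiv ^^ Suc l) ?u) x
      = 2 * real k * (x * poly ((pderiv ^^ Suc (Suc l)) ?u) x
          + real (Suc (Suc l)) * poly ((pderiv ^^ Suc l) ?u) x)"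
    unfolding higher_pderiv_quadratic_mult[OF D] higher_pderiv_linear_mult[OF D(2)]
    by (simp only: poly_add poly_mult poly_smult w z mult_zero_left add_0_left mult.assoc)
  moreover have "k + m = Suc l" "k + Suc m = Suc (Suc l)" "real (Suc l) = real k + real m"
    using Suc by auto
  moreover have "real (Suc (Suc l)) = real k + real m + 1" using Suc by simp
  ultimately show ?thesis by (simp only:) (simp only: algebra_simps)
qed

section \<open>Endpoint values, orthogonality and normalization\<close>

definition legendre_norm_factor :: "nat \<Rightarrow> real" where
  "legendre_norm_factor k = sqrt (real k + 1/2) / (2 ^ k * fact k)"

lemma higher_pderiv_legendre:
  "(pderiv ^^ m) (legendre k) = smult (legendre_norm_factor k) ((pderiv ^^ (k + m)) (rodrigues k))"
  unfolding legendre_def legendre_norm_factor_def rodrigues_def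
  by (subst higher_pderiv_smult) (simp add: add.commute[of k] funpow_add)

lemma degree_legendre: "degree (legendre k) = k"
proof -
  have "degree ((pderiv ^^ (k + 0)) (rodrigues k)) = k"
    by (simp only: degree_higher_pderiv degree_rodrigues)
  moreover have "legendre_norm_factor k \<noteq> 0" by (auto simp: legendre_norm_factor_def)
  ultimately show ?thesis using higher_pderiv_legendre[of 0 k] by simp
qed

lemma legendre_at_1: "poly (legendre k) 1 = sqrt (real k + 1/2)"
  using higher_pderiv_legendre[of 0 k] rodrigues_endpoints(1)[of k k]
  by (simp add: legendre_norm_factor_def)

lemma legendre_at_minus_1: "poly (legendre k) (-1) = (-1) ^ k * sqrt (real k + 1/2)"
  using higher_pderiv_legendre[of 0 k] rodrigues_endpoints(2)[of k k]
  by (simp add: legendre_norm_factor_def power_minus[of 2])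

lemma legendre_deriv_recurrence:
  assumes "x\<^sup>2 = 1"
  shows "2 * (real m + 1) * x * legendre_deriv (Suc m) k x
       = (real k + real m + 1) * (real k - real m) * legendre_deriv m k x"
  using rodrigues_recurrence[OF assms, of m k]
  unfolding legendre_deriv_def higher_pderiv_legendre poly_smult
  by (metis (no_types, opaque_lifting) mult.assoc mult.left_commute)

text \<open>All k derivatives are moved from the Rodrigues polynomial to \<open>q\<close>, which
  they annihilate. No boundary term appears because both endpoints are roots of order k.\<close>

lemma legendre_orthogonal_lower_degree:
  assumes "degree q < k"
  shows "ipoly (legendre k * q) = 0"
proof -
  let ?u = "rodrigues k"
  have step: "i \<le> k \<Longrightarrow> ipoly ((pderiv ^^ k) ?u * q) = (-1) ^ i * ipoly ((pderiv ^^ (k - i)) ?u * (pderiv ^^ i) q)" for i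
  proof (induction i)
    case 0
    then show ?case by simp
  next
    case (Suc i)
    have "k - i = Suc (k - Suc i)" using Suc by simp
    hence "ipoly ((pderiv ^^ (k - i)) ?u * (pderiv ^^ i) q)
        = ipoly (pderiv ((pderiv ^^ (k - Suc i)) ?u) * (pderiv ^^ i) q)" by simp
    also have "\<dots> = - ipoly ((pderiv ^^ (k - Suc i)) ?u * (pderiv ^^ Suc i) q)"
      using Suc.prems rodrigues_endpoints[of "k - Suc i" k] by (subst ipoly_by_parts) auto
    finally show ?case using Suc by simp
  qed
  have "ipoly ((pderiv ^^ k) ?u * q) = 0"
    using step[of k] higher_pderiv_eq_0[OF assms] by simp
  thus ?thesis using higher_pderiv_legendre[of 0 k] by (simp add: ipoly_smult)
qed

text \<open>For \<open>p = legendre k\<close>, the integral of \<open>x p p'\<close> is computed by parts and, since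
  \<open>x p' - k p\<close> has degree below \<open>k\<close>, by orthogonality; comparison gives the norm.\<close>

lemma legendre_normalized: "ipoly (legendre k * legendre k) = 1"
proof -
  let ?p = "legendre k"
  let ?x = "[:0, 1:] :: real poly"
  \<comment> \<open>The boundary terms at 1 and -1 are both k + 1/2 and add up, since the factor x
    changes sign between them.\<close>
  have 1: "ipoly (pderiv ?p * (?x * ?p)) = 2 * (real k + 1/2) - ipoly (?p * pderiv (?x * ?p))"
    by (subst ipoly_by_parts)
       (simp add: legendre_at_1 legendre_at_minus_1 power_mult_distrib flip: power2_eq_square power_mult)
  have "?p * pderiv (?x * ?p) = pderiv ?p * (?x * ?p) + ?p * ?p"
    by (simp add: pderiv_mult pderiv_pCons algebra_simps)
  hence 2: "2 * ipoly (pderiv ?p * (?x * ?p)) = 2 * (real k + 1/2) - ipoly (?p * ?p)"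
    using 1 by (simp add: ipoly_add)
  define q where "q = ?x * pderiv ?p - smult (real k) ?p"
  have "ipoly (?p * q) = 0"
  proof (cases "k = 0")
    case True
    hence "pderiv ?p = 0" using pderiv_eq_0_iff[of ?p] degree_legendre by simp
    thus ?thesis using True by (simp add: q_def)
  next
    case False
    \<comment> \<open>Multiplication by x undoes the index shift of the derivative, so the
      coefficient of x^i in x p' is i times that in p; the coefficients of degree k cancel in
      \<open>q\<close>.\<close>
    have "coeff q i = 0" if "i \<ge> k" for i
    proof (cases i)
      case 0
      with that False show ?thesis by simp
    next
      case (Suc j)
      show ?thesis
      proof (cases "i = k")
        case True
        thus ?thesis using Suc by (auto simp: q_def coeff_pderiv)
      next
        case False
        hence "coeff ?p i = 0" using that degree_legendre by (simp add: coeff_eq_0)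
        thus ?thesis using Suc by (simp add: q_def coeff_pderiv)
      qed
    qed
    hence "degree q < k" using False by (metis coeff_0 leading_coeff_0_iff not_less degree_0 neq0_conv)
    thus ?thesis by (rule legendre_orthogonal_lower_degree)
  qed
  moreover have "?p * q = pderiv ?p * (?x * ?p) - smult (real k) (?p * ?p)"
    by (simp add: q_def algebra_simps)
  ultimately have "ipoly (pderiv ?p * (?x * ?p)) = real k * ipoly (?p * ?p)"
    by (simp add: ipoly_diff ipoly_smult)
  hence "(2 * real k + 1) * (ipoly (?p * ?p) - 1) = 0" using 2 by (simp add: algebra_simps)
  thus ?thesis by (simp add: add_nonneg_eq_0_iff)
qed

lemma legendre_orthonormal: "ipoly (legendre k * legendre l) = (if k = l then 1 else 0)"
proof -
  have "ipoly (legendre a * legendre b) = 0" if "b < a" for a b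
    using that by (simp add: legendre_orthogonal_lower_degree degree_legendre)
  thus ?thesis
    by (metis legendre_normalized linorder_neqE_nat mult.commute)
qed

lemma legendre_expansion: "degree g \<le> n \<Longrightarrow> \<exists>a. g = (\<Sum>l\<le>n. smult (a l) (legendre l))"
proof (induction n arbitrary: g)
  case 0
  hence "g = smult (coeff g 0 / coeff (legendre 0) 0) (legendre 0)"
    using degree_legendre[of 0] legendre_at_1[of 0]
    by (auto elim!: degree_eq_zeroE)
  thus ?case by (intro exI[of _ "\<lambda>_. coeff g 0 / coeff (legendre 0) 0"]) simp
next
  case (Suc n)
  let ?L = "legendre (Suc n)"
  define c where "c = coeff g (Suc n) / coeff ?L (Suc n)"
  have nz: "coeff ?L (Suc n) \<noteq> 0"
    using degree_legendre[of "Suc n"] leading_coeff_0_iff[of ?L] by fastforce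
  have "degree (g - smult c ?L) \<le> n"
  proof (rule degree_le, intro allI impI)
    fix i assume "n < i"
    show "coeff (g - smult c ?L) i = 0"
    proof (cases "i = Suc n")
      case True
      thus ?thesis using nz by (simp add: c_def)
    next
      case False
      hence "i > Suc n" using \<open>n < i\<close> by simp
      thus ?thesis using Suc.prems degree_legendre[of "Suc n"] by (simp add: coeff_eq_0)
    qed
  qed
  then obtain a where a: "g - smult c ?L = (\<Sum>l\<le>n. smult (a l) (legendre l))" using Suc.IH by blast
  have "g = (\<Sum>l\<le>Suc n. smult ((a(Suc n := c)) l) (legendre l))"
    using a by (simp add: algebra_simps)
  thus ?case by blast
qed

text \<open>Nikolskii's inequality at an endpoint, by Cauchy-Schwarz for the Legendre expansion.\<close>

lemma poly_at_1_le:
  assumes "degree g \<le> n"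
  shows "(poly g 1)\<^sup>2 \<le> (real n + 1)\<^sup>2 * ipoly (g * g)"
proof -
  obtain a where a: "g = (\<Sum>l\<le>n. smult (a l) (legendre l))" using legendre_expansion[OF assms] by blast
  have "ipoly (g * g) = (\<Sum>l\<le>n. \<Sum>m\<le>n. ipoly (smult (a l * a m) (legendre l * legendre m)))"
    by (subst (1 2) a) (simp add: sum_product ipoly_sum mult.commute)
  also have "\<dots> = (\<Sum>l\<le>n. \<Sum>m\<le>n. a l * a m * (if l = m then 1 else 0))"
    by (simp only: ipoly_smult legendre_orthonormal)
  also have "\<dots> = (\<Sum>l\<le>n. (a l)\<^sup>2)"
    by (intro sum.cong refl) (simp add: power2_eq_square if_distrib[of "\<lambda>x. _ * x"] cong: if_cong)
  finally have I: "ipoly (g * g) = (\<Sum>l\<le>n. (a l)\<^sup>2)" .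
  have "(poly g 1)\<^sup>2 = (\<Sum>l\<le>n. a l * sqrt (real l + 1/2))\<^sup>2"
    by (subst a) (simp add: poly_sum legendre_at_1)
  also have "\<dots> \<le> (\<Sum>l\<le>n. (a l)\<^sup>2) * (\<Sum>l\<le>n. (sqrt (real l + 1/2))\<^sup>2)"
    by (rule Cauchy_Schwarz_ineq_sum)
  \<comment> \<open>The second sum equals (n+1)^2 / 2, so replacing l + 1/2 by n + 1 costs only a
    factor 2.\<close>
  also have "\<dots> \<le> (\<Sum>l\<le>n. (a l)\<^sup>2) * (\<Sum>l\<le>n. real n + 1)"
    by (intro mult_left_mono sum_mono sum_nonneg) auto
  finally show ?thesis using I by (simp add: power2_eq_square algebra_simps)
qed

section \<open>Growth of the derivatives at the endpoints and in norm\<close>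

lemma legendre_deriv_eq_0: "k < m \<Longrightarrow> legendre_deriv m k x = 0"
  by (simp add: legendre_deriv_def higher_pderiv_eq_0 degree_legendre)

text \<open>By the recurrence, the derivative of order m + 1 at an endpoint arises from that of
  order m, up to sign, through the factor (k+m+1)(k-m) / (2(m+1)). For m < k it is at most k^2;
  beyond order k the derivatives vanish.\<close>

lemma legendre_deriv_endpoint_le:
  assumes "x\<^sup>2 = 1" "1 \<le> k"
  shows "\<bar>legendre_deriv m k x\<bar> \<le> sqrt (real k + 1/2) * real k ^ (2 * m)"
proof (induction m)
  case 0
  have "x = 1 \<or> x = -1" using assms by (simp add: power2_eq_1_iff)
  thus ?case by (auto simp: legendre_deriv_def legendre_at_1 legendre_at_minus_1 abs_mult power_abs)
next
  case (Suc m)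
  show ?case
  proof (cases "k < Suc m")
    case True
    thus ?thesis by (simp add: legendre_deriv_eq_0 del: power_Suc)
  next
    case False
    have [simp]: "\<bar>x\<bar> = 1" using assms by (simp add: abs_square_eq_1)
    have "\<bar>2 * (real m + 1) * x * legendre_deriv (Suc m) k x\<bar>
        = \<bar>(real k + real m + 1) * (real k - real m) * legendre_deriv m k x\<bar>"
      using legendre_deriv_recurrence[OF assms(1), of m k] by simp
    hence "2 * (real m + 1) * \<bar>legendre_deriv (Suc m) k x\<bar>
        = (real k + real m + 1) * (real k - real m) * \<bar>legendre_deriv m k x\<bar>"
      using False by (simp add: abs_mult)
    also have "\<dots> \<le> (2 * real k) * real k * \<bar>legendre_deriv m k x\<bar>"
      using False by (intro mult_right_mono mult_mono) auto
    finally have "2 * (real m + 1) * \<bar>legendre_deriv (Suc m) k x\<bar> \<le> 2 * (real k * real k * \<bar>legendre_deriv m k x\<bar>)"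
      by simp
    moreover have "2 * 1 * \<bar>legendre_deriv (Suc m) k x\<bar> \<le> 2 * (real m + 1) * \<bar>legendre_deriv (Suc m) k x\<bar>"
      by (intro mult_right_mono mult_left_mono) auto
    ultimately have "\<bar>legendre_deriv (Suc m) k x\<bar> \<le> real k * real k * \<bar>legendre_deriv m k x\<bar>" by simp
    also have "\<dots> \<le> real k * real k * (sqrt (real k + 1/2) * real k ^ (2 * m))"
      using Suc by (intro mult_left_mono) auto
    finally show ?thesis by (simp add: algebra_simps)
  qed
qed

text \<open>While m < r and 2r is at most k, the factor k - m in the recurrence is at least k/2, so
  each differentiation multiplies the value by at least k^2 / (4r).\<close>

lemma legendre_deriv_at_1_ge:
  assumes "2 * r \<le> k" "m \<le> r" "1 \<le> r"
  shows "sqrt (real k) * (real k ^ 2 / (4 * real r)) ^ m \<le> legendre_deriv m k 1"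
  using assms(2)
proof (induction m)
  case 0
  thus ?case by (simp add: legendre_deriv_def legendre_at_1)
next
  case (Suc m)
  hence nn: "0 \<le> legendre_deriv m k 1" by (smt (verit) Suc_leD divide_nonneg_nonneg mult_nonneg_nonneg of_nat_0_le_iff
    real_sqrt_ge_0_iff zero_le_power)
  have "real k * (real k / 2) * legendre_deriv m k 1 \<le> (real k + real m + 1) * (real k - real m) * legendre_deriv m k 1"
    using nn assms Suc.prems by (intro mult_right_mono mult_mono) auto
  also have "\<dots> = 2 * (real m + 1) * legendre_deriv (Suc m) k 1"
    using legendre_deriv_recurrence[of 1 m k] by simp
  finally have "real k ^ 2 / (4 * (real m + 1)) * legendre_deriv m k 1 \<le> legendre_deriv (Suc m) k 1"
    by (simp add: field_simps power2_eq_square)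
  moreover have "real k ^ 2 / (4 * real r) * legendre_deriv m k 1 \<le> real k ^ 2 / (4 * (real m + 1)) * legendre_deriv m k 1"
    using nn Suc.prems by (intro mult_right_mono divide_left_mono) auto
  moreover have "real k ^ 2 / (4 * real r) * (sqrt (real k) * (real k ^ 2 / (4 * real r)) ^ m)
      \<le> real k ^ 2 / (4 * real r) * legendre_deriv m k 1"
    using Suc by (intro mult_left_mono) auto
  ultimately show ?case by (simp add: algebra_simps)
qed

text \<open>Integration by parts \<open>r\<close> times leaves only boundary terms, because the last integrand is
  \<open>p\<close> times a polynomial of smaller degree.\<close>

lemma ipoly_deriv_square_le:
  assumes "degree p = k" and "1 \<le> k" and orth: "\<And>q. degree q < k \<Longrightarrow> ipoly (p * q) = 0"
    and bd: "\<And>x m. x\<^sup>2 = 1 \<Longrightarrow> \<bar>poly ((pderiv ^^ m) p) x\<bar> \<le> c * real k ^ (2 * m)"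
    and "1 \<le> r"
  shows "ipoly ((pderiv ^^ r) p * (pderiv ^^ r) p) \<le> real r * (2 * c\<^sup>2 * real k ^ (4 * r - 2))"
proof -
  let ?D = "\<lambda>m. (pderiv ^^ m) p"
  have cnn: "0 \<le> c" using bd[of 1 0] by simp
  have step: "i \<le> r \<Longrightarrow> \<bar>ipoly (?D r * ?D r)\<bar> \<le> \<bar>ipoly (?D (r - i) * ?D (r + i))\<bar> + real i * (2 * c\<^sup>2 * real k ^ (4 * r - 2))" for i
  proof (induction i)
    case 0
    then show ?case by simp
  next
    case (Suc i)
    define j where "j = r - Suc i"
    have j: "r - i = Suc j" "r = j + Suc i" using Suc.prems by (auto simp: j_def)
    \<comment> \<open>The two orders j and r + i always add up to 2r - 1. Every boundary term
      therefore has the same bound, and two of them arise in each of the r steps.\<close>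
    have b: "\<bar>poly (?D j) x * poly (?D (r + i)) x\<bar> \<le> c\<^sup>2 * real k ^ (4 * r - 2)" if "x\<^sup>2 = 1" for x :: real
    proof -
      have "\<bar>poly (?D j) x * poly (?D (r + i)) x\<bar> \<le> (c * real k ^ (2 * j)) * (c * real k ^ (2 * (r + i)))"
        unfolding abs_mult using cnn by (intro mult_mono bd that) auto
      also have "\<dots> = c\<^sup>2 * real k ^ (2 * j + 2 * (r + i))" by (simp add: power2_eq_square power_add)
      also have "2 * j + 2 * (r + i) = 4 * r - 2" using j by simp
      finally show ?thesis .
    qed
    have "ipoly (?D (r - i) * ?D (r + i)) = ipoly (pderiv (?D j) * ?D (r + i))" by (simp add: j)
    also have "\<dots> = poly (?D j) 1 * poly (?D (r + i)) 1 - poly (?D j) (-1) * poly (?D (r + i)) (-1)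
        - ipoly (?D j * pderiv (?D (r + i)))" by (rule ipoly_by_parts)
    also have "pderiv (?D (r + i)) = ?D (r + Suc i)" by simp
    finally have "\<bar>ipoly (?D (r - i) * ?D (r + i))\<bar> \<le> 2 * (c\<^sup>2 * real k ^ (4 * r - 2)) + \<bar>ipoly (?D j * ?D (r + Suc i))\<bar>"
      using b[of 1] b[of "-1"] by simp
    thus ?case using Suc by (simp add: j_def algebra_simps)
  qed
  have "degree (?D (r + r)) < k" using assms by (simp add: degree_higher_pderiv del: funpow.simps)
  hence "ipoly (?D (r - r) * ?D (r + r)) = 0" using orth by simp
  thus ?thesis using step[of r] by simp
qed

definition deriv_norm :: "nat \<Rightarrow> nat \<Rightarrow> real" where
  "deriv_norm r k = sqrt (ipoly ((pderiv ^^ r) (legendre k) * (pderiv ^^ r) (legendre k)))"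

lemma deriv_norm_le:
  assumes "1 \<le> k" "1 \<le> r"
  shows "deriv_norm r k \<le> 2 * sqrt (real r) * real k powr (2 * real r - 1 / 2)"
proof -
  have "ipoly ((pderiv ^^ r) (legendre k) * (pderiv ^^ r) (legendre k))
      \<le> real r * (2 * (sqrt (real k + 1/2))\<^sup>2 * real k ^ (4 * r - 2))"
    using assms legendre_deriv_endpoint_le
    by (intro ipoly_deriv_square_le legendre_orthogonal_lower_degree degree_legendre)
       (auto simp: legendre_deriv_def)
  \<comment> \<open>One power of k comes from the squared normalization, as 2(k + 1/2) is at most
    4k. It raises 4r - 2 to 4r - 1, twice the claimed exponent.\<close>
  also have "\<dots> \<le> real r * (4 * real k * real k ^ (4 * r - 2))"
    using assms by (intro mult_left_mono mult_right_mono) auto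
  also have "\<dots> = 4 * real r * real k ^ (4 * r - 1)"
    using assms by (cases r) (auto simp: numeral_eq_Suc)
  also have "\<dots> = 4 * real r * real k powr (4 * real r - 1)"
    using assms by (subst powr_realpow[symmetric]) (auto simp: of_nat_diff)
  also have "\<dots> = (2 * sqrt (real r) * real k powr (2 * real r - 1 / 2))\<^sup>2"
    
    by (simp add: power_mult_distrib power2_eq_square[of "_ powr _"] flip: powr_add)
  finally show ?thesis unfolding deriv_norm_def by (intro real_le_lsqrt) auto
qed

subsection \<open>Series in \<open>L\<^sub>2(Q)\<close>\<close>

lemma Q_cbox: "Q = cbox (-1, -1) (1, 1)"
  by (simp add: Q_def cbox_Pair_eq)

lemma Q_lebesgue: "Q \<in> sets lebesgue"
  by (simp add: Q_cbox)

lemma L2_Q_D: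
  assumes "f \<in> L2_Q"
  shows "f \<in> borel_measurable (lebesgue_on Q)" "integrable (lebesgue_on Q) (\<lambda>z. (f z)\<^sup>2)"
  using assms by (auto simp: L2_Q_def)

lemma L2_Q_cmult: "f \<in> L2_Q \<Longrightarrow> (\<lambda>z. c * f z) \<in> L2_Q"
  by (auto simp: L2_Q_def power_mult_distrib)

text \<open>Cauchy-Schwarz with free weights. For a = b = 1 it shows that sums are square
  integrable; with weights close to the two norms it integrates to Minkowski's inequality.\<close>

lemma weighted_square_add_le:
  fixes u v a b :: real
  assumes "0 < a" "0 < b"
  shows "(u + v)\<^sup>2 \<le> (a + b) * (u\<^sup>2 / a + v\<^sup>2 / b)"
proof -
  have "(a + b) * (u\<^sup>2 / a + v\<^sup>2 / b) - (u + v)\<^sup>2 = (b * u - a * v)\<^sup>2 / (a * b)"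
    using assms by (simp add: field_simps power2_eq_square)
  thus ?thesis using assms by (smt (verit) divide_nonneg_pos mult_pos_pos zero_le_power2)
qed

lemma L2_Q_add:
  assumes "f \<in> L2_Q" "g \<in> L2_Q"
  shows "(\<lambda>z. f z + g z) \<in> L2_Q"
proof -
  note m = L2_Q_D[OF assms(1)] L2_Q_D[OF assms(2)]
  have "integrable (lebesgue_on Q) (\<lambda>z. (f z + g z)\<^sup>2)"
  proof (rule Bochner_Integration.integrable_bound)
    show "integrable (lebesgue_on Q) (\<lambda>z. 2 * ((f z)\<^sup>2 + (g z)\<^sup>2))" using m by simp
    show "(\<lambda>z. (f z + g z)\<^sup>2) \<in> borel_measurable (lebesgue_on Q)" using m by measurable
    show "AE z in lebesgue_on Q. norm ((f z + g z)\<^sup>2) \<le> norm (2 * ((f z)\<^sup>2 + (g z)\<^sup>2))"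
      using weighted_square_add_le[of 1 1] by (intro AE_I2) simp
  qed
  thus ?thesis using m by (simp add: L2_Q_def)
qed

lemma L2_Q_diff: "f \<in> L2_Q \<Longrightarrow> g \<in> L2_Q \<Longrightarrow> (\<lambda>z. f z - g z) \<in> L2_Q"
  using L2_Q_add[of f "\<lambda>z. -1 * g z"] L2_Q_cmult[of g "-1"] by simp

lemma L2_Q_sum: "(\<And>i. i \<in> F \<Longrightarrow> h i \<in> L2_Q) \<Longrightarrow> (\<lambda>z. \<Sum>i\<in>F. h i z) \<in> L2_Q"
  by (induction F rule: infinite_finite_induct) (auto simp: L2_Q_add, auto simp: L2_Q_def)

lemma L2_norm_nonneg: "0 \<le> L2_norm f"
  by (simp add: L2_norm_def)

lemma L2_norm_cmult: "L2_norm (\<lambda>z. c * f z) = \<bar>c\<bar> * L2_norm f"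
  by (simp add: L2_norm_def power_mult_distrib real_sqrt_mult)

lemma L2_norm_minus_commute: "L2_norm (\<lambda>z. f z - g z) = L2_norm (\<lambda>z. g z - f z)"
  by (simp add: L2_norm_def power2_commute)

lemma L2_norm_square: "(L2_norm f)\<^sup>2 = (LINT z|lebesgue_on Q. (f z)\<^sup>2)"
  by (simp add: L2_norm_def)

lemma L2_norm_add_le:
  assumes "f \<in> L2_Q" "g \<in> L2_Q"
  shows "L2_norm (\<lambda>z. f z + g z) \<le> L2_norm f + L2_norm g"
proof (rule field_le_epsilon)
  fix e :: real assume "0 < e"
  \<comment> \<open>The optimal weights are the norms themselves; e/2 keeps them positive when a
    norm is zero.\<close>
  define a where "a = L2_norm f + e / 2"
  define b where "b = L2_norm g + e / 2"
  have pos: "0 < a" "0 < b"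
    using \<open>0 < e\<close> L2_norm_nonneg[of f] L2_norm_nonneg[of g] by (auto simp: a_def b_def)
  have int: "integrable (lebesgue_on Q) (\<lambda>z. (a + b) * ((f z)\<^sup>2 / a + (g z)\<^sup>2 / b))"
    by (intro integrable_mult_right Bochner_Integration.integrable_add
          Bochner_Integration.integrable_divide_zero L2_Q_D(2) assms impI)
  have "(L2_norm (\<lambda>z. f z + g z))\<^sup>2 \<le> (LINT z|lebesgue_on Q. (a + b) * ((f z)\<^sup>2 / a + (g z)\<^sup>2 / b))"
    unfolding L2_norm_square
    by (rule integral_mono[OF L2_Q_D(2)[OF L2_Q_add[OF assms]] int weighted_square_add_le[OF pos]])
  also have "\<dots> = (a + b) * ((L2_norm f)\<^sup>2 / a + (L2_norm g)\<^sup>2 / b)"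
    unfolding L2_norm_square
    using L2_Q_D(2)[OF assms(1)] L2_Q_D(2)[OF assms(2)] by simp
  also have "\<dots> \<le> (a + b) * (a\<^sup>2 / a + b\<^sup>2 / b)"
    using pos \<open>0 < e\<close> L2_norm_nonneg[of f] L2_norm_nonneg[of g]
    by (intro mult_left_mono add_mono divide_right_mono power_mono) (auto simp: a_def b_def)
  also have "\<dots> = (a + b)\<^sup>2" using pos by (simp add: power2_eq_square)
  finally have "L2_norm (\<lambda>z. f z + g z) \<le> a + b" by (rule power2_le_imp_le) (use pos in auto)
  thus "L2_norm (\<lambda>z. f z + g z) \<le> L2_norm f + L2_norm g + e" by (simp add: a_def b_def)
qed

lemma L2_norm_triangle:
  assumes "f \<in> L2_Q" "g \<in> L2_Q" "h \<in> L2_Q"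
  shows "L2_norm (\<lambda>z. f z - h z) \<le> L2_norm (\<lambda>z. f z - g z) + L2_norm (\<lambda>z. g z - h z)"
  using L2_norm_add_le[OF L2_Q_diff[OF assms(1,2)] L2_Q_diff[OF assms(2,3)]] by simp

lemma L2_norm_sum_le:
  assumes "\<And>i. i \<in> F \<Longrightarrow> h i \<in> L2_Q"
  shows "L2_norm (\<lambda>z. \<Sum>i\<in>F. h i z) \<le> (\<Sum>i\<in>F. L2_norm (h i))"
  using assms
proof (induction F rule: infinite_finite_induct)
  case (insert i F)
  thus ?case
    using L2_norm_add_le[of "h i" "\<lambda>z. \<Sum>i\<in>F. h i z"] L2_Q_sum[of F h] by auto
qed (auto simp: L2_norm_def)

section \<open>Tensor products of polynomials\<close>

lemma tensor_integral:
  "integrable (lebesgue_on Q) (\<lambda>z. poly p (fst z) * poly q (snd z))"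
  "(LINT z|lebesgue_on Q. poly p (fst z) * poly q (snd z)) = ipoly p * ipoly q"
proof -
  have c: "continuous_on (cbox (-1, -1) (1, 1)) (\<lambda>z. poly p (fst z) * poly q (snd z :: real))"
    by (intro continuous_intros)
  thus i: "integrable (lebesgue_on Q) (\<lambda>z. poly p (fst z) * poly q (snd z))"
    unfolding Q_cbox by (rule continuous_imp_integrable)
  have "(LINT z|lebesgue_on Q. poly p (fst z) * poly q (snd z))
      = integral (cbox (-1, -1) (1, 1)) (\<lambda>z. poly p (fst z) * poly q (snd z))"
    using lebesgue_integral_eq_integral[OF i Q_lebesgue] by (simp add: Q_cbox)
  also have "\<dots> = ipoly p * ipoly q"
    by (subst integral_prod_continuous[OF c]) (simp add: ipoly_def)
  finally show "(LINT z|lebesgue_on Q. poly p (fst z) * poly q (snd z)) = ipoly p * ipoly q" .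
qed

lemma tensor_L2_Q: "(\<lambda>z. poly p (fst z) * poly q (snd z)) \<in> L2_Q"
proof -
  have "(\<lambda>z. (poly p (fst z) * poly q (snd z))\<^sup>2) = (\<lambda>z. poly (p * p) (fst z) * poly (q * q) (snd z))"
    by (auto simp: power2_eq_square)
  thus ?thesis
    using tensor_integral(1)[of "p * p" "q * q"] borel_measurable_integrable[OF tensor_integral(1)[of p q]]
    by (simp add: L2_Q_def)
qed

lemma L2_norm_tensor:
  "L2_norm (\<lambda>z. poly p (fst z) * poly q (snd z)) = sqrt (ipoly (p * p)) * sqrt (ipoly (q * q))"
proof -
  have "(\<lambda>z. (poly p (fst z) * poly q (snd z))\<^sup>2) = (\<lambda>z. poly (p * p) (fst z) * poly (q * q) (snd z))"
    by (auto simp: power2_eq_square)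
  thus ?thesis using tensor_integral(2)[of "p * p" "q * q"]
    by (simp add: L2_norm_def real_sqrt_mult)
qed

section \<open>Differentiated basis functions and their series\<close>

definition deriv_basis :: "nat \<Rightarrow> nat \<Rightarrow> nat \<times> nat \<Rightarrow> real \<times> real \<Rightarrow> real" where
  "deriv_basis r1 r2 i z = legendre_deriv r1 (fst i) (fst z) * legendre_deriv r2 (snd i) (snd z)"

lemma deriv_sum_alt: "deriv_sum r1 r2 F c z = (\<Sum>i\<in>F. c i * deriv_basis r1 r2 i z)"
  by (simp add: deriv_sum_def deriv_basis_def case_prod_beta mult.assoc)

lemma deriv_basis_L2_Q: "deriv_basis r1 r2 i \<in> L2_Q"
  unfolding deriv_basis_def legendre_deriv_def by (rule tensor_L2_Q)

lemma L2_norm_deriv_basis: "L2_norm (deriv_basis r1 r2 i) = deriv_norm r1 (fst i) * deriv_norm r2 (snd i)"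
  unfolding deriv_basis_def legendre_deriv_def deriv_norm_def by (rule L2_norm_tensor)

lemma deriv_sum_L2_Q: "deriv_sum r1 r2 F c \<in> L2_Q"
  unfolding deriv_sum_alt by (intro L2_Q_sum L2_Q_cmult deriv_basis_L2_Q)

lemma L2_norm_deriv_sum_le:
  assumes "\<And>i. i \<in> F \<Longrightarrow> L2_norm (deriv_basis r1 r2 i) \<le> w i"
  shows "L2_norm (deriv_sum r1 r2 F c) \<le> (\<Sum>i\<in>F. \<bar>c i\<bar> * w i)"
proof -
  have "L2_norm (deriv_sum r1 r2 F c) \<le> (\<Sum>i\<in>F. L2_norm (\<lambda>z. c i * deriv_basis r1 r2 i z))"
    unfolding deriv_sum_alt by (intro L2_norm_sum_le L2_Q_cmult deriv_basis_L2_Q)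
  also have "\<dots> \<le> (\<Sum>i\<in>F. \<bar>c i\<bar> * w i)"
    unfolding L2_norm_cmult by (intro sum_mono mult_left_mono assms) auto
  finally show ?thesis .
qed

text \<open>By monotone convergence the sum of the series has finite integral, so it is finite
  almost everywhere.\<close>

lemma AE_summable_nonneg:
  fixes h :: "nat \<Rightarrow> 'a \<Rightarrow> real"
  assumes int: "\<And>n. integrable M (h n)" and nn: "\<And>n x. 0 \<le> h n x"
    and sm: "summable (\<lambda>n. integral\<^sup>L M (h n))"
  shows "AE x in M. summable (\<lambda>n. h n x)"
proof -
  have meas[measurable]: "h n \<in> borel_measurable M" for n using int by auto
  have "(\<integral>\<^sup>+x. (\<Sum>n. ennreal (h n x)) \<partial>M) = (\<Sum>n. \<integral>\<^sup>+x. ennreal (h n x) \<partial>M)"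
    by (intro nn_integral_suminf) measurable
  also have "\<dots> = (\<Sum>n. ennreal (integral\<^sup>L M (h n)))"
    by (intro suminf_cong nn_integral_eq_integral int) (simp add: nn)
  also have "\<dots> \<noteq> \<infinity>"
    by (subst suminf_ennreal2[OF _ sm]) (auto intro: integral_nonneg_AE nn)
  finally have "AE x in M. (\<Sum>n. ennreal (h n x)) \<noteq> \<infinity>"
    by (intro nn_integral_PInf_AE) auto
  thus ?thesis
    by eventually_elim (auto intro!: summable_suminf_not_top nn)
qed

text \<open>The split into |x| w and |x| y^2 / w suits functions y of norm at most w: the first sum
  is a tail of a convergent series, and the second has an integral controlled by the same
  series.\<close>

lemma weighted_Cauchy_Schwarz_sum:
  fixes x y w :: "'a \<Rightarrow> real"
  assumes "\<And>i. i \<in> G \<Longrightarrow> 0 < w i"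
  shows "(\<Sum>i\<in>G. \<bar>x i * y i\<bar>)\<^sup>2 \<le> (\<Sum>i\<in>G. \<bar>x i\<bar> * w i) * (\<Sum>i\<in>G. \<bar>x i\<bar> * (y i)\<^sup>2 / w i)"
proof -
  have "(\<Sum>i\<in>G. \<bar>x i * y i\<bar>) = (\<Sum>i\<in>G. sqrt (\<bar>x i\<bar> * w i) * sqrt (\<bar>x i\<bar> * (y i)\<^sup>2 / w i))"
  proof (intro sum.cong refl)
    fix i assume "i \<in> G"
    hence "(\<bar>x i\<bar> * w i) * (\<bar>x i\<bar> * (y i)\<^sup>2 / w i) = (x i * y i)\<^sup>2"
      using assms[of i] by (simp add: power_mult_distrib power2_eq_square[of "x i"])
    thus "\<bar>x i * y i\<bar> = sqrt (\<bar>x i\<bar> * w i) * sqrt (\<bar>x i\<bar> * (y i)\<^sup>2 / w i)"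
      by (simp only: real_sqrt_mult[symmetric] real_sqrt_abs)
  qed
  also have "\<dots>\<^sup>2 \<le> (\<Sum>i\<in>G. (sqrt (\<bar>x i\<bar> * w i))\<^sup>2) * (\<Sum>i\<in>G. (sqrt (\<bar>x i\<bar> * (y i)\<^sup>2 / w i))\<^sup>2)"
    by (rule Cauchy_Schwarz_ineq_sum)
  also have "\<dots> = (\<Sum>i\<in>G. \<bar>x i\<bar> * w i) * (\<Sum>i\<in>G. \<bar>x i\<bar> * (y i)\<^sup>2 / w i)"
    using assms by (intro arg_cong2[of _ _ _ _ "(*)"] sum.cong refl real_sqrt_pow2) (auto simp: less_imp_le)
  finally show ?thesis .
qed

text \<open>The majorant \<open>H\<close> dominates all tails pointwise by weighted Cauchy-Schwarz, which replaces
  the completeness of \<open>L\<^sub>2\<close>.\<close>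

lemma L2_series:
  fixes e :: "nat \<times> nat \<Rightarrow> real \<times> real \<Rightarrow> real" and x w :: "nat \<times> nat \<Rightarrow> real"
  assumes e: "\<And>i. e i \<in> L2_Q" and w: "\<And>i. i \<in> I \<Longrightarrow> L2_norm (e i) \<le> w i" "\<And>i. i \<in> I \<Longrightarrow> 0 < w i"
    and sm: "(\<lambda>i. \<bar>x i\<bar> * w i) summable_on I"
  obtains g where "g \<in> L2_Q"
    "((\<lambda>F. L2_norm (\<lambda>z. g z - (\<Sum>i\<in>F. x i * e i z))) \<longlongrightarrow> 0) (finite_subsets_at_top I)"
proof -
  define M where "M = lebesgue_on Q"
  have eM[measurable]: "e i \<in> borel_measurable M" and eint: "integrable M (\<lambda>z. (e i z)\<^sup>2)" for i
    using L2_Q_D[OF e[of i]] by (auto simp: M_def)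
  \<comment> \<open>The pairs are enumerated so that the theorems on measurability and integration
    of sequences apply; absolute convergence makes the order irrelevant.\<close>
  have bij: "bij_betw prod_decode UNIV UNIV" by (rule bij_prod_decode)
  \<comment> \<open>Division by w i makes the integral of each term at most |x i| w i, so the
    majorant inherits the summability of \<open>sm\<close>.\<close>
  define hh where "hh i z = (if i \<in> I then \<bar>x i\<bar> * (e i z)\<^sup>2 / w i else 0)" for i z
  define h where "h n = hh (prod_decode n)" for n
  have hh_nn: "0 \<le> hh i z" for i z using w(2)[of i] by (auto simp: hh_def intro!: divide_nonneg_pos)
  have hh_int: "integrable M (hh i)" for i
    using eint[of i] by (cases "i \<in> I") (auto simp: hh_def[abs_def])
  have hh_le: "integral\<^sup>L M (hh i) \<le> \<bar>x i\<bar> * w i" if "i \<in> I" for i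
  proof -
    have "integral\<^sup>L M (hh i) = \<bar>x i\<bar> * (L2_norm (e i))\<^sup>2 / w i"
      using that by (simp add: hh_def[abs_def] L2_norm_square M_def)
    also have "\<dots> \<le> \<bar>x i\<bar> * (w i)\<^sup>2 / w i"
      using w[OF that] L2_norm_nonneg[of "e i"] by (intro divide_right_mono mult_left_mono power_mono) auto
    also have "\<dots> = \<bar>x i\<bar> * w i" using w(2)[OF that] by (simp add: power2_eq_square)
    finally show ?thesis .
  qed
  have "(\<lambda>i. integral\<^sup>L M (hh i)) summable_on I"
    by (rule summable_on_comparison_test[OF sm]) (auto intro: hh_le integral_nonneg_AE hh_nn)
  hence "(\<lambda>i. integral\<^sup>L M (hh i)) summable_on UNIV"
    by (subst summable_on_cong_neutral[where T = I and g = "\<lambda>i. integral\<^sup>L M (hh i)"])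
       (auto simp: hh_def[abs_def])
  hence "(\<lambda>n. integral\<^sup>L M (h n)) summable_on UNIV"
    unfolding h_def by (subst summable_on_reindex_bij_betw[OF bij, of "\<lambda>i. integral\<^sup>L M (hh i)"])
  hence sm_h: "summable (\<lambda>n. integral\<^sup>L M (h n))" by (rule summable_on_imp_summable)
  have AE1: "AE z in M. summable (\<lambda>n. h n z)"
    by (rule AE_summable_nonneg[OF _ _ sm_h]) (auto simp: h_def hh_int hh_nn)
  define H where "H z = (\<Sum>n. h n z)" for z
  have Hint: "integrable M H"
    unfolding H_def
    by (rule integrable_suminf) (use AE1 sm_h in \<open>auto simp: h_def hh_int hh_nn\<close>)
  define T where "T F = (\<Sum>\<^sub>\<infinity>i\<in>I - F. \<bar>x i\<bar> * w i)" for F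
  \<comment> \<open>This pointwise series is measurable. Where it diverges its value is a default,
    which is harmless because \<open>AE1\<close> confines these points to a null set.\<close>
  define g where "g z = (\<Sum>n. if prod_decode n \<in> I then x (prod_decode n) * e (prod_decode n) z else 0)" for z
  have gM[measurable]: "g \<in> borel_measurable M" unfolding g_def by measurable
  have key: "(g z - (\<Sum>i\<in>F. x i * e i z))\<^sup>2 \<le> T F * H z"
    if smz: "summable (\<lambda>n. h n z)" and F: "finite F" "F \<subseteq> I" for z F
  proof -
    have "(\<lambda>n. h n z) summable_on UNIV"
      using smz by (intro summable_nonneg_imp_summable_on) (auto simp: h_def hh_nn)
    hence hsU: "(\<lambda>i. hh i z) summable_on UNIV"
      unfolding h_def by (subst (asm) summable_on_reindex_bij_betw[OF bij, of "\<lambda>i. hh i z"])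
    have HU: "H z = (\<Sum>\<^sub>\<infinity>i. hh i z)"
    proof -
      have "((\<lambda>n. h n z) has_sum (\<Sum>\<^sub>\<infinity>n. h n z)) UNIV"
        using \<open>(\<lambda>n. h n z) summable_on UNIV\<close> by simp
      hence "H z = (\<Sum>\<^sub>\<infinity>n. h n z)" unfolding H_def by (intro sums_unique[symmetric] has_sum_imp_sums)
      thus ?thesis unfolding h_def using infsum_reindex_bij_betw[OF bij, of "\<lambda>i. hh i z"] by simp
    qed
    have CS: "(\<Sum>i\<in>G. \<bar>x i * e i z\<bar>) \<le> sqrt (T F * H z)" if G: "finite G" "G \<subseteq> I - F" for F G
    proof (rule real_le_rsqrt)
      have "(\<Sum>i\<in>G. \<bar>x i * e i z\<bar>)\<^sup>2 \<le> (\<Sum>i\<in>G. \<bar>x i\<bar> * w i) * (\<Sum>i\<in>G. \<bar>x i\<bar> * (e i z)\<^sup>2 / w i)"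
        using G w by (intro weighted_Cauchy_Schwarz_sum) auto
      also have "(\<Sum>i\<in>G. \<bar>x i\<bar> * (e i z)\<^sup>2 / w i) = (\<Sum>i\<in>G. hh i z)"
        using G by (intro sum.cong) (auto simp: hh_def)
      also have "(\<Sum>i\<in>G. \<bar>x i\<bar> * w i) * (\<Sum>i\<in>G. hh i z) \<le> T F * H z"
      proof (intro mult_mono)
        show "(\<Sum>i\<in>G. \<bar>x i\<bar> * w i) \<le> T F" unfolding T_def
          using G less_imp_le[OF w(2)]
          by (intro finite_sum_le_infsum summable_on_subset_banach[OF sm] mult_nonneg_nonneg) auto
        thus "0 \<le> T F" using G w(2) by (smt (verit) DiffD1 abs_ge_zero mult_nonneg_nonneg subsetD sum_nonneg)
        show "(\<Sum>i\<in>G. hh i z) \<le> H z" unfolding HU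
          using G hsU by (intro finite_sum_le_infsum) (auto simp: hh_nn)
      qed (auto intro: sum_nonneg hh_nn)
      finally show "(\<Sum>i\<in>G. \<bar>x i * e i z\<bar>)\<^sup>2 \<le> T F * H z" .
    qed
    \<comment> \<open>With no terms removed, \<open>CS\<close> bounds all finite sums of absolute
      values, which gives absolute convergence at z.\<close>
    have abs_sm: "(\<lambda>i. \<bar>x i * e i z\<bar>) summable_on I"
      by (rule nonneg_bdd_above_summable_on) (use CS[of _ "{}"] in \<open>auto intro!: bdd_aboveI2\<close>)
    hence xe_sm: "(\<lambda>i. x i * e i z) summable_on I"
      using abs_summable_summable[of "\<lambda>i. x i * e i z" I] by simp
    have gz: "g z = (\<Sum>\<^sub>\<infinity>i\<in>I. x i * e i z)"
    proof -
      let ?f = "\<lambda>i. if i \<in> I then x i * e i z else 0"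
      have "(?f has_sum (\<Sum>\<^sub>\<infinity>i\<in>I. x i * e i z)) UNIV"
        using xe_sm by (subst has_sum_cong_neutral[where T = I and g = "\<lambda>i. x i * e i z"]) auto
      hence "((\<lambda>n. ?f (prod_decode n)) has_sum (\<Sum>\<^sub>\<infinity>i\<in>I. x i * e i z)) UNIV"
        by (subst has_sum_reindex_bij_betw[OF bij, of ?f])
      thus ?thesis unfolding g_def by (intro sums_unique[symmetric] has_sum_imp_sums)
    qed
    have "g z - (\<Sum>i\<in>F. x i * e i z) = (\<Sum>\<^sub>\<infinity>i\<in>I - F. x i * e i z)"
      unfolding gz using F xe_sm by (subst infsum_Diff) auto
    moreover have "\<bar>\<Sum>\<^sub>\<infinity>i\<in>I - F. x i * e i z\<bar> \<le> sqrt (T F * H z)"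
    proof -
      have s: "(\<lambda>i. \<bar>x i * e i z\<bar>) summable_on I - F"
        by (rule summable_on_subset_banach[OF abs_sm]) auto
      have "\<bar>\<Sum>\<^sub>\<infinity>i\<in>I - F. x i * e i z\<bar> \<le> (\<Sum>\<^sub>\<infinity>i\<in>I - F. \<bar>x i * e i z\<bar>)"
        using norm_infsum_bound[of "\<lambda>i. x i * e i z" "I - F"] s by simp
      also have "\<dots> \<le> sqrt (T F * H z)"
        by (rule infsum_le_finite_sums[OF s CS])
      finally show ?thesis .
    qed
    ultimately have "\<bar>g z - (\<Sum>i\<in>F. x i * e i z)\<bar>\<^sup>2 \<le> (sqrt (T F * H z))\<^sup>2"
      by (intro power_mono) auto
    moreover have "0 \<le> T F * H z" using CS[of "{}" F] by simp
    ultimately show ?thesis by simp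
  qed
  have AE2: "AE z in M. (g z - (\<Sum>i\<in>F. x i * e i z))\<^sup>2 \<le> T F * H z" if "finite F" "F \<subseteq> I" for F
    using AE1 by eventually_elim (use key that in auto)
  have gL: "g \<in> L2_Q"
  proof -
    have "integrable M (\<lambda>z. (g z)\<^sup>2)"
    proof (rule Bochner_Integration.integrable_bound)
      show "integrable M (\<lambda>z. T {} * H z)" using Hint by simp
      show "AE z in M. norm ((g z)\<^sup>2) \<le> norm (T {} * H z)"
        using AE2[of "{}"] by simp (auto elim: eventually_mono)
    qed measurable
    thus ?thesis using gM by (simp add: L2_Q_def M_def)
  qed
  have bound: "L2_norm (\<lambda>z. g z - (\<Sum>i\<in>F. x i * e i z)) \<le> sqrt (T F * integral\<^sup>L M H)"
    if "finite F" "F \<subseteq> I" for F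
  proof -
    have "(\<lambda>z. g z - (\<Sum>i\<in>F. x i * e i z)) \<in> L2_Q"
      by (intro L2_Q_diff gL L2_Q_sum L2_Q_cmult e)
    hence "(L2_norm (\<lambda>z. g z - (\<Sum>i\<in>F. x i * e i z)))\<^sup>2 \<le> (LINT z|M. T F * H z)"
      unfolding L2_norm_square M_def[symmetric]
      using Hint AE2[OF that] by (intro integral_mono_AE) (auto dest: L2_Q_D simp: M_def)
    thus ?thesis using L2_norm_nonneg by (simp add: real_le_rsqrt)
  qed
  have "(T \<longlongrightarrow> 0) (finite_subsets_at_top I)"
  proof -
    have "((\<lambda>F. (\<Sum>\<^sub>\<infinity>i\<in>I. \<bar>x i\<bar> * w i) - (\<Sum>i\<in>F. \<bar>x i\<bar> * w i)) \<longlongrightarrow>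
        (\<Sum>\<^sub>\<infinity>i\<in>I. \<bar>x i\<bar> * w i) - (\<Sum>\<^sub>\<infinity>i\<in>I. \<bar>x i\<bar> * w i)) (finite_subsets_at_top I)"
      by (intro tendsto_intros infsum_tendsto sm)
    moreover have "\<forall>\<^sub>F F in finite_subsets_at_top I.
        (\<Sum>\<^sub>\<infinity>i\<in>I. \<bar>x i\<bar> * w i) - (\<Sum>i\<in>F. \<bar>x i\<bar> * w i) = T F"
      by (rule eventually_finite_subsets_at_top_weakI)
         (use sm in \<open>auto simp: T_def infsum_Diff\<close>)
    ultimately show ?thesis by (subst (asm) tendsto_cong) auto
  qed
  hence "((\<lambda>F. sqrt (T F * integral\<^sup>L M H)) \<longlongrightarrow> sqrt (0 * integral\<^sup>L M H)) (finite_subsets_at_top I)"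
    by (intro tendsto_intros)
  hence lim: "((\<lambda>F. sqrt (T F * integral\<^sup>L M H)) \<longlongrightarrow> 0) (finite_subsets_at_top I)"
    by simp
  have "((\<lambda>F. L2_norm (\<lambda>z. g z - (\<Sum>i\<in>F. x i * e i z))) \<longlongrightarrow> 0) (finite_subsets_at_top I)"
  proof (rule tendsto_sandwich[OF _ _ tendsto_const lim])
    show "\<forall>\<^sub>F F in finite_subsets_at_top I. L2_norm (\<lambda>z. g z - (\<Sum>i\<in>F. x i * e i z)) \<le> sqrt (T F * integral\<^sup>L M H)"
      by (rule eventually_finite_subsets_at_top_weakI) (rule bound)
  qed (simp_all add: L2_norm_nonneg)
  with gL show ?thesis using that by blast
qed

text \<open>For finite F containing \<Gamma>, the partial sums over F and \<Gamma> differ by the sum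
  over F - \<Gamma>, of norm at most T; then F grows and the distance to g vanishes. With T = 0 this
  also yields uniqueness for finite expansions.\<close>

lemma has_mixed_deriv_minus_partial_le:
  assumes g: "has_mixed_deriv r1 r2 f g" and \<Gamma>: "finite \<Gamma>" "\<Gamma> \<subseteq> {r1..} \<times> {r2..}"
    and w: "\<And>i. i \<in> {r1..} \<times> {r2..} \<Longrightarrow> L2_norm (deriv_basis r1 r2 i) \<le> w i"
    and T: "\<And>F. finite F \<Longrightarrow> F \<subseteq> {r1..} \<times> {r2..} - \<Gamma> \<Longrightarrow> (\<Sum>i\<in>F. \<bar>legendre_coeff f i\<bar> * w i) \<le> T"
  shows "L2_norm (\<lambda>z. g z - deriv_sum r1 r2 \<Gamma> (legendre_coeff f) z) \<le> T"
proof -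
  let ?c = "legendre_coeff f"
  let ?D = "\<lambda>F. deriv_sum r1 r2 F ?c"
  have gL: "g \<in> L2_Q" and lim: "((\<lambda>F. L2_norm (\<lambda>z. g z - ?D F z)) \<longlongrightarrow> 0) (finite_subsets_at_top ({r1..} \<times> {r2..}))"
    using g by (auto simp: has_mixed_deriv_def)
  have "((\<lambda>F. L2_norm (\<lambda>z. g z - ?D F z) + T) \<longlongrightarrow> 0 + T) (finite_subsets_at_top ({r1..} \<times> {r2..}))"
    by (intro tendsto_intros lim)
  moreover have "\<forall>\<^sub>F F in finite_subsets_at_top ({r1..} \<times> {r2..}).
      L2_norm (\<lambda>z. g z - ?D \<Gamma> z) \<le> L2_norm (\<lambda>z. g z - ?D F z) + T"
    unfolding eventually_finite_subsets_at_top
  proof (intro exI[of _ \<Gamma>] conjI \<Gamma> allI impI; elim conjE)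
    fix F assume F: "finite F" "\<Gamma> \<subseteq> F" "F \<subseteq> {r1..} \<times> {r2..}"
    have "(\<lambda>z. ?D F z - ?D \<Gamma> z) = ?D (F - \<Gamma>)"
      using F by (auto simp: deriv_sum_alt sum_diff)
    moreover have "L2_norm (?D (F - \<Gamma>)) \<le> (\<Sum>i\<in>F - \<Gamma>. \<bar>?c i\<bar> * w i)"
      using F by (intro L2_norm_deriv_sum_le w) auto
    moreover have "\<dots> \<le> T" using F by (intro T) auto
    ultimately show "L2_norm (\<lambda>z. g z - ?D \<Gamma> z) \<le> L2_norm (\<lambda>z. g z - ?D F z) + T"
      using L2_norm_triangle[OF gL deriv_sum_L2_Q[of r1 r2 F ?c] deriv_sum_L2_Q[of r1 r2 \<Gamma> ?c]] by simp
  qed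
  ultimately show ?thesis
    using tendsto_lowerbound finite_subsets_at_top_neq_bot by fastforce
qed

text \<open>The tail bound T serves twice. Together with the finite sum over \<Gamma> it bounds all
  weighted partial sums, so that a mixed derivative exists and the inner infimum is finite; it then
  bounds the truncation part of the error, while E bounds the propagated noise.\<close>

lemma truncation_recovery_error_le:
  assumes \<Gamma>: "finite \<Gamma>" "\<Gamma> \<subseteq> {r1..} \<times> {r2..}"
    and w: "\<And>i. i \<in> {r1..} \<times> {r2..} \<Longrightarrow> L2_norm (deriv_basis r1 r2 i) \<le> w i"
           "\<And>i. i \<in> {r1..} \<times> {r2..} \<Longrightarrow> 0 < w i"
    and T: "\<And>f F. f \<in> smoothness_class s \<mu> \<Longrightarrow> smoothness_norm s \<mu> f \<le> 1 \<Longrightarrow>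
       finite F \<Longrightarrow> F \<subseteq> {r1..} \<times> {r2..} - \<Gamma> \<Longrightarrow> (\<Sum>i\<in>F. \<bar>legendre_coeff f i\<bar> * w i) \<le> T"
    and N: "\<And>f y. y \<in> perturbed_data p \<delta> f \<Longrightarrow> (\<Sum>i\<in>\<Gamma>. \<bar>legendre_coeff f i - y i\<bar> * w i) \<le> E"
  shows "recovery_error r1 r2 s \<mu> p \<delta> \<Gamma> (deriv_sum r1 r2 \<Gamma>) \<le> ennreal (T + E)"
  unfolding recovery_error_def
proof (intro SUP_least)
  fix f y assume f: "f \<in> {f \<in> smoothness_class s \<mu>. smoothness_norm s \<mu> f \<le> 1}" and y: "y \<in> perturbed_data p \<delta> f"
  let ?I = "{r1..} \<times> {r2..}" and ?c = "legendre_coeff f"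
  have "(\<lambda>i. \<bar>?c i\<bar> * w i) summable_on ?I"
  proof (rule nonneg_bdd_above_summable_on)
    show nn: "0 \<le> \<bar>?c i\<bar> * w i" if "i \<in> ?I" for i using w(2)[OF that] by simp
    show "bdd_above (sum (\<lambda>i. \<bar>?c i\<bar> * w i) ` {F. F \<subseteq> ?I \<and> finite F})"
    proof (rule bdd_aboveI2)
      fix F assume F: "F \<in> {F. F \<subseteq> ?I \<and> finite F}"
      have "(\<Sum>i\<in>F. \<bar>?c i\<bar> * w i) \<le> (\<Sum>i\<in>(F - \<Gamma>) \<union> \<Gamma>. \<bar>?c i\<bar> * w i)"
        using F \<Gamma> by (intro sum_mono2 nn) auto
      also have "\<dots> = (\<Sum>i\<in>F - \<Gamma>. \<bar>?c i\<bar> * w i) + (\<Sum>i\<in>\<Gamma>. \<bar>?c i\<bar> * w i)"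
        using F \<Gamma> by (intro sum.union_disjoint) auto
      also have "(\<Sum>i\<in>F - \<Gamma>. \<bar>?c i\<bar> * w i) \<le> T" using f F by (intro T) auto
      finally show "(\<Sum>i\<in>F. \<bar>?c i\<bar> * w i) \<le> T + (\<Sum>i\<in>\<Gamma>. \<bar>?c i\<bar> * w i)" by simp
    qed
  qed
  then obtain g where g: "g \<in> L2_Q"
    "((\<lambda>F. L2_norm (\<lambda>z. g z - (\<Sum>i\<in>F. ?c i * deriv_basis r1 r2 i z))) \<longlongrightarrow> 0) (finite_subsets_at_top ?I)"
    using L2_series[of "deriv_basis r1 r2" ?I w ?c] deriv_basis_L2_Q w by blast
  hence md: "has_mixed_deriv r1 r2 f g" by (simp add: has_mixed_deriv_def deriv_sum_alt)
  have info: "deriv_sum r1 r2 \<Gamma> (information \<Gamma> y) = deriv_sum r1 r2 \<Gamma> y"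
    by (rule ext) (auto simp: deriv_sum_alt information_def intro!: sum.cong)
  have "L2_norm (\<lambda>z. g z - deriv_sum r1 r2 \<Gamma> y z)
      \<le> L2_norm (\<lambda>z. g z - deriv_sum r1 r2 \<Gamma> ?c z) + L2_norm (\<lambda>z. deriv_sum r1 r2 \<Gamma> ?c z - deriv_sum r1 r2 \<Gamma> y z)"
    by (intro L2_norm_triangle g deriv_sum_L2_Q)
  also have "L2_norm (\<lambda>z. g z - deriv_sum r1 r2 \<Gamma> ?c z) \<le> T"
    using f by (intro has_mixed_deriv_minus_partial_le[OF md \<Gamma> w(1)] T) auto
  also have "(\<lambda>z. deriv_sum r1 r2 \<Gamma> ?c z - deriv_sum r1 r2 \<Gamma> y z) = deriv_sum r1 r2 \<Gamma> (\<lambda>i. ?c i - y i)"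
    by (rule ext) (simp add: deriv_sum_alt sum_subtractf algebra_simps)
  also have "L2_norm \<dots> \<le> (\<Sum>i\<in>\<Gamma>. \<bar>?c i - y i\<bar> * w i)"
    using \<Gamma> by (intro L2_norm_deriv_sum_le w) auto
  also have "\<dots> \<le> E" by (rule N[OF y])
  finally have "ennreal (L2_norm (\<lambda>z. g z - deriv_sum r1 r2 \<Gamma> (information \<Gamma> y) z)) \<le> ennreal (T + E)"
    by (simp add: info ennreal_leI)
  thus "(INF g\<in>{g. has_mixed_deriv r1 r2 f g}. ennreal (L2_norm (\<lambda>z. g z - deriv_sum r1 r2 \<Gamma> (information \<Gamma> y) z))) \<le> ennreal (T + E)"
    using md by (intro INF_lower2) auto
qed

subsection \<open>The lower bound\<close>

lemma tensor_legendre_coeff: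
  "legendre_coeff (\<lambda>z. poly P (fst z) * poly R (snd z)) (k, j)
     = ipoly (P * legendre k) * ipoly (R * legendre j)"
proof -
  have "(\<lambda>z. poly P (fst z) * poly R (snd z) * poly (legendre k) (fst z) * poly (legendre j) (snd z))
      = (\<lambda>z. poly (P * legendre k) (fst z) * poly (R * legendre j) (snd z))"
    by (auto simp: mult_ac)
  thus ?thesis using tensor_integral(2)[of "P * legendre k" "R * legendre j"]
    by (simp add: legendre_coeff_def)
qed

lemma legendre_coeff_in_perturbed_data:
  "0 \<le> \<delta> \<Longrightarrow> legendre_coeff f \<in> perturbed_data p \<delta> f"
  by (simp add: perturbed_data_def lp_space_def lp_norm_def)

text \<open>Equal information forces the same reconstruction \<open>u\<close> for both functions,
  and \<open>u\<close> cannot be closer than half the distance to both derivatives. The derivatives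
  enter through uniqueness: without any, the inner infimum is infinite and the bound holds all the
  more.\<close>

lemma recovery_error_ge_half_distance:
  assumes f: "f1 \<in> smoothness_class s \<mu>" "smoothness_norm s \<mu> f1 \<le> 1"
             "f2 \<in> smoothness_class s \<mu>" "smoothness_norm s \<mu> f2 \<le> 1"
    and info: "information \<Omega> (legendre_coeff f1) = information \<Omega> (legendre_coeff f2)"
    and \<psi>: "\<psi> \<in> recovery_maps \<Omega>" and \<delta>: "0 \<le> \<delta>"
    and d: "d1 \<in> L2_Q" "d2 \<in> L2_Q"
    and d1: "\<And>g. has_mixed_deriv r1 r2 f1 g \<Longrightarrow> L2_norm (\<lambda>z. g z - d1 z) = 0"
    and d2: "\<And>g. has_mixed_deriv r1 r2 f2 g \<Longrightarrow> L2_norm (\<lambda>z. g z - d2 z) = 0"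
  shows "ennreal (L2_norm (\<lambda>z. d1 z - d2 z) / 2) \<le> recovery_error r1 r2 s \<mu> p \<delta> \<Omega> \<psi>"
proof -
  define u where "u = \<psi> (information \<Omega> (legendre_coeff f1))"
  have u: "u \<in> L2_Q" using \<psi> by (auto simp: u_def recovery_maps_def information_def)
  have ge: "ennreal (L2_norm (\<lambda>z. d z - u z)) \<le> recovery_error r1 r2 s \<mu> p \<delta> \<Omega> \<psi>"
    if f: "f \<in> smoothness_class s \<mu>" "smoothness_norm s \<mu> f \<le> 1" and dL: "d \<in> L2_Q"
      and dd: "\<And>g. has_mixed_deriv r1 r2 f g \<Longrightarrow> L2_norm (\<lambda>z. g z - d z) = 0"
      and uf: "u = \<psi> (information \<Omega> (legendre_coeff f))" for f d
  proof -
    have "ennreal (L2_norm (\<lambda>z. d z - u z))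
        \<le> (INF g\<in>{g. has_mixed_deriv r1 r2 f g}. ennreal (L2_norm (\<lambda>z. g z - u z)))"
    proof (intro INF_greatest ennreal_leI)
      fix g assume g: "g \<in> {g. has_mixed_deriv r1 r2 f g}"
      hence "g \<in> L2_Q" by (simp add: has_mixed_deriv_def)
      from L2_norm_triangle[OF dL this u] show "L2_norm (\<lambda>z. d z - u z) \<le> L2_norm (\<lambda>z. g z - u z)"
        using dd[of g] g L2_norm_minus_commute[of d g] by simp
    qed
    also have "\<dots> \<le> recovery_error r1 r2 s \<mu> p \<delta> \<Omega> \<psi>"
      unfolding recovery_error_def uf
      by (rule SUP_upper2[of f], use f in simp, rule SUP_upper2[of "legendre_coeff f"])
         (simp_all add: legendre_coeff_in_perturbed_data \<delta>)
    finally show ?thesis .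
  qed
  have "L2_norm (\<lambda>z. d1 z - d2 z) \<le> L2_norm (\<lambda>z. d1 z - u z) + L2_norm (\<lambda>z. d2 z - u z)"
    using L2_norm_triangle[OF d(1) u d(2)] L2_norm_minus_commute[of u d2] by simp
  hence "L2_norm (\<lambda>z. d1 z - d2 z) / 2 \<le> L2_norm (\<lambda>z. d1 z - u z)
       \<or> L2_norm (\<lambda>z. d1 z - d2 z) / 2 \<le> L2_norm (\<lambda>z. d2 z - u z)" by linarith
  moreover have "u = \<psi> (information \<Omega> (legendre_coeff f2))" by (simp add: u_def info)
  ultimately show ?thesis
    using ge[OF f(1,2) d(1) d1 u_def] ge[OF f(3,4) d(2) d2]
    by (meson ennreal_leI order_trans)
qed

section \<open>Extremal functions supported in one row of coefficients\<close>

definition test_function :: "nat set \<Rightarrow> nat \<Rightarrow> real \<Rightarrow> real \<times> real \<Rightarrow> real" where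
  "test_function K m a z = poly (smult a (\<Sum>k\<in>K. legendre k)) (fst z) * poly (legendre m) (snd z)"

definition test_derivative :: "nat \<Rightarrow> nat \<Rightarrow> nat set \<Rightarrow> nat \<Rightarrow> real \<Rightarrow> real \<times> real \<Rightarrow> real" where
  "test_derivative r1 r2 K m a z =
     poly (smult a (\<Sum>k\<in>K. (pderiv ^^ r1) (legendre k))) (fst z) * poly ((pderiv ^^ r2) (legendre m)) (snd z)"

lemma test_function_coeff:
  assumes "finite K"
  shows "legendre_coeff (test_function K m a) (k, j) = (if k \<in> K \<and> j = m then a else 0)"
  unfolding test_function_def tensor_legendre_coeff
  using assms by (simp add: ipoly_smult sum_distrib_right ipoly_sum legendre_orthonormal)

lemma test_function_L2_Q: "test_function K m a \<in> L2_Q"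
  unfolding test_function_def by (rule tensor_L2_Q)

lemma test_derivative_L2_Q: "test_derivative r1 r2 K m a \<in> L2_Q"
  unfolding test_derivative_def by (rule tensor_L2_Q)

text \<open>All nonzero coefficients lie in \<open>K \<times> {m}\<close>, so the tail outside this
  set is bounded by 0.\<close>

lemma test_function_mixed_deriv:
  assumes K: "finite K" "K \<subseteq> {r1..}" "r2 \<le> m" and g: "has_mixed_deriv r1 r2 (test_function K m a) g"
  shows "L2_norm (\<lambda>z. g z - test_derivative r1 r2 K m a z) = 0"
proof -
  let ?c = "legendre_coeff (test_function K m a)"
  have "L2_norm (\<lambda>z. g z - deriv_sum r1 r2 (K \<times> {m}) ?c z) \<le> 0"
  proof (rule has_mixed_deriv_minus_partial_le[OF g, where w = "\<lambda>i. L2_norm (deriv_basis r1 r2 i)"])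
    fix F assume "finite F" "F \<subseteq> {r1..} \<times> {r2..} - K \<times> {m}"
    hence "\<bar>?c i\<bar> * L2_norm (deriv_basis r1 r2 i) = 0" if "i \<in> F" for i
      using that K by (cases i) (auto simp: test_function_coeff)
    hence "(\<Sum>i\<in>F. \<bar>?c i\<bar> * L2_norm (deriv_basis r1 r2 i)) = 0" by (intro sum.neutral ballI)
    thus "(\<Sum>i\<in>F. \<bar>?c i\<bar> * L2_norm (deriv_basis r1 r2 i)) \<le> 0" by simp
  qed (use K in auto)
  moreover have "deriv_sum r1 r2 (K \<times> {m}) ?c = test_derivative r1 r2 K m a"
  proof
    fix z
    have "deriv_sum r1 r2 (K \<times> {m}) ?c z = (\<Sum>k\<in>K. a * deriv_basis r1 r2 (k, m) z)"
      unfolding deriv_sum_alt using K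
      by (simp add: sum.cartesian_product' test_function_coeff)
    thus "deriv_sum r1 r2 (K \<times> {m}) ?c z = test_derivative r1 r2 K m a z"
      by (simp add: test_derivative_def deriv_basis_def legendre_deriv_def poly_sum sum_distrib_left
            sum_distrib_right mult_ac)
  qed
  ultimately show ?thesis using L2_norm_nonneg by (metis order_antisym)
qed

lemma test_function_smoothness:
  assumes K: "finite K" and "1 \<le> m" "K \<subseteq> {1..}" and s: "1 \<le> s"
    and le: "(\<Sum>k\<in>K. (real k * real m) powr (s * \<mu>) * \<bar>a\<bar> powr s) \<le> 1"
  shows "test_function K m a \<in> smoothness_class s \<mu>" "smoothness_norm s \<mu> (test_function K m a) \<le> 1"
proof -
  let ?t = "smoothness_term s \<mu> (test_function K m a)"
  have z: "?t i = 0" if "i \<notin> K \<times> {m}" for i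
    using that K by (cases i) (auto simp: smoothness_term_def test_function_coeff)
  have "(?t has_sum (\<Sum>i\<in>K \<times> {m}. ?t i)) (K \<times> {m})" using K by (intro has_sum_finite) auto
  hence hs: "(?t has_sum (\<Sum>i\<in>K \<times> {m}. ?t i)) UNIV"
    by (rule has_sum_cong_neutral[THEN iffD1, rotated -1]) (use z in auto)
  have "(\<Sum>i\<in>K \<times> {m}. ?t i) = (\<Sum>k\<in>K. (real k * real m) powr (s * \<mu>) * \<bar>a\<bar> powr s)"
    unfolding sum.cartesian_product'[symmetric] using assms
    by (auto simp: smoothness_term_def test_function_coeff sum.cartesian_product' max_def intro!: sum.cong)
  hence "0 \<le> (\<Sum>i\<in>K \<times> {m}. ?t i)" "(\<Sum>i\<in>K \<times> {m}. ?t i) \<le> 1"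
    using le by (auto intro!: sum_nonneg)
  thus "smoothness_norm s \<mu> (test_function K m a) \<le> 1"
    unfolding smoothness_norm_def infsumI[OF hs] using s by (intro powr_le1) auto
  show "test_function K m a \<in> smoothness_class s \<mu>"
    using hs test_function_L2_Q by (auto simp: smoothness_class_def intro: has_sum_imp_summable)
qed

text \<open>At 1 the summands are positive and each is at least N^(2r+1/2), so the value there is at
  least N^(2r+3/2). The degree is of order N, hence \<open>poly_at_1_le\<close> loses just one power
  of N.\<close>

lemma legendre_deriv_sum_norm_ge:
  fixes N r D :: nat
  assumes r: "1 \<le> r" and N: "1 \<le> N" and K: "finite K" "N \<le> card K"
    and k: "\<And>k. k \<in> K \<Longrightarrow> 2 * r * N \<le> k \<and> k \<le> 2 * (r + 1) * N"
  defines "G \<equiv> (\<Sum>k\<in>K. (pderiv ^^ r) (legendre k))"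
  shows "real N powr (2 * real r + 1 / 2) / (2 * (real r + 2)) \<le> sqrt (ipoly (G * G))"
proof -
  have each: "sqrt (real N) * (real N)\<^sup>2 ^ r \<le> legendre_deriv r k 1" if kK: "k \<in> K" for k
  proof -
    have "2 * r * 1 \<le> 2 * r * N" using N by (intro mult_le_mono) auto
    also have "\<dots> \<le> k" using k[OF kK] by simp
    finally have "2 * r \<le> k" by simp
    hence "sqrt (real k) * (real k ^ 2 / (4 * real r)) ^ r \<le> legendre_deriv r k 1"
      using r by (intro legendre_deriv_at_1_ge) auto
    moreover have "sqrt (real N) * (real N)\<^sup>2 ^ r \<le> sqrt (real k) * (real k ^ 2 / (4 * real r)) ^ r"
    proof (intro mult_mono power_mono)
      \<comment> \<open>The degrees start at 2rN so that k^2 / (4r) is at least r N^2, which removes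
        r from the lower bound for the single derivatives.\<close>
      have kN: "2 * real r * real N \<le> real k"
        using k[OF kK] by (metis of_nat_le_iff of_nat_mult of_nat_numeral)
      have "1 * real N \<le> 2 * real r * real N" using r by (intro mult_right_mono) auto
      thus "sqrt (real N) \<le> sqrt (real k)" using kN by simp
      have "4 * real r * (real N)\<^sup>2 \<le> 4 * real r * real r * (real N)\<^sup>2"
        using r by (intro mult_right_mono) auto
      also have "\<dots> = (2 * real r * real N)\<^sup>2" by (simp add: power2_eq_square)
      also have "\<dots> \<le> (real k)\<^sup>2" using kN by (intro power_mono) auto
      finally show "(real N)\<^sup>2 \<le> (real k)\<^sup>2 / (4 * real r)" using r by (simp add: field_simps)
    qed auto
    ultimately show ?thesis by linarith
  qed
  have "real N * (sqrt (real N) * (real N)\<^sup>2 ^ r) \<le> real (card K) * (sqrt (real N) * (real N)\<^sup>2 ^ r)"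
    using K by (intro mult_right_mono) auto
  also have "\<dots> \<le> (\<Sum>k\<in>K. legendre_deriv r k 1)"
    using sum_bounded_below[of K "sqrt (real N) * (real N)\<^sup>2 ^ r" "\<lambda>k. legendre_deriv r k 1"] each by simp
  also have "\<dots> = poly G 1" by (simp add: G_def poly_sum legendre_deriv_def)
  finally have G1: "real N * (sqrt (real N) * (real N)\<^sup>2 ^ r) \<le> poly G 1" .
  have pos: "0 < real N" using N by simp
  have "(real N)\<^sup>2 ^ r = real N powr (2 * real r)"
    using powr_realpow[OF pos, of "2 * r"] by (simp add: power_mult)
  hence "real N * (sqrt (real N) * (real N)\<^sup>2 ^ r) = real N powr (2 * real r + 1 / 2) * real N"
    by (simp add: powr_add powr_half_sqrt)
  hence G2: "real N powr (2 * real r + 1 / 2) * real N \<le> poly G 1" using G1 by (simp only:)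
  have "degree ((pderiv ^^ r) (legendre k)) \<le> 2 * (r + 1) * N" if "k \<in> K" for k
    using k[OF that] unfolding degree_higher_pderiv degree_legendre by (meson diff_le_self le_trans)
  hence deg: "degree G \<le> 2 * (r + 1) * N" unfolding G_def using K by (intro degree_sum_le) auto
  let ?D = "real (2 * (r + 1) * N) + 1"
  have "(poly G 1)\<^sup>2 \<le> ?D\<^sup>2 * ipoly (G * G)" by (rule poly_at_1_le[OF deg])
  also have "\<dots> = (?D * sqrt (ipoly (G * G)))\<^sup>2"
    by (simp only: power_mult_distrib real_sqrt_pow2[OF ipoly_square_nonneg])
  finally have "poly G 1 \<le> ?D * sqrt (ipoly (G * G))"
    by (rule power2_le_imp_le) (simp add: ipoly_square_nonneg)
  also have "\<dots> \<le> (2 * (real r + 2) * real N) * sqrt (ipoly (G * G))"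
  proof (rule mult_right_mono)
    show "?D \<le> 2 * (real r + 2) * real N" using N by (simp add: algebra_simps)
  qed (simp add: ipoly_square_nonneg)
  finally have "real N powr (2 * real r + 1 / 2) * real N \<le> (2 * (real r + 2) * sqrt (ipoly (G * G))) * real N"
    using G2 by (simp add: mult_ac)
  hence "real N powr (2 * real r + 1 / 2) \<le> 2 * (real r + 2) * sqrt (ipoly (G * G))"
    using pos by (rule mult_right_le_imp_le)
  thus ?thesis by (simp add: pos_divide_le_eq mult_ac)
qed

text \<open>The degree 2r is the first one covered by \<open>legendre_deriv_at_1_ge\<close>; a
  polynomial that is nonzero at 1 has positive norm by \<open>poly_at_1_le\<close>. This makes row 2
  r2 usable for the extremal function.\<close>

lemma deriv_norm_pos:
  assumes "1 \<le> r"
  shows "0 < deriv_norm r (2 * r)"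
proof -
  let ?D = "(pderiv ^^ r) (legendre (2 * r))"
  have "0 < sqrt (real (2 * r)) * (real (2 * r) ^ 2 / (4 * real r)) ^ r" using assms by simp
  also have "\<dots> \<le> legendre_deriv r (2 * r) 1" using assms by (intro legendre_deriv_at_1_ge) auto
  finally have "0 < (poly ?D 1)\<^sup>2" by (simp add: legendre_deriv_def)
  also have "\<dots> \<le> (real (2 * r) + 1)\<^sup>2 * ipoly (?D * ?D)"
    by (rule poly_at_1_le) (simp add: degree_higher_pderiv degree_legendre)
  finally have "0 < ipoly (?D * ?D)" by (simp add: zero_less_mult_iff)
  thus ?thesis by (simp add: deriv_norm_def)
qed

text \<open>Among \<open>2 N\<close> consecutive degrees of size about \<open>N\<close>, at least \<open>N\<close> are not observed in the
  row \<open>m = 2 r2\<close>; the extremal function spreads its mass equally over them and has zero data, even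
  without noise.\<close>

lemma minimal_radius_ge:
  fixes s \<mu> :: real and p :: ereal and r1 r2 :: nat
  defines "B \<equiv> \<mu> - 2 * real r1 + 1 / s - 1 / 2"
  assumes s: "1 \<le> s" and r: "1 \<le> r2" "1 \<le> r1" and \<mu>: "0 \<le> \<mu>"
  shows "\<exists>c>0. \<forall>N\<ge>1. \<forall>\<delta>>0. ennreal (c * real N powr (- B)) \<le> minimal_radius r1 r2 s \<mu> p N \<delta>"
proof -
  define m where "m = 2 * r2"
  define d where "d = 2 * (real r1 + 1) * real m"
  define c where "c = d powr (-\<mu>) * 2 powr (- 1 / s) / (2 * (real r1 + 2)) * deriv_norm r2 m"
  have m: "1 \<le> m" "r2 \<le> m" using r by (auto simp: m_def)
  have d: "0 < d" using m by (simp add: d_def)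
  have c: "0 < c" using d deriv_norm_pos[OF r(1)] by (simp add: c_def m_def)
  have "ennreal (c * real N powr (- B)) \<le> recovery_error r1 r2 s \<mu> p \<delta> \<Omega> \<psi>"
    if N: "1 \<le> N" and \<delta>: "0 < \<delta>" and \<Omega>: "finite \<Omega>" "card \<Omega> \<le> N" and \<psi>: "\<psi> \<in> recovery_maps \<Omega>" for N \<delta> \<Omega> \<psi>
  proof -
    \<comment> \<open>The half-open interval has exactly 2N elements, so N observations leave at
      least N of them free.\<close>
    let ?R = "{2 * r1 * N..<2 * (r1 + 1) * N}"
    define K where "K = {k \<in> ?R. (k, m) \<notin> \<Omega>}"
    have K: "finite K" "K \<subseteq> ?R" by (auto simp: K_def)
    have "card {k \<in> ?R. (k, m) \<in> \<Omega>} \<le> card \<Omega>"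
      by (rule card_inj_on_le[of "\<lambda>k. (k, m)"]) (use \<Omega> in \<open>auto simp: inj_on_def\<close>)
    moreover have "card ?R = card K + card {k \<in> ?R. (k, m) \<in> \<Omega>}"
    proof -
      have "K \<union> {k \<in> ?R. (k, m) \<in> \<Omega>} = ?R" by (auto simp: K_def)
      moreover have "card (K \<union> {k \<in> ?R. (k, m) \<in> \<Omega>}) = card K + card {k \<in> ?R. (k, m) \<in> \<Omega>}"
        by (rule card_Un_disjoint) (auto simp: K_def)
      ultimately show ?thesis by (simp only:)
    qed
    ultimately have cardK: "N \<le> card K" using \<Omega> by (simp add: algebra_simps)
    have cardK': "card K \<le> 2 * N" using card_mono[OF _ K(2)] by (simp add: algebra_simps)
    have "r1 \<le> 2 * r1 * N" using N by simp
    hence "r1 \<le> k" if "k \<in> K" for k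
      using that K(2) by (meson atLeastLessThan_iff le_trans subsetD)
    hence Kr: "K \<subseteq> {r1..}" "K \<subseteq> {1..}" using r by (auto intro: le_trans)
    \<comment> \<open>At most 2N coefficients are used and k m is at most d N for each of them. This
      height therefore makes every smoothness term at most 1 / (2N).\<close>
    define h where "h = (d * real N) powr (-\<mu>) * (2 * real N) powr (- 1 / s)"
    have h: "0 < h" using d N by (simp add: h_def)
    have h_powr: "h powr s = (d * real N) powr (-(s * \<mu>)) * (2 * real N) powr (-1)"
    proof -
      have "(X powr (-\<mu>) * Y powr (- 1 / s)) powr s = X powr (-(s * \<mu>)) * Y powr (-1)" for X Y :: real
        using s by (simp add: powr_mult powr_powr mult.commute)
      thus ?thesis by (simp only: h_def)
    qed
    have le1: "(\<Sum>k\<in>K. (real k * real m) powr (s * \<mu>) * \<bar>a\<bar> powr s) \<le> 1" if a: "\<bar>a\<bar> = h" for a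
    proof -
      have "(\<Sum>k\<in>K. (real k * real m) powr (s * \<mu>) * \<bar>a\<bar> powr s)
          \<le> (\<Sum>k\<in>K. (d * real N) powr (s * \<mu>) * \<bar>a\<bar> powr s)"
      proof (intro sum_mono mult_right_mono powr_mono2)
        fix k assume "k \<in> K"
        hence "real k \<le> real (2 * (r1 + 1) * N)" using K(2) by (intro of_nat_mono) auto
        hence "real k * real m \<le> real (2 * (r1 + 1) * N) * real m" by (intro mult_right_mono) auto
        thus "real k * real m \<le> d * real N" by (simp add: d_def algebra_simps)
      qed (use s \<mu> in auto)
      also have "(d * real N) powr (s * \<mu>) * \<bar>a\<bar> powr s = 1 / (2 * real N)"
        using d N unfolding a h_powr
        by (simp add: powr_minus_divide[of "2 * real N" 1] flip: powr_add mult.assoc)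
      also have "(\<Sum>k\<in>K. 1 / (2 * real N)) \<le> 1" using cardK' N by simp
      finally show ?thesis .
    qed
    let ?f = "test_function K m" and ?g = "test_derivative r1 r2 K m"
    let ?G = "\<Sum>k\<in>K. (pderiv ^^ r1) (legendre k)"
    have info: "information \<Omega> (legendre_coeff (?f a)) = information \<Omega> (\<lambda>_. 0)" for a
      by (rule ext) (auto simp: information_def restrict_def test_function_coeff K_def)
    \<comment> \<open>The two competitors are the extremal function and its negative: both have zero
      data, and half the distance of their derivatives is the norm of one derivative.\<close>
    have "ennreal (L2_norm (\<lambda>z. ?g h z - ?g (-h) z) / 2) \<le> recovery_error r1 r2 s \<mu> p \<delta> \<Omega> \<psi>"
      using h \<delta>
      by (intro recovery_error_ge_half_distance[of "?f h" _ _ "?f (-h)"] test_function_smoothness le1 s \<psi>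
            test_derivative_L2_Q test_function_mixed_deriv[OF K(1) Kr(1) m(2)] K m Kr)
         (auto simp: info)
    also have "(\<lambda>z. ?g h z - ?g (-h) z) = (\<lambda>z. 2 * h * (poly ?G (fst z) * poly ((pderiv ^^ r2) (legendre m)) (snd z)))"
      by (auto simp: test_derivative_def algebra_simps)
    also have "L2_norm \<dots> / 2 = h * (sqrt (ipoly (?G * ?G)) * deriv_norm r2 m)"
      unfolding L2_norm_cmult L2_norm_tensor deriv_norm_def using h by simp
    finally have "ennreal (h * (sqrt (ipoly (?G * ?G)) * deriv_norm r2 m)) \<le> recovery_error r1 r2 s \<mu> p \<delta> \<Omega> \<psi>" .
    moreover have "c * real N powr (- B) \<le> h * (sqrt (ipoly (?G * ?G)) * deriv_norm r2 m)"
    proof -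
      have "real N powr (2 * real r1 + 1 / 2) / (2 * (real r1 + 2)) \<le> sqrt (ipoly (?G * ?G))"
        using K(2) by (intro legendre_deriv_sum_norm_ge r N K(1) cardK) auto
      hence "h * (real N powr (2 * real r1 + 1 / 2) / (2 * (real r1 + 2)) * deriv_norm r2 m)
          \<le> h * (sqrt (ipoly (?G * ?G)) * deriv_norm r2 m)"
        using h by (intro mult_left_mono mult_right_mono) (auto simp: deriv_norm_def ipoly_square_nonneg)
      moreover have "- B = -\<mu> + (- 1 / s + (2 * real r1 + 1 / 2))" by (simp add: B_def)
      hence "real N powr (- B) = real N powr (-\<mu>) * (real N powr (- 1 / s) * real N powr (2 * real r1 + 1 / 2))"
        by (simp only: powr_add)
      hence "c * real N powr (- B) = h * (real N powr (2 * real r1 + 1 / 2) / (2 * (real r1 + 2)) * deriv_norm r2 m)"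
        using d by (simp add: c_def h_def powr_mult mult_ac)
      ultimately show ?thesis by simp
    qed
    ultimately show ?thesis by (meson ennreal_leI order_trans)
  qed
  with c show ?thesis unfolding minimal_radius_def
    by (intro exI[of _ c] conjI allI impI INF_greatest) auto
qed

subsection \<open>Power sums over hyperbolic crosses\<close>

text \<open>The increment of x^(1-a) over [k, k+1] is taken at a mean value point, which is below
  2k; this is the origin of the factor 2^a.\<close>

lemma powr_le_telescope:
  fixes a :: real and k :: nat
  assumes a: "1 < a" and k: "1 \<le> k"
  shows "real k powr (-a) \<le> 2 powr a / (a - 1) * (real k powr (1 - a) - real (Suc k) powr (1 - a))"
proof -
  have "\<exists>z. real k < z \<and> z < real k + 1 \<and>
      (real k + 1) powr (1 - a) - real k powr (1 - a) = (real k + 1 - real k) * ((1 - a) * z powr (1 - a - 1))"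
    by (rule MVT2[OF _ has_real_derivative_powr]) (use k in auto)
  then obtain z where z: "real k < z" "z < real k + 1"
    "real k powr (1 - a) - (real k + 1) powr (1 - a) = (a - 1) * z powr (-a)"
    by (auto simp: algebra_simps)
  have "(2 * real k) powr (-a) \<le> z powr (-a)"
    using z k a by (intro powr_mono2') auto
  hence "real k powr (-a) \<le> 2 powr a * z powr (-a)"
    using k by (simp add: powr_mult powr_minus field_simps)
  also have "\<dots> = 2 powr a / (a - 1) * ((a - 1) * z powr (-a))" using a by simp
  finally show ?thesis using z(3) by (simp add: add.commute)
qed

text \<open>The estimates telescope from the least integer above x. Any positive real threshold is
  allowed, so x = 1/2 bounds the full sum over the positive integers.\<close>

lemma sum_powr_tail:
  fixes a x :: real
  assumes a: "1 < a" and x: "0 < x" and F: "finite F" "\<And>k. k \<in> F \<Longrightarrow> 1 \<le> k \<and> x < real k"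
  shows "(\<Sum>k\<in>F. real k powr (-a)) \<le> 2 powr a / (a - 1) * x powr (1 - a)"
proof -
  define m where "m = max 1 (nat \<lceil>x\<rceil>)"
  define M where "M = Suc (Max (insert m F))"
  let ?c = "2 powr a / (a - 1)"
  have m: "1 \<le> m" "x \<le> real m" by (auto simp: m_def) linarith+
  have mM: "m \<le> M" "F \<subseteq> {m..<M}"
  proof -
    show "m \<le> M" using F by (auto simp: M_def intro!: le_SucI)
    show "F \<subseteq> {m..<M}"
    proof
      fix k assume k: "k \<in> F"
      have "m \<le> k" using F(2)[OF k] by (simp add: m_def)
      thus "k \<in> {m..<M}" using F k by (simp add: M_def less_Suc_eq_le)
    qed
  qed
  have "(\<Sum>k\<in>F. real k powr (-a)) \<le> (\<Sum>k=m..<M. real k powr (-a))"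
    using mM by (intro sum_mono2) auto
  also have "\<dots> \<le> (\<Sum>k=m..<M. ?c * (real k powr (1 - a) - real (Suc k) powr (1 - a)))"
    using m a by (intro sum_mono powr_le_telescope) auto
  also have "\<dots> = ?c * (real m powr (1 - a) - real M powr (1 - a))"
    using sum_Suc_diff'[OF mM(1), of "\<lambda>k. - (real k powr (1 - a))"]
    by (subst sum_distrib_left[symmetric]) (simp del: of_nat_Suc)
  also have "\<dots> \<le> ?c * x powr (1 - a)"
  proof (rule mult_left_mono)
    have "real m powr (1 - a) \<le> x powr (1 - a)" using a x m by (intro powr_mono2') auto
    thus "real m powr (1 - a) - real M powr (1 - a) \<le> x powr (1 - a)"
      by (smt (verit) powr_ge_zero)
  qed (use a in auto)
  finally show ?thesis .
qed

section \<open>Summation row by row over the cross and its complement\<close>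

lemma sum_by_snd:
  fixes f :: "'a \<times> 'b \<Rightarrow> real"
  assumes "finite F"
  shows "sum f F = (\<Sum>j\<in>snd ` F. \<Sum>k\<in>{k. (k, j) \<in> F}. f (k, j))"
proof -
  have "sum f {i \<in> F. snd i = j} = (\<Sum>k\<in>{k. (k, j) \<in> F}. f (k, j))" for j
    by (rule sum.reindex_bij_witness[of _ "\<lambda>k. (k, j)" fst]) auto
  thus ?thesis using sum.image_gen[OF assms, of f snd] by simp
qed

lemma finite_section: "finite F \<Longrightarrow> finite {k. (k, j) \<in> F}"
  by (rule finite_subset[of _ "fst ` F"]) force+

lemma harmonic_sum_le:
  fixes n :: real
  assumes n: "1 \<le> n" and J: "finite J" "\<And>j. j \<in> J \<Longrightarrow> 1 \<le> j \<and> real j \<le> n"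
  shows "(\<Sum>j\<in>J. 1 / real j) \<le> 1 + ln n"
proof -
  define N where "N = nat \<lfloor>n\<rfloor>"
  have N: "1 \<le> N" "real N \<le> n" using n by (auto simp: N_def le_nat_floor)
  have "J \<subseteq> {1..N}"
  proof
    fix j assume "j \<in> J"
    thus "j \<in> {1..N}" using J(2)[of j] by (auto simp: N_def le_nat_floor)
  qed
  hence "(\<Sum>j\<in>J. 1 / real j) \<le> (\<Sum>j=1..N. 1 / real j)" by (intro sum_mono2) auto
  also have "\<dots> \<le> 1 + ln (real N)" using N(1)
  proof (induction N rule: dec_induct)
    case base
    show ?case by simp
  next
    case (step N)
    have "ln (real N / real (Suc N)) \<le> real N / real (Suc N) - 1"
      using step by (intro ln_le_minus_one) auto
    hence "1 / real (Suc N) \<le> ln (real (Suc N)) - ln (real N)"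
      using step by (simp add: ln_div field_simps)
    thus ?case using step by (simp add: atLeastAtMostSuc_conv del: of_nat_Suc)
  qed
  also have "\<dots> \<le> 1 + ln n" using N by simp
  finally show ?thesis .
qed

text \<open>The factor \<open>\<Lambda> n\<close> is \<open>1 + ln n\<close> for the isotropic cross (\<open>\<gamma> = 1\<close>) and \<open>1\<close> for the
  anisotropic one.\<close>

definition tail_bound :: "real \<Rightarrow> real \<Rightarrow> real \<Rightarrow> (real \<Rightarrow> real) \<Rightarrow> bool" where
  "tail_bound a b \<gamma> \<Lambda> \<longleftrightarrow> (\<exists>C>0. \<forall>n\<ge>1. \<forall>F. finite F \<longrightarrow>
     (\<forall>(k, j)\<in>F. 1 \<le> k \<and> 1 \<le> j \<and> n < real k * real j powr \<gamma>) \<longrightarrow>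
     (\<Sum>(k, j)\<in>F. real k powr (-a) * real j powr (-b)) \<le> C * n powr (1 - a) * \<Lambda> n)"

text \<open>The powers of n in this and the preceding definition are the orders of the single row j
  = 1, so \<Lambda> measures what the other rows add. Arbitrary finite subsets are allowed because
  the complement of the cross is infinite.\<close>

definition head_bound :: "real \<Rightarrow> real \<Rightarrow> real \<Rightarrow> (real \<Rightarrow> real) \<Rightarrow> bool" where
  "head_bound a b \<gamma> \<Lambda> \<longleftrightarrow> (\<exists>C>0. \<forall>n\<ge>1. \<forall>F. finite F \<longrightarrow>
     (\<forall>(k, j)\<in>F. 1 \<le> k \<and> 1 \<le> j \<and> real k * real j powr \<gamma> \<le> n) \<longrightarrow>
     (\<Sum>(k, j)\<in>F. real k powr a * real j powr b) \<le> C * n powr (1 + a) * \<Lambda> n)"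

lemma tail_boundE:
  assumes "tail_bound a b \<gamma> \<Lambda>"
  obtains C where "0 < C" and "\<And>n F. 1 \<le> n \<Longrightarrow> finite F \<Longrightarrow>
     (\<forall>(k, j)\<in>F. 1 \<le> k \<and> 1 \<le> j \<and> n < real k * real j powr \<gamma>) \<Longrightarrow>
     (\<Sum>(k, j)\<in>F. real k powr (-a) * real j powr (-b)) \<le> C * n powr (1 - a) * \<Lambda> n"
proof -
  from assms obtain C where C: "0 < C" "\<forall>n\<ge>1. \<forall>F. finite F \<longrightarrow>
     (\<forall>(k, j)\<in>F. 1 \<le> k \<and> 1 \<le> j \<and> n < real k * real j powr \<gamma>) \<longrightarrow>
     (\<Sum>(k, j)\<in>F. real k powr (-a) * real j powr (-b)) \<le> C * n powr (1 - a) * \<Lambda> n"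
    unfolding tail_bound_def by (elim exE conjE)
  show ?thesis by (rule that[OF C(1) C(2)[THEN spec, THEN mp, THEN spec, THEN mp, THEN mp]])
qed

lemma head_boundE:
  assumes "head_bound a b \<gamma> \<Lambda>"
  obtains C where "0 < C" and "\<And>n F. 1 \<le> n \<Longrightarrow> finite F \<Longrightarrow>
     (\<forall>(k, j)\<in>F. 1 \<le> k \<and> 1 \<le> j \<and> real k * real j powr \<gamma> \<le> n) \<Longrightarrow>
     (\<Sum>(k, j)\<in>F. real k powr a * real j powr b) \<le> C * n powr (1 + a) * \<Lambda> n"
proof -
  from assms obtain C where C: "0 < C" "\<forall>n\<ge>1. \<forall>F. finite F \<longrightarrow>
     (\<forall>(k, j)\<in>F. 1 \<le> k \<and> 1 \<le> j \<and> real k * real j powr \<gamma> \<le> n) \<longrightarrow>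
     (\<Sum>(k, j)\<in>F. real k powr a * real j powr b) \<le> C * n powr (1 + a) * \<Lambda> n"
    unfolding head_bound_def by (elim exE conjE)
  show ?thesis by (rule that[OF C(1) C(2)[THEN spec, THEN mp, THEN spec, THEN mp, THEN mp]])
qed

text \<open>In row j the condition reads k > n / j^\<gamma>, and the one-dimensional tail estimate
  applies at this threshold.\<close>

lemma tail_section_le:
  fixes F :: "(nat \<times> nat) set"
  assumes a: "1 < a" and n: "0 < n" and F: "finite F" "\<And>k j. (k, j) \<in> F \<Longrightarrow> 1 \<le> k \<and> 1 \<le> j \<and> n < real k * real j powr \<gamma>"
    and j: "j \<in> snd ` F"
  shows "(\<Sum>k\<in>{k. (k, j) \<in> F}. real k powr (-a)) \<le> 2 powr a / (a - 1) * (n powr (1 - a) * real j powr (\<gamma> * (a - 1)))"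
proof -
  have j1: "1 \<le> j" using j F by auto
  have "(\<Sum>k\<in>{k. (k, j) \<in> F}. real k powr (-a)) \<le> 2 powr a / (a - 1) * (n / real j powr \<gamma>) powr (1 - a)"
  proof (rule sum_powr_tail[OF a])
    show "0 < n / real j powr \<gamma>" using n j1 by simp
    show "finite {k. (k, j) \<in> F}" using F by (intro finite_section)
    fix k assume "k \<in> {k. (k, j) \<in> F}"
    thus "1 \<le> k \<and> n / real j powr \<gamma> < real k" using F(2)[of k j] j1 by (simp add: pos_divide_less_eq)
  qed
  also have "(n / real j powr \<gamma>) powr (1 - a) = n powr (1 - a) * real j powr (\<gamma> * (a - 1))"
  proof -
    have "(n / real j powr \<gamma>) powr (1 - a) = n powr (1 - a) / real j powr (\<gamma> * (1 - a))"
      using n j1 by (simp add: powr_divide powr_powr)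
    also have "\<gamma> * (1 - a) = - (\<gamma> * (a - 1))" by (simp add: algebra_simps)
    finally show ?thesis by (simp add: powr_minus divide_inverse)
  qed
  finally show ?thesis .
qed

text \<open>After summation over k, row j contributes j to the power \<gamma> (a - 1) - b, and the
  hypothesis places this below -1.\<close>

lemma tail_bound_anisotropic:
  assumes a: "1 < a" and b: "\<gamma> * (a - 1) < b - 1"
  shows "tail_bound a b \<gamma> (\<lambda>_. 1)"
proof -
  let ?c = "2 powr a / (a - 1)"
  let ?e = "b - \<gamma> * (a - 1)"
  define C where "C = ?c * (2 powr ?e / (?e - 1) * (1/2) powr (1 - ?e))"
  have "0 < C" using a b by (simp add: C_def)
  moreover have "(\<Sum>(k, j)\<in>F. real k powr (-a) * real j powr (-b)) \<le> C * n powr (1 - a) * 1"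
    if n: "1 \<le> n" and F: "finite F" "\<forall>(k, j)\<in>F. 1 \<le> k \<and> 1 \<le> j \<and> n < real k * real j powr \<gamma>" for n F
  proof -
    have "(\<Sum>(k, j)\<in>F. real k powr (-a) * real j powr (-b))
        = (\<Sum>j\<in>snd ` F. (\<Sum>k\<in>{k. (k, j) \<in> F}. real k powr (-a)) * real j powr (-b))"
      by (subst sum_by_snd[OF F(1)]) (simp add: sum_distrib_right)
    also have "\<dots> \<le> (\<Sum>j\<in>snd ` F. ?c * (n powr (1 - a) * real j powr (\<gamma> * (a - 1))) * real j powr (-b))"
      by (intro sum_mono mult_right_mono tail_section_le a) (use n F in auto)
    also have "\<dots> = ?c * n powr (1 - a) * (\<Sum>j\<in>snd ` F. real j powr (- ?e))"
      by (simp add: sum_distrib_left mult.assoc flip: powr_add)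
    also have "\<dots> \<le> ?c * n powr (1 - a) * (2 powr ?e / (?e - 1) * (1/2) powr (1 - ?e))"
    proof (intro mult_left_mono sum_powr_tail)
      fix j assume "j \<in> snd ` F"
      hence "1 \<le> j" using F by auto
      thus "1 \<le> j \<and> 1 / 2 < real j" by simp
    qed (use a b F in auto)
    finally show ?thesis by (simp add: C_def mult_ac)
  qed
  ultimately show ?thesis unfolding tail_bound_def by (intro exI[of _ C]) auto
qed

text \<open>Here the row estimate leaves 1/j, which is summable only up to a logarithm and only for
  j up to n. For larger j the whole row is bounded by the constant d, and the sum of j^(-a) over j >
  n supplies n^(1-a).\<close>

lemma tail_bound_isotropic:
  assumes a: "1 < a"
  shows "tail_bound a a 1 (\<lambda>n. 1 + ln n)"
proof -
  define c where "c = 2 powr a / (a - 1)"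
  define d where "d = c * (1/2) powr (1 - a)"
  define C where "C = c + d * c"
  have c: "0 < c" "0 < d" using a by (auto simp: c_def d_def)
  hence C: "0 < C" by (simp add: C_def add_pos_pos)
  moreover have "(\<Sum>(k, j)\<in>F. real k powr (-a) * real j powr (-a)) \<le> C * n powr (1 - a) * (1 + ln n)"
    if n: "1 \<le> n" and F: "finite F" "\<forall>(k, j)\<in>F. 1 \<le> k \<and> 1 \<le> j \<and> n < real k * real j powr 1" for n F
  proof -
    let ?S = "\<lambda>j. (\<Sum>k\<in>{k. (k, j) \<in> F}. real k powr (-a)) * real j powr (-a)"
    let ?J = "{j \<in> snd ` F. real j \<le> n}" and ?K = "{j \<in> snd ` F. n < real j}"
    have "(\<Sum>(k, j)\<in>F. real k powr (-a) * real j powr (-a)) = (\<Sum>j\<in>snd ` F. ?S j)"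
      by (subst sum_by_snd[OF F(1)]) (simp add: sum_distrib_right)
    also have "snd ` F = ?J \<union> ?K" by auto
    also have "(\<Sum>j\<in>?J \<union> ?K. ?S j) = (\<Sum>j\<in>?J. ?S j) + (\<Sum>j\<in>?K. ?S j)"
      using F by (intro sum.union_disjoint) auto
    also have "(\<Sum>j\<in>?J. ?S j) \<le> (\<Sum>j\<in>?J. c * n powr (1 - a) * (1 / real j))"
    proof (rule sum_mono)
      fix j assume j: "j \<in> ?J"
      hence j1: "1 \<le> j" using F by auto
      have "?S j \<le> c * (n powr (1 - a) * real j powr (1 * (a - 1))) * real j powr (-a)"
        unfolding c_def by (intro mult_right_mono tail_section_le a) (use n F j in auto)
      also have "\<dots> = c * n powr (1 - a) * real j powr (-1)"
        by (simp add: mult.assoc flip: powr_add)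
      finally show "?S j \<le> c * n powr (1 - a) * (1 / real j)"
        using j1 by (simp add: powr_minus_divide)
    qed
    also have "\<dots> \<le> c * n powr (1 - a) * (1 + ln n)"
      unfolding sum_distrib_left[symmetric]
      by (intro mult_left_mono harmonic_sum_le n) (use c F in auto)
    also have "(\<Sum>j\<in>?K. ?S j) \<le> (\<Sum>j\<in>?K. d * real j powr (-a))"
    proof (intro sum_mono mult_right_mono)
      fix j assume "j \<in> ?K"
      show "(\<Sum>k\<in>{k. (k, j) \<in> F}. real k powr (-a)) \<le> d" unfolding c_def d_def
        by (intro sum_powr_tail a finite_section) (use F in auto)
    qed auto
    also have "\<dots> \<le> d * (c * n powr (1 - a))"
      unfolding sum_distrib_left[symmetric] c_def
      by (intro mult_left_mono sum_powr_tail a) (use n c F in auto)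
    also have "\<dots> \<le> d * c * n powr (1 - a) * (1 + ln n)"
      using c n mult_left_mono[of 1 "1 + ln n" "d * c * n powr (1 - a)"] by (simp add: mult.assoc)
    finally show ?thesis by (simp add: C_def algebra_simps)
  qed
  ultimately show ?thesis unfolding tail_bound_def by (intro exI[of _ C]) auto
qed

text \<open>Row j has at most x = n / j^\<gamma> points, and each term is at most x^a.\<close>

lemma head_section_le:
  fixes F :: "(nat \<times> nat) set"
  assumes a: "0 \<le> a" and n: "0 < n" and F: "finite F" "\<And>k j. (k, j) \<in> F \<Longrightarrow> 1 \<le> k \<and> 1 \<le> j \<and> real k * real j powr \<gamma> \<le> n"
    and j: "j \<in> snd ` F"
  shows "(\<Sum>k\<in>{k. (k, j) \<in> F}. real k powr a) \<le> n powr (1 + a) * real j powr (- (\<gamma> * (1 + a)))"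
proof -
  have j1: "1 \<le> j" using j F by auto
  define x where "x = n / real j powr \<gamma>"
  have x: "0 < x" using n j1 by (simp add: x_def)
  have k: "1 \<le> k \<and> real k \<le> x" if "(k, j) \<in> F" for k
    using F(2)[OF that] j1 by (simp add: x_def pos_le_divide_eq)
  have "real (card {k. (k, j) \<in> F}) \<le> x"
  proof -
    have "{k. (k, j) \<in> F} \<subseteq> {1..nat \<lfloor>x\<rfloor>}" using k by (auto simp: le_nat_floor)
    hence "card {k. (k, j) \<in> F} \<le> nat \<lfloor>x\<rfloor>" using card_mono[of "{1..nat \<lfloor>x\<rfloor>}"] by simp
    thus ?thesis using x by linarith
  qed
  moreover have "(\<Sum>k\<in>{k. (k, j) \<in> F}. real k powr a) \<le> real (card {k. (k, j) \<in> F}) * x powr a"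
    using k a by (intro sum_bounded_above powr_mono2) auto
  ultimately have "(\<Sum>k\<in>{k. (k, j) \<in> F}. real k powr a) \<le> x * x powr a"
    by (smt (verit) mult_right_mono powr_ge_zero)
  also have "\<dots> = x powr (1 + a)" using x by (simp add: powr_add)
  also have "\<dots> = n powr (1 + a) * real j powr (- (\<gamma> * (1 + a)))"
    using n j1 by (simp add: x_def powr_divide powr_powr powr_minus_divide)
  finally show ?thesis .
qed

lemma head_bound_anisotropic:
  assumes a: "0 \<le> a" and b: "1 + b < \<gamma> * (1 + a)"
  shows "head_bound a b \<gamma> (\<lambda>_. 1)"
proof -
  let ?e = "\<gamma> * (1 + a) - b"
  define C where "C = (2 powr ?e / (?e - 1) * (1/2) powr (1 - ?e))"
  have "0 < C" using b by (simp add: C_def)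
  moreover have "(\<Sum>(k, j)\<in>F. real k powr a * real j powr b) \<le> C * n powr (1 + a) * 1"
    if n: "1 \<le> n" and F: "finite F" "\<forall>(k, j)\<in>F. 1 \<le> k \<and> 1 \<le> j \<and> real k * real j powr \<gamma> \<le> n" for n F
  proof -
    have "(\<Sum>(k, j)\<in>F. real k powr a * real j powr b)
        = (\<Sum>j\<in>snd ` F. (\<Sum>k\<in>{k. (k, j) \<in> F}. real k powr a) * real j powr b)"
      by (subst sum_by_snd[OF F(1)]) (simp add: sum_distrib_right)
    also have "\<dots> \<le> (\<Sum>j\<in>snd ` F. (n powr (1 + a) * real j powr (- (\<gamma> * (1 + a)))) * real j powr b)"
      by (intro sum_mono mult_right_mono head_section_le a) (use n F in auto)
    also have "\<dots> = n powr (1 + a) * (\<Sum>j\<in>snd ` F. real j powr (- ?e))"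
      by (simp add: sum_distrib_left mult.assoc flip: powr_add)
    also have "\<dots> \<le> n powr (1 + a) * (2 powr ?e / (?e - 1) * (1/2) powr (1 - ?e))"
    proof (intro mult_left_mono sum_powr_tail)
      fix j assume "j \<in> snd ` F"
      hence "1 \<le> j" using F by auto
      thus "1 \<le> j \<and> 1 / 2 < real j" by simp
    qed (use b F in auto)
    finally show ?thesis by (simp add: C_def mult_ac)
  qed
  ultimately show ?thesis unfolding head_bound_def by (intro exI[of _ C]) auto
qed

text \<open>The row estimates leave the harmonic sum over j up to n. The constant is kept equal to
  1, so that a = 0 bounds the number of points by n (1 + ln n).\<close>

lemma hyp_cross_sum_isotropic_le:
  assumes a: "0 \<le> a" and n: "1 \<le> n"
    and F: "finite F" "\<forall>(k, j)\<in>F. 1 \<le> k \<and> 1 \<le> j \<and> real k * real j powr 1 \<le> n"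
  shows "(\<Sum>(k, j)\<in>F. real k powr a * real j powr a) \<le> n powr (1 + a) * (1 + ln n)"
proof -
  have "(\<Sum>(k, j)\<in>F. real k powr a * real j powr a)
      = (\<Sum>j\<in>snd ` F. (\<Sum>k\<in>{k. (k, j) \<in> F}. real k powr a) * real j powr a)"
    by (subst sum_by_snd[OF F(1)]) (simp add: sum_distrib_right)
  also have "\<dots> \<le> (\<Sum>j\<in>snd ` F. (n powr (1 + a) * real j powr (- (1 * (1 + a)))) * real j powr a)"
    by (intro sum_mono mult_right_mono head_section_le a) (use n F in auto)
  also have "\<dots> = n powr (1 + a) * (\<Sum>j\<in>snd ` F. real j powr (-1))"
    by (simp add: sum_distrib_left mult.assoc flip: powr_add)
  also have "(\<Sum>j\<in>snd ` F. real j powr (-1)) = (\<Sum>j\<in>snd ` F. 1 / real j)"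
    using F by (intro sum.cong refl) (auto simp: powr_minus_divide)
  also have "n powr (1 + a) * \<dots> \<le> n powr (1 + a) * (1 + ln n)"
  proof (intro mult_left_mono harmonic_sum_le n)
    fix j assume "j \<in> snd ` F"
    then obtain k where k: "(k, j) \<in> F" by auto
    hence "1 \<le> k" "1 \<le> j" "real k * real j \<le> n" using F by auto
    moreover have "1 * real j \<le> real k * real j" using \<open>1 \<le> k\<close> by (intro mult_right_mono) auto
    ultimately show "1 \<le> j \<and> real j \<le> n" by linarith
  qed (use F in auto)
  finally show ?thesis .
qed

lemma head_bound_isotropic: "0 \<le> a \<Longrightarrow> head_bound a a 1 (\<lambda>n. 1 + ln n)"
  unfolding head_bound_def
  by (intro exI[of _ 1] conjI allI impI zero_less_one, unfold mult_1) (rule hyp_cross_sum_isotropic_le)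

text \<open>Here \<open>q\<close> is the reciprocal of the Hoelder exponent of \<open>\<xi>\<close>; the endpoints \<open>q = 0\<close> and \<open>q = 1\<close>
  are the pairings of \<open>\<ell>\<^sub>\<infinity>\<close> with \<open>\<ell>\<^sub>1\<close>.\<close>

lemma Holder_finite_sum:
  fixes \<xi> w :: "'a \<Rightarrow> real"
  assumes F: "finite F" and q: "0 \<le> q" "q \<le> 1" and K: "0 < K" "0 < L"
    and nn: "\<And>i. i \<in> F \<Longrightarrow> 0 \<le> \<xi> i" "\<And>i. i \<in> F \<Longrightarrow> 0 \<le> w i"
    and \<xi>: "0 < q \<Longrightarrow> (\<Sum>i\<in>F. \<xi> i powr (1 / q)) \<le> 1" "\<And>i. q = 0 \<Longrightarrow> i \<in> F \<Longrightarrow> \<xi> i \<le> 1"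
    and w: "q < 1 \<Longrightarrow> (\<Sum>i\<in>F. w i powr (1 / (1 - q))) \<le> K powr (1 / (1 - q)) * L"
           "\<And>i. q = 1 \<Longrightarrow> i \<in> F \<Longrightarrow> w i \<le> K"
  shows "(\<Sum>i\<in>F. \<xi> i * w i) \<le> K * L powr (1 - q)"
proof -
  consider "q = 0" | "q = 1" | "0 < q" "q < 1" using q by linarith
  thus ?thesis
  proof cases
    case 1
    have "(\<Sum>i\<in>F. \<xi> i * w i) \<le> (\<Sum>i\<in>F. 1 * w i)"
      using \<xi>(2) nn 1 by (intro sum_mono mult_right_mono) auto
    also have "\<dots> = (\<Sum>i\<in>F. w i powr (1 / (1 - q)))"
      using nn 1 by (intro sum.cong) auto
    finally show ?thesis using w(1) 1 K by simp
  next
    case 2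
    have "(\<Sum>i\<in>F. \<xi> i * w i) \<le> (\<Sum>i\<in>F. \<xi> i * K)"
      using w(2) nn 2 by (intro sum_mono mult_left_mono) auto
    also have "\<dots> = (\<Sum>i\<in>F. \<xi> i powr (1 / q)) * K"
      using nn 2 by (simp add: sum_distrib_right)
    also have "\<dots> \<le> 1 * K" using \<xi>(1) 2 K by (intro mult_right_mono) auto
    finally show ?thesis using 2 K by simp
  next
    case 3
    \<comment> \<open>The weights are divided by the bound to be proved, so that Young's inequality
      sums to at most q + (1 - q) = 1.\<close>
    define M where "M = K * L powr (1 - q)"
    have M: "0 < M" using K by (simp add: M_def)
    have Mp: "M powr (1 / (1 - q)) = K powr (1 / (1 - q)) * L"
      using K 3 by (simp add: M_def powr_mult powr_powr)
    have "(\<Sum>i\<in>F. \<xi> i * (w i / M)) \<le> (\<Sum>i\<in>F. q * \<xi> i powr (1 / q) + (1 - q) / M powr (1 / (1 - q)) * w i powr (1 / (1 - q)))"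
    proof (rule sum_mono)
      fix i assume i: "i \<in> F"
      have "\<xi> i * (w i / M) \<le> \<xi> i powr (1 / q) / (1 / q) + (w i / M) powr (1 / (1 - q)) / (1 / (1 - q))"
        using 3 nn[OF i] M by (intro Youngs_inequality) auto
      also have "(w i / M) powr (1 / (1 - q)) = w i powr (1 / (1 - q)) / M powr (1 / (1 - q))"
        using nn[OF i] M by (simp add: powr_divide)
      finally show "\<xi> i * (w i / M) \<le> q * \<xi> i powr (1 / q) + (1 - q) / M powr (1 / (1 - q)) * w i powr (1 / (1 - q))"
        using 3 by (simp add: mult_ac)
    qed
    also have "\<dots> = q * (\<Sum>i\<in>F. \<xi> i powr (1 / q)) + (1 - q) / M powr (1 / (1 - q)) * (\<Sum>i\<in>F. w i powr (1 / (1 - q)))"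
      by (simp add: sum.distrib sum_distrib_left)
    also have "\<dots> \<le> q * 1 + (1 - q) / M powr (1 / (1 - q)) * M powr (1 / (1 - q))"
      using \<xi>(1) w(1)[folded Mp] 3 by (intro add_mono mult_left_mono) auto
    also have "\<dots> = 1" using M by simp
    finally have "(\<Sum>i\<in>F. \<xi> i * w i) / M \<le> 1" by (simp add: sum_divide_distrib)
    thus ?thesis using M by (simp add: M_def)
  qed
qed

subsection \<open>The error of the truncation method\<close>

lemma finite_hyp_cross:
  assumes "1 \<le> r1" "1 \<le> r2" "1 \<le> \<gamma>"
  shows "finite (hyp_cross r1 r2 n \<gamma>)"
proof (rule finite_subset)
  show "hyp_cross r1 r2 n \<gamma> \<subseteq> {..nat \<lfloor>n\<rfloor>} \<times> {..nat \<lfloor>n\<rfloor>}"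
  proof (clarsimp simp: hyp_cross_def)
    fix k j :: nat assume kj: "r1 \<le> k" "r2 \<le> j" "real k * real j powr \<gamma> \<le> n"
    hence pos: "1 \<le> real k" "1 \<le> real j" using assms by auto
    hence "real j powr 1 \<le> real j powr \<gamma>" using assms by (intro powr_mono) auto
    hence j: "real j \<le> real j powr \<gamma>" by simp
    have "real k * 1 \<le> real k * real j powr \<gamma>" "1 * real j powr \<gamma> \<le> real k * real j powr \<gamma>"
      using pos j by (intro mult_left_mono mult_right_mono; simp)+
    hence "real k \<le> n" "real j \<le> n" using kj j by auto
    thus "k \<le> nat \<lfloor>n\<rfloor> \<and> j \<le> nat \<lfloor>n\<rfloor>" by (simp add: le_nat_floor)
  qed
qed auto

lemma hyp_cross_subset: "hyp_cross r1 r2 n \<gamma> \<subseteq> {r1..} \<times> {r2..}"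
  by (auto simp: hyp_cross_def)

lemma card_hyp_cross_isotropic:
  assumes "1 \<le> r1" "1 \<le> r2" "1 \<le> n"
  shows "real (card (hyp_cross r1 r2 n 1)) \<le> n * (1 + ln n)"
proof -
  let ?\<Gamma> = "hyp_cross r1 r2 n 1"
  have mem: "\<forall>(k, j)\<in>?\<Gamma>. 1 \<le> k \<and> 1 \<le> j \<and> real k * real j powr 1 \<le> n"
    using assms by (auto simp: hyp_cross_def)
  have "real (card ?\<Gamma>) = (\<Sum>(k, j)\<in>?\<Gamma>. real k powr 0 * real j powr 0)"
    using mem by (subst sum.cong[OF refl, of _ _ "\<lambda>_. 1"]) auto
  also have "\<dots> \<le> n powr (1 + 0) * (1 + ln n)"
    by (intro hyp_cross_sum_isotropic_le finite_hyp_cross mem) (use assms in auto)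
  finally show ?thesis using assms by simp
qed

text \<open>Counting is the head sum with both exponents 0, for which the condition of
  \<open>head_bound_anisotropic\<close> reads \<gamma> > 1.\<close>

lemma card_hyp_cross_anisotropic:
  assumes "1 \<le> r1" "1 \<le> r2" "1 < \<gamma>"
  shows "\<exists>C>0. \<forall>n\<ge>1. real (card (hyp_cross r1 r2 n \<gamma>)) \<le> C * n"
proof -
  have "head_bound 0 0 \<gamma> (\<lambda>_. 1)" using assms by (intro head_bound_anisotropic) auto
  from head_boundE[OF this] obtain C where C: "0 < C" "\<And>n F. 1 \<le> n \<Longrightarrow> finite F \<Longrightarrow>
     (\<forall>(k, j)\<in>F. 1 \<le> k \<and> 1 \<le> j \<and> real k * real j powr \<gamma> \<le> n) \<Longrightarrow>
     (\<Sum>(k, j)\<in>F. real k powr 0 * real j powr 0) \<le> C * n powr (1 + 0) * 1"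
    by blast
  have "real (card (hyp_cross r1 r2 n \<gamma>)) \<le> C * n" if n: "1 \<le> n" for n
  proof -
    let ?\<Gamma> = "hyp_cross r1 r2 n \<gamma>"
    have mem: "\<forall>(k, j)\<in>?\<Gamma>. 1 \<le> k \<and> 1 \<le> j \<and> real k * real j powr \<gamma> \<le> n"
      using assms by (auto simp: hyp_cross_def)
    have "real (card ?\<Gamma>) = (\<Sum>(k, j)\<in>?\<Gamma>. real k powr 0 * real j powr 0)"
      using mem by (subst sum.cong[OF refl, of _ _ "\<lambda>_. 1"]) auto
    also have "\<dots> \<le> C * n powr (1 + 0) * 1"
      by (intro C(2) n finite_hyp_cross mem) (use assms in auto)
    finally show ?thesis using n by simp
  qed
  with C(1) show ?thesis by blast
qed

text \<open>The reciprocal exponent q turns p = \<infinity> into the ordinary value 0. The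
  conclusions are the hypotheses of \<open>Holder_finite_sum\<close> for the noise divided by
  \<delta>.\<close>

lemma perturbed_data_scaled:
  assumes p: "1 \<le> p" and \<delta>: "0 < \<delta>" and y: "y \<in> perturbed_data p \<delta> f"
  defines "q \<equiv> real_of_ereal (1 / p)"
  shows "0 \<le> q" "q \<le> 1"
    and "0 < q \<Longrightarrow> finite F \<Longrightarrow> (\<Sum>i\<in>F. (\<bar>legendre_coeff f i - y i\<bar> / \<delta>) powr (1 / q)) \<le> 1"
    and "q = 0 \<Longrightarrow> \<bar>legendre_coeff f i - y i\<bar> / \<delta> \<le> 1"
proof -
  let ?x = "\<lambda>i. legendre_coeff f i - y i"
  have x: "?x \<in> lp_space p" "lp_norm p ?x \<le> \<delta>" using y by (auto simp: perturbed_data_def)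
  consider "p = \<infinity>" | P where "p = ereal P" "1 \<le> P" using p by (cases p) auto
  hence "0 \<le> q \<and> q \<le> 1 \<and> (0 < q \<longrightarrow> finite F \<longrightarrow> (\<Sum>i\<in>F. (\<bar>?x i\<bar> / \<delta>) powr (1 / q)) \<le> 1)
      \<and> (q = 0 \<longrightarrow> \<bar>?x i\<bar> / \<delta> \<le> 1)"
  proof cases
    case 1
    have "bounded (range ?x)" using x 1 by (simp add: lp_space_def)
    hence "bdd_above (range (\<lambda>i. \<bar>?x i\<bar>))" by (auto simp: bounded_iff bdd_above_def)
    hence "\<bar>?x i\<bar> \<le> (SUP i. \<bar>?x i\<bar>)" by (intro cSUP_upper) auto
    also have "\<dots> \<le> \<delta>" using x 1 by (simp add: lp_norm_def)
    finally show ?thesis using 1 \<delta> by (simp add: q_def)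
  next
    case 2
    have q: "q = 1 / P" using 2 by (simp add: q_def one_ereal_def)
    have sm: "(\<lambda>i. \<bar>?x i\<bar> powr P) summable_on UNIV" and nm: "(\<Sum>\<^sub>\<infinity>i. \<bar>?x i\<bar> powr P) powr (1 / P) \<le> \<delta>"
      using x 2 by (auto simp: lp_space_def lp_norm_def)
    have "(\<Sum>i\<in>F. (\<bar>?x i\<bar> / \<delta>) powr (1 / q)) \<le> 1" if F: "finite F"
    proof -
      have S: "0 \<le> (\<Sum>\<^sub>\<infinity>i. \<bar>?x i\<bar> powr P)" by (rule infsum_nonneg) auto
      have "(\<Sum>i\<in>F. \<bar>?x i\<bar> powr P) \<le> (\<Sum>\<^sub>\<infinity>i. \<bar>?x i\<bar> powr P)"
        by (rule finite_sum_le_infsum[OF sm F]) auto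
      also have "\<dots> = ((\<Sum>\<^sub>\<infinity>i. \<bar>?x i\<bar> powr P) powr (1 / P)) powr P"
        using 2 S by (simp add: powr_powr)
      also have "\<dots> \<le> \<delta> powr P" using nm 2 by (intro powr_mono2) auto
      finally have "(\<Sum>i\<in>F. \<bar>?x i\<bar> powr P) / \<delta> powr P \<le> 1" using \<delta> by simp
      thus ?thesis using \<delta> by (simp add: q powr_divide sum_divide_distrib)
    qed
    thus ?thesis using 2 q by auto
  qed
  thus "0 \<le> q" "q \<le> 1"
    and "0 < q \<Longrightarrow> finite F \<Longrightarrow> (\<Sum>i\<in>F. (\<bar>?x i\<bar> / \<delta>) powr (1 / q)) \<le> 1"
    and "q = 0 \<Longrightarrow> \<bar>?x i\<bar> / \<delta> \<le> 1" by auto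
qed

text \<open>On positive indices \<open>max 1 k\<close> is k, so the weighted coefficients form a
  sequence in the unit ball of l_s, ready for Hoelder's inequality.\<close>

lemma smoothness_class_sum_le:
  assumes s: "1 \<le> s" and f: "f \<in> smoothness_class s \<mu>" "smoothness_norm s \<mu> f \<le> 1"
    and F: "finite F" "F \<subseteq> {1..} \<times> {1..}"
  shows "(\<Sum>(k, j)\<in>F. (real k powr \<mu> * real j powr \<mu> * \<bar>legendre_coeff f (k, j)\<bar>) powr s) \<le> 1"
proof -
  let ?S = "\<Sum>\<^sub>\<infinity>i. smoothness_term s \<mu> f i"
  have nn: "0 \<le> smoothness_term s \<mu> f i" for i by (cases i) (simp add: smoothness_term_def)
  hence S: "0 \<le> ?S" by (intro infsum_nonneg)
  have "(\<Sum>(k, j)\<in>F. (real k powr \<mu> * real j powr \<mu> * \<bar>legendre_coeff f (k, j)\<bar>) powr s)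
      = (\<Sum>i\<in>F. smoothness_term s \<mu> f i)"
  proof (intro sum.cong refl, clarify)
    fix k j assume "(k, j) \<in> F"
    hence "1 \<le> k" "1 \<le> j" using F by auto
    thus "(real k powr \<mu> * real j powr \<mu> * \<bar>legendre_coeff f (k, j)\<bar>) powr s = smoothness_term s \<mu> f (k, j)"
      by (simp add: smoothness_term_def powr_mult powr_powr mult_ac max_def)
  qed
  also have "\<dots> \<le> ?S"
    using f nn F by (intro finite_sum_le_infsum) (auto simp: smoothness_class_def)
  also have "\<dots> = (?S powr (1 / s)) powr s" using S s by (simp add: powr_powr)
  also have "\<dots> \<le> 1 powr s" using f s by (intro powr_mono2) (auto simp: smoothness_norm_def)
  finally show ?thesis by simp
qed

text \<open>The basis norms grow like k^\<alpha>1 j^\<alpha>2; relative to the smoothness weight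
  they decay like k^(-\<beta>1) j^(-\<beta>2) with \<beta> = \<mu> - \<alpha>. Hoelder's inequality
  with exponents s and p leads to the sums in \<open>tail\<close> and \<open>head\<close>; raising
  their bounds to the powers 1 - 1/s and 1 - q gives the two powers of n. For s = 1 or p = 1 the
  supremum of the weights replaces the sum.\<close>

lemma truncation_error_le:
  fixes s \<mu> \<gamma> :: real and p :: ereal and r1 r2 :: nat and \<Lambda> :: "real \<Rightarrow> real"
  defines "q \<equiv> real_of_ereal (1 / p)"
  defines "B \<equiv> \<mu> - 2 * real r1 + 1 / s - 1 / 2"
  assumes s: "1 \<le> s" and p: "1 \<le> p" and r: "1 \<le> r2" "r2 \<le> r1" and B: "0 < B" and \<gamma>: "1 \<le> \<gamma>"
    and \<Lambda>: "\<And>n. 1 \<le> n \<Longrightarrow> 0 < \<Lambda> n"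
    and tail: "1 < s \<Longrightarrow> tail_bound ((\<mu> - 2 * real r1 + 1 / 2) / (1 - 1 / s)) ((\<mu> - 2 * real r2 + 1 / 2) / (1 - 1 / s)) \<gamma> \<Lambda>"
    and tail1: "s = 1 \<Longrightarrow> \<gamma> * (\<mu> - 2 * real r1 + 1 / 2) \<le> \<mu> - 2 * real r2 + 1 / 2"
    and head: "q < 1 \<Longrightarrow> head_bound ((2 * real r1 - 1 / 2) / (1 - q)) ((2 * real r2 - 1 / 2) / (1 - q)) \<gamma> \<Lambda>"
  shows "\<exists>C>0. \<forall>n\<ge>1. \<forall>\<delta>>0. truncation_error r1 r2 s \<mu> p \<delta> n \<gamma>
     \<le> ennreal (C * (n powr (- B) * \<Lambda> n powr (1 - 1 / s) + \<delta> * n powr (2 * real r1 + 1 / 2 - q) * \<Lambda> n powr (1 - q)))"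
proof -
  define \<alpha>1 \<alpha>2 where \<alpha>: "\<alpha>1 = 2 * real r1 - 1 / 2" "\<alpha>2 = 2 * real r2 - 1 / 2"
  define \<beta>1 \<beta>2 where \<beta>: "\<beta>1 = \<mu> - 2 * real r1 + 1 / 2" "\<beta>2 = \<mu> - 2 * real r2 + 1 / 2"
  define c where "c = (2 * sqrt (real r1)) * (2 * sqrt (real r2))"
  have c: "0 < c" using r by (simp add: c_def)
  define w where "w i = c * (real (fst i) powr \<alpha>1 * real (snd i) powr \<alpha>2)" for i
  have q: "0 \<le> q" "q \<le> 1"
  proof -
    have "1 / p \<le> 1" "0 \<le> 1 / p" using p by (cases p; simp add: one_ereal_def)+
    thus "0 \<le> q" "q \<le> 1" unfolding q_def by (cases "1 / p"; simp add: one_ereal_def)+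
  qed
  have w: "L2_norm (deriv_basis r1 r2 i) \<le> w i" "0 < w i" if i: "i \<in> {r1..} \<times> {r2..}" for i
  proof -
    have "1 \<le> fst i" "1 \<le> snd i" using i r by auto
    thus "0 < w i" using c by (simp add: w_def)
    have "L2_norm (deriv_basis r1 r2 i) \<le> (2 * sqrt (real r1) * real (fst i) powr \<alpha>1) * (2 * sqrt (real r2) * real (snd i) powr \<alpha>2)"
      unfolding L2_norm_deriv_basis \<alpha> using r \<open>1 \<le> fst i\<close> \<open>1 \<le> snd i\<close>
      by (intro mult_mono deriv_norm_le) (auto simp: deriv_norm_def ipoly_square_nonneg)
    thus "L2_norm (deriv_basis r1 r2 i) \<le> w i" by (simp add: w_def c_def mult_ac)
  qed
  \<comment> \<open>For s = 1 there is no power sum and the dummy constant 1 is chosen; it only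
    enters with the power 1 - 1/s. The same device serves q = 1 below.\<close>
  obtain Ct where Ct: "0 < Ct" "\<And>n F. 1 < s \<Longrightarrow> 1 \<le> n \<Longrightarrow> finite F \<Longrightarrow>
     (\<forall>(k, j)\<in>F. 1 \<le> k \<and> 1 \<le> j \<and> n < real k * real j powr \<gamma>) \<Longrightarrow>
     (\<Sum>(k, j)\<in>F. real k powr (-(\<beta>1 / (1 - 1 / s))) * real j powr (-(\<beta>2 / (1 - 1 / s)))) \<le> Ct * n powr (1 - \<beta>1 / (1 - 1 / s)) * \<Lambda> n"
  proof (cases "1 < s")
    case True
    show ?thesis
      by (rule tail_boundE[OF tail[OF True, folded \<beta>]]) (erule that)
  qed (use that[of 1] in simp)
  obtain Ch where Ch: "0 < Ch" "\<And>n F. q < 1 \<Longrightarrow> 1 \<le> n \<Longrightarrow> finite F \<Longrightarrow>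
     (\<forall>(k, j)\<in>F. 1 \<le> k \<and> 1 \<le> j \<and> real k * real j powr \<gamma> \<le> n) \<Longrightarrow>
     (\<Sum>(k, j)\<in>F. real k powr (\<alpha>1 / (1 - q)) * real j powr (\<alpha>2 / (1 - q))) \<le> Ch * n powr (1 + \<alpha>1 / (1 - q)) * \<Lambda> n"
  proof (cases "q < 1")
    case True
    show ?thesis
      by (rule head_boundE[OF head[OF True, folded \<alpha>]]) (erule that)
  qed (use that[of 1] in simp)
  define C where "C = c * (Ct powr (1 - 1 / s) + Ch powr (1 - q))"
  have Cpos: "0 < C" using c Ct Ch by (simp add: C_def add_pos_pos)
  have "truncation_error r1 r2 s \<mu> p \<delta> n \<gamma>
     \<le> ennreal (C * (n powr (- B) * \<Lambda> n powr (1 - 1 / s) + \<delta> * n powr (2 * real r1 + 1 / 2 - q) * \<Lambda> n powr (1 - q)))"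
    if n: "1 \<le> n" and \<delta>: "0 < \<delta>" for n \<delta>
  proof -
    let ?\<Gamma> = "hyp_cross r1 r2 n \<gamma>"
    let ?X = "n powr (- B) * \<Lambda> n powr (1 - 1 / s)"
    let ?Y = "n powr (2 * real r1 + 1 / 2 - q) * \<Lambda> n powr (1 - q)"
    have \<Lambda>n: "0 < \<Lambda> n" by (rule \<Lambda>[OF n])
    have "truncation_error r1 r2 s \<mu> p \<delta> n \<gamma>
        \<le> ennreal (c * (Ct powr (1 - 1 / s) * ?X) + c * (\<delta> * (Ch powr (1 - q) * ?Y)))"
      unfolding truncation_error_def
    proof (rule truncation_recovery_error_le[where w = w])
      show "finite ?\<Gamma>" using r \<gamma> by (intro finite_hyp_cross) auto
    next
      fix f F assume f: "f \<in> smoothness_class s \<mu>" "smoothness_norm s \<mu> f \<le> 1"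
        and F: "finite F" "F \<subseteq> {r1..} \<times> {r2..} - ?\<Gamma>"
      define \<xi> where "\<xi> i = real (fst i) powr \<mu> * real (snd i) powr \<mu> * \<bar>legendre_coeff f i\<bar>" for i
      define v where "v i = real (fst i) powr (-\<beta>1) * real (snd i) powr (-\<beta>2)" for i
      have mem: "\<forall>(k, j)\<in>F. 1 \<le> k \<and> 1 \<le> j \<and> n < real k * real j powr \<gamma>"
        using F r by (fastforce simp: hyp_cross_def)
      have "(\<Sum>i\<in>F. \<xi> i * v i) \<le> n powr (- B) * (Ct * \<Lambda> n) powr (1 - 1 / s)"
      proof (rule Holder_finite_sum[OF F(1)])
        have "(\<Sum>(k, j)\<in>F. (real k powr \<mu> * real j powr \<mu> * \<bar>legendre_coeff f (k, j)\<bar>) powr s) \<le> 1"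
          using mem by (intro smoothness_class_sum_le s f F(1)) auto
        thus "(\<Sum>i\<in>F. \<xi> i powr (1 / (1 / s))) \<le> 1" by (simp add: \<xi>_def case_prod_beta)
      next
        assume "1 / s < 1"
        hence s1: "1 < s" using s by simp
        have "(\<Sum>i\<in>F. v i powr (1 / (1 - 1 / s)))
            = (\<Sum>(k, j)\<in>F. real k powr (-(\<beta>1 / (1 - 1 / s))) * real j powr (-(\<beta>2 / (1 - 1 / s))))"
          by (simp add: v_def case_prod_beta powr_mult powr_powr)
        also have "\<dots> \<le> Ct * n powr (1 - \<beta>1 / (1 - 1 / s)) * \<Lambda> n"
          by (rule Ct(2)[OF s1 n F(1) mem])
        also have "1 - \<beta>1 / (1 - 1 / s) = - B * (1 / (1 - 1 / s))"
          using s1 by (simp add: \<beta> B_def field_simps)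
        finally show "(\<Sum>i\<in>F. v i powr (1 / (1 - 1 / s))) \<le> (n powr (- B)) powr (1 / (1 - 1 / s)) * (Ct * \<Lambda> n)"
          by (simp add: powr_powr mult_ac)
      next
        \<comment> \<open>For s = 1, \<open>tail1\<close> bounds j^(-\<beta>2) by
          (j^\<gamma>)^(-\<beta>1), so the weight depends only on the quantity that exceeds n
          outside the cross.\<close>
        fix i assume "1 / s = 1" and i: "i \<in> F"
        hence s1: "s = 1" using s by simp
        obtain k j where kj: "i = (k, j)" by (cases i)
        hence pos: "1 \<le> k" "1 \<le> j" and lt: "n < real k * real j powr \<gamma>" using mem i by auto
        have B1: "B = \<beta>1" using s1 by (simp add: B_def \<beta>)
        have "real k powr (-\<beta>1) * real j powr (-\<beta>2) \<le> real k powr (-\<beta>1) * real j powr (-(\<gamma> * \<beta>1))"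
          using tail1[OF s1] pos by (intro mult_left_mono powr_mono) (auto simp: \<beta>)
        also have "\<dots> = (real k * real j powr \<gamma>) powr (-\<beta>1)"
          using pos by (simp add: powr_mult powr_powr)
        also have "\<dots> \<le> n powr (-\<beta>1)"
          using lt n B B1 by (intro powr_mono2') auto
        finally show "v i \<le> n powr (- B)" by (simp add: v_def kj B1)
      qed (use s n Ct \<Lambda>n in \<open>auto simp: \<xi>_def v_def\<close>)
      also have "\<dots> = Ct powr (1 - 1 / s) * ?X" using Ct \<Lambda>n by (simp add: powr_mult mult_ac)
      finally have "c * (\<Sum>i\<in>F. \<xi> i * v i) \<le> c * (Ct powr (1 - 1 / s) * ?X)"
        using c by simp
      moreover have "\<bar>legendre_coeff f i\<bar> * w i = c * (\<xi> i * v i)" if i: "i \<in> F" for i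
      proof -
        have pos: "0 < real (fst i)" "0 < real (snd i)" using mem i by auto
        have "\<mu> + - \<beta>1 = \<alpha>1" "\<mu> + - \<beta>2 = \<alpha>2" by (auto simp: \<alpha> \<beta>)
        hence "real (fst i) powr \<alpha>1 = real (fst i) powr \<mu> * real (fst i) powr (-\<beta>1)"
          "real (snd i) powr \<alpha>2 = real (snd i) powr \<mu> * real (snd i) powr (-\<beta>2)"
          by (simp_all flip: powr_add)
        thus ?thesis by (simp add: w_def \<xi>_def v_def mult_ac)
      qed
      ultimately show "(\<Sum>i\<in>F. \<bar>legendre_coeff f i\<bar> * w i) \<le> c * (Ct powr (1 - 1 / s) * ?X)"
        by (simp add: sum_distrib_left)
    next
      fix f y assume y: "y \<in> perturbed_data p \<delta> f"
      note ps = perturbed_data_scaled[OF p \<delta> y, folded q_def]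
      define \<xi> where "\<xi> i = \<bar>legendre_coeff f i - y i\<bar> / \<delta>" for i
      define v where "v i = real (fst i) powr \<alpha>1 * real (snd i) powr \<alpha>2" for i
      have fin: "finite ?\<Gamma>" using r \<gamma> by (intro finite_hyp_cross) auto
      have mem: "\<forall>(k, j)\<in>?\<Gamma>. 1 \<le> k \<and> 1 \<le> j \<and> real k * real j powr \<gamma> \<le> n"
        using r by (auto simp: hyp_cross_def)
      have "(\<Sum>i\<in>?\<Gamma>. \<xi> i * v i) \<le> n powr (2 * real r1 + 1 / 2 - q) * (Ch * \<Lambda> n) powr (1 - q)"
      proof (rule Holder_finite_sum[OF fin q])
        assume q1: "q < 1"
        have "(\<Sum>i\<in>?\<Gamma>. v i powr (1 / (1 - q)))
            = (\<Sum>(k, j)\<in>?\<Gamma>. real k powr (\<alpha>1 / (1 - q)) * real j powr (\<alpha>2 / (1 - q)))"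
          by (simp add: v_def case_prod_beta powr_mult powr_powr)
        also have "\<dots> \<le> Ch * n powr (1 + \<alpha>1 / (1 - q)) * \<Lambda> n"
          by (rule Ch(2)[OF q1 n fin mem])
        also have "1 + \<alpha>1 / (1 - q) = (2 * real r1 + 1 / 2 - q) * (1 / (1 - q))"
          using q1 by (simp add: \<alpha> field_simps)
        finally show "(\<Sum>i\<in>?\<Gamma>. v i powr (1 / (1 - q))) \<le> (n powr (2 * real r1 + 1 / 2 - q)) powr (1 / (1 - q)) * (Ch * \<Lambda> n)"
          by (simp add: powr_powr mult_ac)
      next
        fix i assume q1: "q = 1" and i: "i \<in> ?\<Gamma>"
        obtain k j where kj: "i = (k, j)" by (cases i)
        hence pos: "1 \<le> k" "1 \<le> j" and le: "real k * real j powr \<gamma> \<le> n" using mem i by auto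
        \<comment> \<open>For p = 1 the largest weight inside the cross is needed; r2 \<le> r1 and
          \<gamma> \<ge> 1 bound it by a power of k j^\<gamma>.\<close>
        have "\<alpha>2 \<le> 1 * \<alpha>1" using r by (simp add: \<alpha>)
        also have "\<dots> \<le> \<gamma> * \<alpha>1" using \<gamma> r by (intro mult_right_mono) (auto simp: \<alpha>)
        finally have "real k powr \<alpha>1 * real j powr \<alpha>2 \<le> real k powr \<alpha>1 * real j powr (\<gamma> * \<alpha>1)"
          using pos by (intro mult_left_mono powr_mono) auto
        also have "\<dots> = (real k * real j powr \<gamma>) powr \<alpha>1"
          using pos by (simp add: powr_mult powr_powr)
        also have "\<dots> \<le> n powr \<alpha>1"
          using le r by (intro powr_mono2) (auto simp: \<alpha>)
        finally show "v i \<le> n powr (2 * real r1 + 1 / 2 - q)" by (simp add: v_def kj q1 \<alpha>)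
      qed (use ps fin n Ch \<Lambda>n \<delta> in \<open>auto simp: \<xi>_def v_def\<close>)
      also have "\<dots> = Ch powr (1 - q) * ?Y" using Ch \<Lambda>n by (simp add: powr_mult mult_ac)
      finally have "c * \<delta> * (\<Sum>i\<in>?\<Gamma>. \<xi> i * v i) \<le> c * \<delta> * (Ch powr (1 - q) * ?Y)"
        using c \<delta> by simp
      moreover have "\<bar>legendre_coeff f i - y i\<bar> * w i = c * \<delta> * (\<xi> i * v i)" for i
        using \<delta> by (simp add: w_def \<xi>_def v_def)
      ultimately show "(\<Sum>i\<in>?\<Gamma>. \<bar>legendre_coeff f i - y i\<bar> * w i) \<le> c * (\<delta> * (Ch powr (1 - q) * ?Y))"
        by (simp add: sum_distrib_left mult.assoc)
    qed (use hyp_cross_subset w in auto)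
    also have "\<dots> \<le> ennreal (C * (?X + \<delta> * n powr (2 * real r1 + 1 / 2 - q) * \<Lambda> n powr (1 - q)))"
    proof (rule ennreal_leI)
      have "0 \<le> c * (Ch powr (1 - q) * ?X)" "0 \<le> c * (\<delta> * (Ct powr (1 - 1 / s) * ?Y))"
        using c \<delta> by auto
      thus "c * (Ct powr (1 - 1 / s) * ?X) + c * (\<delta> * (Ch powr (1 - q) * ?Y))
          \<le> C * (?X + \<delta> * n powr (2 * real r1 + 1 / 2 - q) * \<Lambda> n powr (1 - q))"
        by (simp add: C_def algebra_simps)
    qed
    finally show ?thesis .
  qed
  with Cpos show ?thesis by blast
qed

text \<open>For the tail exponent a = \<beta>1 / (1 - 1/s), the requirement a > 1 is the same as B >
  0.\<close>

lemma truncation_error_isotropic_le: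
  fixes s \<mu> :: real and p :: ereal and r :: nat
  defines "q \<equiv> real_of_ereal (1 / p)"
  defines "B \<equiv> \<mu> - 2 * real r + 1 / s - 1 / 2"
  assumes "1 \<le> s" "1 \<le> p" "1 \<le> r" "0 < B"
  shows "\<exists>C>0. \<forall>n\<ge>1. \<forall>\<delta>>0. truncation_error r r s \<mu> p \<delta> n 1
     \<le> ennreal (C * (n powr (- B) * (1 + ln n) powr (1 - 1 / s)
                     + \<delta> * n powr (2 * real r + 1 / 2 - q) * (1 + ln n) powr (1 - q)))"
  unfolding q_def B_def
proof (rule truncation_error_le)
  show "tail_bound ((\<mu> - 2 * real r + 1 / 2) / (1 - 1 / s)) ((\<mu> - 2 * real r + 1 / 2) / (1 - 1 / s)) 1 (\<lambda>n. 1 + ln n)"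
    if "1 < s" using that assms by (intro tail_bound_isotropic) (simp add: B_def)
  show "head_bound ((2 * real r - 1 / 2) / (1 - real_of_ereal (1 / p))) ((2 * real r - 1 / 2) / (1 - real_of_ereal (1 / p))) 1 (\<lambda>n. 1 + ln n)"
    if "real_of_ereal (1 / p) < 1" using that assms by (intro head_bound_isotropic divide_nonneg_pos) auto
  show "0 < 1 + ln n" if "1 \<le> n" for n :: real using ln_ge_zero[OF that] by linarith
qed (use assms in auto)

text \<open>The upper restriction on \<gamma> is the condition \<gamma> (a - 1) < b - 1 of the tail
  sum multiplied by 1 - 1/s; \<gamma> > 1 gives the condition of the head sum.\<close>

lemma truncation_error_anisotropic_le:
  fixes s \<mu> \<gamma> :: real and p :: ereal and r1 r2 :: nat
  defines "q \<equiv> real_of_ereal (1 / p)"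
  defines "B \<equiv> \<mu> - 2 * real r1 + 1 / s - 1 / 2"
  assumes s: "1 \<le> s" and p: "1 \<le> p" and r: "1 \<le> r2" "r2 \<le> r1" and B: "0 < B"
    and \<gamma>: "1 < \<gamma>" "\<gamma> * B < \<mu> - 2 * real r2 + 1 / s - 1 / 2"
  shows "\<exists>C>0. \<forall>n\<ge>1. \<forall>\<delta>>0. truncation_error r1 r2 s \<mu> p \<delta> n \<gamma>
     \<le> ennreal (C * (n powr (- B) + \<delta> * n powr (2 * real r1 + 1 / 2 - q)))"
proof -
  have "\<exists>C>0. \<forall>n\<ge>1. \<forall>\<delta>>0. truncation_error r1 r2 s \<mu> p \<delta> n \<gamma>
     \<le> ennreal (C * (n powr (- B) * 1 powr (1 - 1 / s) + \<delta> * n powr (2 * real r1 + 1 / 2 - q) * 1 powr (1 - q)))"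
    unfolding q_def B_def
  proof (rule truncation_error_le)
    show "tail_bound ((\<mu> - 2 * real r1 + 1 / 2) / (1 - 1 / s)) ((\<mu> - 2 * real r2 + 1 / 2) / (1 - 1 / s)) \<gamma> (\<lambda>_. 1)"
      if s1: "1 < s"
    proof (rule tail_bound_anisotropic)
      have d: "0 < 1 - 1 / s" using s1 by simp
      show "1 < (\<mu> - 2 * real r1 + 1 / 2) / (1 - 1 / s)" using d B by (simp add: B_def)
      have D: "x / (1 - 1 / s) - 1 = (x - (1 - 1 / s)) / (1 - 1 / s)" for x
        using d s1 by (subst diff_divide_distrib) simp
      have e: "(\<mu> - 2 * real r1 + 1 / 2) / (1 - 1 / s) - 1 = B / (1 - 1 / s)"
        "(\<mu> - 2 * real r2 + 1 / 2) / (1 - 1 / s) - 1 = (\<mu> - 2 * real r2 + 1 / s - 1 / 2) / (1 - 1 / s)"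
        unfolding D B_def by (simp_all add: algebra_simps)
      show "\<gamma> * ((\<mu> - 2 * real r1 + 1 / 2) / (1 - 1 / s) - 1) < (\<mu> - 2 * real r2 + 1 / 2) / (1 - 1 / s) - 1"
        unfolding e using d \<gamma>(2) by (simp add: divide_strict_right_mono)
    qed
    show "head_bound ((2 * real r1 - 1 / 2) / (1 - real_of_ereal (1 / p))) ((2 * real r2 - 1 / 2) / (1 - real_of_ereal (1 / p))) \<gamma> (\<lambda>_. 1)"
      if q: "real_of_ereal (1 / p) < 1"
    proof (rule head_bound_anisotropic)
      let ?a = "(2 * real r1 - 1 / 2) / (1 - real_of_ereal (1 / p))"
      show a: "0 \<le> ?a" using q r by (intro divide_nonneg_pos) auto
      have "1 + (2 * real r2 - 1 / 2) / (1 - real_of_ereal (1 / p)) \<le> 1 + ?a"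
        using q r by (intro add_left_mono divide_right_mono) auto
      also have "\<dots> < \<gamma> * (1 + ?a)" using a \<gamma>(1) by (simp add: mult_less_cancel_right1 not_le)
      finally show "1 + (2 * real r2 - 1 / 2) / (1 - real_of_ereal (1 / p)) < \<gamma> * (1 + ?a)" .
    qed
    show "\<gamma> * (\<mu> - 2 * real r1 + 1 / 2) \<le> \<mu> - 2 * real r2 + 1 / 2" if "s = 1"
    proof -
      have "B = \<mu> - 2 * real r1 + 1 / 2" using that by (simp add: B_def)
      thus ?thesis using \<gamma>(2) that by simp
    qed
  qed (use assms in auto)
  thus ?thesis by simp
qed

subsection \<open>Orders in the noise level\<close>

lemma minimal_radius_le_truncation_error:
  assumes "finite (hyp_cross r1 r2 n \<gamma>)" "card (hyp_cross r1 r2 n \<gamma>) \<le> N"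
  shows "minimal_radius r1 r2 s \<mu> p N \<delta> \<le> truncation_error r1 r2 s \<mu> p \<delta> n \<gamma>"
  unfolding minimal_radius_def truncation_error_def
proof (rule INF_lower2)
  show "hyp_cross r1 r2 n \<gamma> \<in> {\<Omega>. \<Omega> \<subseteq> {r1..} \<times> {r2..} \<and> finite \<Omega> \<and> card \<Omega> \<le> N}"
    using assms hyp_cross_subset by simp
  show "(INF \<psi>\<in>recovery_maps (hyp_cross r1 r2 n \<gamma>). recovery_error r1 r2 s \<mu> p \<delta> (hyp_cross r1 r2 n \<gamma>) \<psi>)
      \<le> recovery_error r1 r2 s \<mu> p \<delta> (hyp_cross r1 r2 n \<gamma>) (deriv_sum r1 r2 (hyp_cross r1 r2 n \<gamma>))"
    by (rule INF_lower) (auto simp: recovery_maps_def deriv_sum_L2_Q)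
qed

lemma powr_neg_le_scaled:
  fixes a x y B :: real
  assumes "0 < a" "0 < x" "a * x \<le> y" "0 \<le> B"
  shows "y powr (-B) \<le> a powr (-B) * x powr (-B)"
proof -
  have "y powr (-B) \<le> (a * x) powr (-B)" using assms by (intro powr_mono2') auto
  thus ?thesis by (simp add: powr_mult)
qed

lemma scaled_powr_neg_le:
  fixes b x y B :: real
  assumes "0 < b" "0 < y" "0 < x" "y \<le> b * x" "0 \<le> B"
  shows "x powr (-B) \<le> b powr B * y powr (-B)"
proof -
  have "(b * x) powr (-B) \<le> y powr (-B)" using assms by (intro powr_mono2') auto
  hence "b powr B * (b powr (-B) * x powr (-B)) \<le> b powr B * y powr (-B)"
    by (intro mult_left_mono) (auto simp: powr_mult)
  thus ?thesis using assms by (simp add: powr_minus field_simps)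
qed

lemma real_of_ereal_inverse_bounds:
  assumes "1 \<le> (p :: ereal)"
  shows "0 \<le> real_of_ereal (1 / p)" "real_of_ereal (1 / p) \<le> 1"
  using assms by (cases p; simp add: one_ereal_def)+

text \<open>With X = \<delta>^(-1/A), the noise term \<delta> n^e is of order X^(e-A) = X^(-B), the
  order of the truncation term.\<close>

lemma anisotropic_truncation:
  fixes s \<mu> \<gamma> :: real and p :: ereal and r1 r2 :: nat
  fixes A B a b a' b' :: real
  defines "A \<equiv> \<mu> - real_of_ereal (1 / p) + 1 / s"
  defines "B \<equiv> \<mu> - 2 * real r1 + 1 / s - 1 / 2"
  assumes s: "1 \<le> s" and p: "1 \<le> p" and r: "1 \<le> r2" "r2 \<le> r1" and B: "0 < B"
    and \<gamma>: "1 < \<gamma>" "\<gamma> * B < \<mu> - 2 * real r2 + 1 / s - 1 / 2"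
    and pos: "0 < a" "0 < b" "0 < a'" "0 < b'"
  shows "\<exists>C>0. \<forall>\<^sub>F \<delta> in at_right 0. \<forall>(N::nat) (n::real).
          within_factors a b (real N) (\<delta> powr (- 1 / A)) \<and>
          within_factors a' b' n (\<delta> powr (- 1 / A)) \<longrightarrow>
            finite (hyp_cross r1 r2 n \<gamma>) \<and>
            real (card (hyp_cross r1 r2 n \<gamma>)) \<le> C * real N \<and>
            truncation_error r1 r2 s \<mu> p \<delta> n \<gamma> \<le> ennreal (C * real N powr (- B)) \<and>
            truncation_error r1 r2 s \<mu> p \<delta> n \<gamma> \<le> ennreal (C * \<delta> powr (B / A))"
proof -
  define e where "e = 2 * real r1 + 1 / 2 - real_of_ereal (1 / p)"
  have e: "0 < e" "A = B + e"
    using r real_of_ereal_inverse_bounds[OF p] by (auto simp: e_def A_def B_def)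
  have A: "0 < A" using e B by simp
  obtain C0 where C0: "0 < C0" "\<And>n \<delta>. 1 \<le> n \<Longrightarrow> 0 < \<delta> \<Longrightarrow>
      truncation_error r1 r2 s \<mu> p \<delta> n \<gamma> \<le> ennreal (C0 * (n powr (- B) + \<delta> * n powr e))"
    using truncation_error_anisotropic_le[OF s p r B[unfolded B_def] \<gamma>[unfolded B_def]]
    unfolding B_def e_def by blast
  obtain Cc where Cc: "0 < Cc" "\<And>n. 1 \<le> n \<Longrightarrow> real (card (hyp_cross r1 r2 n \<gamma>)) \<le> Cc * n"
    using card_hyp_cross_anisotropic[of r1 r2 \<gamma>] r \<gamma> by auto
  define C1 where "C1 = C0 * (a' powr (-B) + b' powr e)"
  define C where "C = Cc * b' / a + C1 + C1 * b powr B"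
  have C1: "0 < C1" using C0 pos by (simp add: C1_def add_pos_pos)
  have C: "0 < C" "Cc * b' / a \<le> C" "C1 \<le> C" "C1 * b powr B \<le> C"
    using C1 Cc pos by (auto simp: C_def intro!: add_pos_pos)
  \<comment> \<open>Small \<delta> makes both a X and a' X at least 1, so n \<ge> 1 and N > 0 for
    all admissible choices.\<close>
  have "\<forall>\<^sub>F \<delta> in at_right 0. max (1 / a) (1 / a') \<le> \<delta> powr (- 1 / A)"
  proof -
    have "filterlim (\<lambda>\<delta>. \<delta> powr (- 1 / A)) at_top (at_right 0)" using A by real_asymp
    thus ?thesis unfolding filterlim_at_top by blast
  qed
  moreover have "\<forall>\<^sub>F \<delta> in at_right 0. (0 :: real) < \<delta>" by (simp add: eventually_at_right_less)
  ultimately have "\<forall>\<^sub>F \<delta> in at_right 0. \<forall>(N::nat) (n::real).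
          within_factors a b (real N) (\<delta> powr (- 1 / A)) \<and>
          within_factors a' b' n (\<delta> powr (- 1 / A)) \<longrightarrow>
            finite (hyp_cross r1 r2 n \<gamma>) \<and>
            real (card (hyp_cross r1 r2 n \<gamma>)) \<le> C * real N \<and>
            truncation_error r1 r2 s \<mu> p \<delta> n \<gamma> \<le> ennreal (C * real N powr (- B)) \<and>
            truncation_error r1 r2 s \<mu> p \<delta> n \<gamma> \<le> ennreal (C * \<delta> powr (B / A))"
  proof (eventually_elim, intro allI impI, elim conjE)
    fix \<delta> :: real and N :: nat and n :: real
    define X where "X = \<delta> powr (- 1 / A)"
    assume "max (1 / a) (1 / a') \<le> \<delta> powr (- 1 / A)" and \<delta>: "0 < \<delta>"
      and "within_factors a b (real N) (\<delta> powr (- 1 / A))" "within_factors a' b' n (\<delta> powr (- 1 / A))"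
    hence X: "0 < X" "1 \<le> a * X" "1 \<le> a' * X" and N: "a * X \<le> real N" "real N \<le> b * X"
      and n: "a' * X \<le> n" "n \<le> b' * X"
      using pos by (auto simp: X_def within_factors_def pos_divide_le_eq mult.commute)
    have n1: "1 \<le> n" and N1: "0 < real N" using X n N by linarith+
    have \<delta>X: "\<delta> = X powr (-A)" "\<delta> powr (B / A) = X powr (-B)"
      using A \<delta> by (simp_all add: X_def powr_powr)
    have "n powr (-B) \<le> a' powr (-B) * X powr (-B)"
      using pos X n B by (intro powr_neg_le_scaled) auto
    moreover have "\<delta> * n powr e \<le> b' powr e * X powr (-B)"
    proof -
      have "\<delta> * n powr e \<le> \<delta> * (b' * X) powr e"
        using \<delta> n n1 e by (intro mult_left_mono powr_mono2) auto
      also have "\<dots> = b' powr e * (X powr (-A) * X powr e)"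
        unfolding \<delta>X(1) by (simp add: powr_mult)
      also have "X powr (-A) * X powr e = X powr (-B)" by (simp add: e flip: powr_add)
      finally show ?thesis .
    qed
    ultimately have "C0 * (n powr (-B) + \<delta> * n powr e) \<le> C0 * (a' powr (-B) * X powr (-B) + b' powr e * X powr (-B))"
      using C0 by (intro mult_left_mono add_mono) auto
    also have "\<dots> = C1 * X powr (-B)" by (simp add: C1_def algebra_simps)
    finally have T: "truncation_error r1 r2 s \<mu> p \<delta> n \<gamma> \<le> ennreal (C1 * X powr (-B))"
      using C0(2)[OF n1 \<delta>] by (meson ennreal_leI order_trans)
    have "C1 * X powr (-B) \<le> C1 * (b powr B * real N powr (-B))"
      using pos X N N1 B C1 by (intro mult_left_mono scaled_powr_neg_le) auto
    also have "\<dots> = (C1 * b powr B) * real N powr (-B)" by simp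
    also have "\<dots> \<le> C * real N powr (-B)" using C by (intro mult_right_mono) auto
    finally have T1: "truncation_error r1 r2 s \<mu> p \<delta> n \<gamma> \<le> ennreal (C * real N powr (-B))"
      using T by (meson ennreal_leI order_trans)
    have "C1 * X powr (-B) \<le> C * X powr (-B)" using C by (intro mult_right_mono) auto
    hence T2: "truncation_error r1 r2 s \<mu> p \<delta> n \<gamma> \<le> ennreal (C * \<delta> powr (B / A))"
      using T unfolding \<delta>X(2) by (meson ennreal_leI order_trans)
    have "real (card (hyp_cross r1 r2 n \<gamma>)) \<le> Cc * n" by (rule Cc(2)[OF n1])
    also have "\<dots> \<le> Cc * (b' * (real N / a))"
    proof -
      have "b' * X \<le> b' * (real N / a)" using N pos by (intro mult_left_mono) (auto simp: field_simps)
      thus ?thesis using n Cc by (intro mult_left_mono) auto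
    qed
    also have "\<dots> = (Cc * b' / a) * real N" by simp
    also have "\<dots> \<le> C * real N" using C by (intro mult_right_mono) auto
    finally have T3: "real (card (hyp_cross r1 r2 n \<gamma>)) \<le> C * real N" .
    have "finite (hyp_cross r1 r2 n \<gamma>)" using r \<gamma> by (intro finite_hyp_cross) auto
    with T1 T2 T3 show "finite (hyp_cross r1 r2 n \<gamma>) \<and>
            real (card (hyp_cross r1 r2 n \<gamma>)) \<le> C * real N \<and>
            truncation_error r1 r2 s \<mu> p \<delta> n \<gamma> \<le> ennreal (C * real N powr (- B)) \<and>
            truncation_error r1 r2 s \<mu> p \<delta> n \<gamma> \<le> ennreal (C * \<delta> powr (B / A))" by blast
  qed
  with C(1) show ?thesis by blast
qed

lemma anisotropic_radius:
  fixes s \<mu> :: real and p :: ereal and r1 r2 :: nat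
  fixes A B a b :: real
  defines "A \<equiv> \<mu> - real_of_ereal (1 / p) + 1 / s"
  defines "B \<equiv> \<mu> - 2 * real r1 + 1 / s - 1 / 2"
  assumes s: "1 \<le> s" and p: "1 \<le> p" and r: "1 \<le> r2" "r2 < r1" and B: "0 < B"
    and pos: "0 < a" "0 < b"
  shows "\<exists>c>0. \<exists>C>0. \<forall>\<^sub>F \<delta> in at_right 0. \<forall>N::nat.
          within_factors a b (real N) (\<delta> powr (- 1 / A)) \<longrightarrow>
            ennreal (c * real N powr (- B)) \<le> minimal_radius r1 r2 s \<mu> p N \<delta> \<and>
            minimal_radius r1 r2 s \<mu> p N \<delta> \<le> ennreal (C * real N powr (- B)) \<and>
            within_factors c C (real N powr (- B)) (\<delta> powr (B / A))"
proof -
  define B2 where "B2 = \<mu> - 2 * real r2 + 1 / s - 1 / 2"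
  have B2: "B < B2" using r by (simp add: B_def B2_def)
  \<comment> \<open>The midpoint of the admissible range (1, B2 / B).\<close>
  define \<gamma> where "\<gamma> = (1 + B2 / B) / 2"
  have "1 < B2 / B" using B B2 by simp
  hence \<gamma>: "1 < \<gamma>" "\<gamma> * B < B2"
    using B by (auto simp: \<gamma>_def field_simps)
  have A: "0 < A" using r B real_of_ereal_inverse_bounds[OF p] by (simp add: A_def B_def)
  have \<mu>: "0 \<le> \<mu>"
  proof -
    have "1 / s \<le> 1" using s by simp
    thus ?thesis using B r unfolding B_def by linarith
  qed
  obtain Cc where Cc: "0 < Cc" "\<And>n. 1 \<le> n \<Longrightarrow> real (card (hyp_cross r1 r2 n \<gamma>)) \<le> Cc * n"
    using card_hyp_cross_anisotropic[of r1 r2 \<gamma>] r \<gamma> by auto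
  \<comment> \<open>The cross with parameter c0 X has at most Cc c0 X = a X points, hence at most N,
    as the radius demands.\<close>
  define c0 where "c0 = a / Cc"
  have c0: "0 < c0" using pos Cc by (simp add: c0_def)
  obtain Cu where Cu: "0 < Cu" "\<forall>\<^sub>F \<delta> in at_right 0. \<forall>(N::nat) (n::real).
          within_factors a b (real N) (\<delta> powr (- 1 / A)) \<and>
          within_factors c0 c0 n (\<delta> powr (- 1 / A)) \<longrightarrow>
            finite (hyp_cross r1 r2 n \<gamma>) \<and>
            real (card (hyp_cross r1 r2 n \<gamma>)) \<le> Cu * real N \<and>
            truncation_error r1 r2 s \<mu> p \<delta> n \<gamma> \<le> ennreal (Cu * real N powr (- B)) \<and>
            truncation_error r1 r2 s \<mu> p \<delta> n \<gamma> \<le> ennreal (Cu * \<delta> powr (B / A))"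
    using anisotropic_truncation[OF s p r(1) less_imp_le[OF r(2)] B[unfolded B_def] \<gamma>[unfolded B2_def B_def] pos c0 c0]
    unfolding A_def B_def by blast
  obtain cl where cl: "0 < cl" "\<And>N \<delta>. 1 \<le> N \<Longrightarrow> 0 < \<delta> \<Longrightarrow> ennreal (cl * real N powr (- B)) \<le> minimal_radius r1 r2 s \<mu> p N \<delta>"
    using minimal_radius_ge[of s r2 r1 \<mu> p] s r \<mu> unfolding B_def by auto
  define c where "c = min cl (inverse (b powr B))"
  define C where "C = max Cu (a powr (-B))"
  have cC: "0 < c" "0 < C" "c \<le> cl" "c \<le> inverse (b powr B)" "Cu \<le> C" "a powr (-B) \<le> C"
    using cl Cu pos by (auto simp: c_def C_def)
  have "\<forall>\<^sub>F \<delta> in at_right 0. max (1 / a) (1 / c0) \<le> \<delta> powr (- 1 / A)"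
  proof -
    have "filterlim (\<lambda>\<delta>. \<delta> powr (- 1 / A)) at_top (at_right 0)" using A by real_asymp
    thus ?thesis unfolding filterlim_at_top by blast
  qed
  moreover have "\<forall>\<^sub>F \<delta> in at_right 0. (0 :: real) < \<delta>" by (simp add: eventually_at_right_less)
  ultimately have "\<forall>\<^sub>F \<delta> in at_right 0. \<forall>N::nat.
          within_factors a b (real N) (\<delta> powr (- 1 / A)) \<longrightarrow>
            ennreal (c * real N powr (- B)) \<le> minimal_radius r1 r2 s \<mu> p N \<delta> \<and>
            minimal_radius r1 r2 s \<mu> p N \<delta> \<le> ennreal (C * real N powr (- B)) \<and>
            within_factors c C (real N powr (- B)) (\<delta> powr (B / A))"
    using Cu(2)
  proof (eventually_elim, intro allI impI)
    fix \<delta> :: real and N :: nat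
    define X where "X = \<delta> powr (- 1 / A)"
    assume big: "max (1 / a) (1 / c0) \<le> \<delta> powr (- 1 / A)" and \<delta>: "0 < \<delta>"
      and up: "\<forall>(N::nat) (n::real).
          within_factors a b (real N) (\<delta> powr (- 1 / A)) \<and>
          within_factors c0 c0 n (\<delta> powr (- 1 / A)) \<longrightarrow>
            finite (hyp_cross r1 r2 n \<gamma>) \<and>
            real (card (hyp_cross r1 r2 n \<gamma>)) \<le> Cu * real N \<and>
            truncation_error r1 r2 s \<mu> p \<delta> n \<gamma> \<le> ennreal (Cu * real N powr (- B)) \<and>
            truncation_error r1 r2 s \<mu> p \<delta> n \<gamma> \<le> ennreal (Cu * \<delta> powr (B / A))"
      and wN: "within_factors a b (real N) (\<delta> powr (- 1 / A))"
    from big wN have X: "0 < X" "1 \<le> a * X" "1 \<le> c0 * X" and N: "a * X \<le> real N" "real N \<le> b * X"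
      using pos c0 \<delta> by (auto simp: X_def within_factors_def pos_divide_le_eq mult.commute)
    have N1: "1 \<le> real N" using X N by linarith
    have \<delta>X: "\<delta> powr (B / A) = X powr (-B)"
      using A \<delta> by (simp add: X_def powr_powr)
    have wn: "within_factors c0 c0 (c0 * X) (\<delta> powr (- 1 / A))" by (simp add: within_factors_def X_def)
    have lo: "ennreal (c * real N powr (- B)) \<le> minimal_radius r1 r2 s \<mu> p N \<delta>"
    proof -
      have "ennreal (c * real N powr (- B)) \<le> ennreal (cl * real N powr (- B))"
        using cC by (intro ennreal_leI mult_right_mono) auto
      also have "\<dots> \<le> minimal_radius r1 r2 s \<mu> p N \<delta>" using N1 \<delta> by (intro cl(2)) auto
      finally show ?thesis .
    qed
    have "real (card (hyp_cross r1 r2 (c0 * X) \<gamma>)) \<le> Cc * (c0 * X)" by (rule Cc(2)[OF X(3)])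
    also have "\<dots> = a * X" using Cc by (simp add: c0_def)
    finally have "card (hyp_cross r1 r2 (c0 * X) \<gamma>) \<le> N" using N by linarith
    hence "minimal_radius r1 r2 s \<mu> p N \<delta> \<le> truncation_error r1 r2 s \<mu> p \<delta> (c0 * X) \<gamma>"
      using up wN wn by (intro minimal_radius_le_truncation_error) auto
    also have "\<dots> \<le> ennreal (Cu * real N powr (- B))" using up wN wn by blast
    also have "\<dots> \<le> ennreal (C * real N powr (- B))"
      using cC by (intro ennreal_leI mult_right_mono) auto
    finally have hi: "minimal_radius r1 r2 s \<mu> p N \<delta> \<le> ennreal (C * real N powr (- B))" .
    have "X powr (-B) \<le> b powr B * real N powr (-B)"
      using pos X N N1 B by (intro scaled_powr_neg_le) auto
    hence "inverse (b powr B) * X powr (-B) \<le> real N powr (-B)"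
      using pos by (simp add: field_simps)
    moreover have "c * X powr (-B) \<le> inverse (b powr B) * X powr (-B)"
      using cC by (intro mult_right_mono) auto
    moreover have "real N powr (-B) \<le> a powr (-B) * X powr (-B)"
      using pos X N B by (intro powr_neg_le_scaled) auto
    moreover have "a powr (-B) * X powr (-B) \<le> C * X powr (-B)"
      using cC by (intro mult_right_mono) auto
    ultimately have "within_factors c C (real N powr (- B)) (\<delta> powr (B / A))"
      by (simp add: within_factors_def \<delta>X)
    with lo hi show "ennreal (c * real N powr (- B)) \<le> minimal_radius r1 r2 s \<mu> p N \<delta> \<and>
            minimal_radius r1 r2 s \<mu> p N \<delta> \<le> ennreal (C * real N powr (- B)) \<and>
            within_factors c C (real N powr (- B)) (\<delta> powr (B / A))" by blast
  qed
  with cC show ?thesis by blast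
qed

text \<open>With L = ln (1/\<delta>) and |\<kappa>| \<le> 1, the factor L^\<kappa> is at least 1/L,
  so the scale still tends to infinity; and \<kappa> ln L is at most L, so its logarithm is at most
  2L/A.\<close>

lemma isotropic_scale_eventually:
  fixes A \<kappa> M :: real
  assumes A: "0 < A" and \<kappa>: "- 1 \<le> \<kappa>" "\<kappa> \<le> 1"
  shows "\<forall>\<^sub>F \<delta> in at_right 0. 0 < \<delta> \<and> 1 \<le> ln (1 / \<delta>) \<and> M \<le> ln (1 / \<delta>) \<and>
    M \<le> (1 / \<delta> * ln (1 / \<delta>) powr \<kappa>) powr (1 / A) \<and>
    ln ((1 / \<delta> * ln (1 / \<delta>) powr \<kappa>) powr (1 / A)) \<le> 2 / A * ln (1 / \<delta>)"
proof -
  have "filterlim (\<lambda>\<delta>::real. ln (1 / \<delta>)) at_top (at_right 0)" by real_asymp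
  hence "\<forall>\<^sub>F \<delta> in at_right 0. max 1 M \<le> ln (1 / \<delta>)" unfolding filterlim_at_top by blast
  moreover have "filterlim (\<lambda>\<delta>::real. 1 / \<delta> / ln (1 / \<delta>)) at_top (at_right 0)" by real_asymp
  hence "\<forall>\<^sub>F \<delta> in at_right 0. max 1 M powr A \<le> 1 / \<delta> / ln (1 / \<delta>)" unfolding filterlim_at_top by blast
  moreover have "\<forall>\<^sub>F \<delta> in at_right 0. (0 :: real) < \<delta>" by (simp add: eventually_at_right_less)
  ultimately show ?thesis
  proof eventually_elim
    fix \<delta> :: real
    define L where "L = ln (1 / \<delta>)"
    assume "max 1 M \<le> ln (1 / \<delta>)" and "max 1 M powr A \<le> 1 / \<delta> / ln (1 / \<delta>)" and \<delta>: "0 < \<delta>"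
    hence L: "1 \<le> L" "M \<le> L" and big: "max 1 M powr A \<le> 1 / \<delta> / L" by (auto simp: L_def)
    define y where "y = 1 / \<delta> * L powr \<kappa>"
    have y: "0 < y" using \<delta> L by (simp add: y_def)
    have "L powr (-1) \<le> L powr \<kappa>" using L \<kappa> by (intro powr_mono) auto
    hence "1 / \<delta> * L powr (-1) \<le> y" unfolding y_def using \<delta> by (intro mult_left_mono) auto
    hence "1 / \<delta> / L \<le> y" using L by (simp add: powr_minus_divide)
    hence "(max 1 M powr A) powr (1 / A) \<le> y powr (1 / A)"
      using big A by (intro powr_mono2) auto
    hence M: "M \<le> y powr (1 / A)" using A by (simp add: powr_powr)
    have "\<kappa> * ln L \<le> 1 * ln L" using \<kappa> L by (intro mult_right_mono) auto
    also have "\<dots> \<le> L" using ln_le_minus_one[of L] L by simp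
    finally have "\<kappa> * ln L \<le> L" .
    moreover have "ln y = ln (1 / \<delta>) + ln (L powr \<kappa>)"
      unfolding y_def using \<delta> L by (intro ln_mult_pos) auto
    ultimately have "ln y \<le> 2 * L" using L by (simp only: ln_powr flip: L_def)
    hence "ln (y powr (1 / A)) \<le> 2 / A * L" using A y by (simp add: ln_powr divide_right_mono)
    with L \<delta> M show "0 < \<delta> \<and> 1 \<le> ln (1 / \<delta>) \<and> M \<le> ln (1 / \<delta>) \<and>
      M \<le> (1 / \<delta> * ln (1 / \<delta>) powr \<kappa>) powr (1 / A) \<and>
      ln ((1 / \<delta> * ln (1 / \<delta>) powr \<kappa>) powr (1 / A)) \<le> 2 / A * ln (1 / \<delta>)"
      by (simp add: y_def L_def)
  qed
qed

text \<open>\<open>n0\<close> and \<open>N0\<close> are the orders of the truncation parameter and of the number of data in the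
  isotropic case; they differ by one logarithm, the cardinality of the hyperbolic cross being of
  order \<open>n0 ln n0\<close>.\<close>

lemma isotropic_scales:
  fixes A B \<mu> \<kappa> \<delta> L n0 N0 :: real
  assumes \<delta>: "0 < \<delta>" and L: "1 \<le> L" "L = ln (1 / \<delta>)" and A: "0 < A" "A = \<mu> - \<kappa>" and \<mu>: "0 \<le> \<mu>"
    and n0: "n0 = (1 / \<delta> * L powr \<kappa>) powr (1 / A)" and N0: "N0 = (\<delta> / L powr \<mu>) powr (- 1 / A)"
  shows "0 < n0" "0 < N0" "N0 = n0 * L" "\<delta> = n0 powr (-A) * L powr \<kappa>"
    "(\<delta> * L powr (-\<kappa>)) powr (B / A) = n0 powr (-B)" "(\<delta> / L powr \<mu>) powr (B / A) = N0 powr (-B)"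
    "L / A \<le> ln N0"
proof -
  have Lp: "0 < L" using L by simp
  show n0p: "0 < n0" and N0p: "0 < N0" using \<delta> Lp by (auto simp: n0 N0)
  have n0': "n0 = (\<delta> * L powr (-\<kappa>)) powr (- 1 / A)"
  proof -
    have "1 / \<delta> * L powr \<kappa> = (\<delta> * L powr (-\<kappa>)) powr (-1)"
      using \<delta> Lp by (simp add: powr_mult powr_powr powr_minus_divide)
    thus ?thesis by (simp only: n0 powr_powr) simp
  qed
  show "(\<delta> * L powr (-\<kappa>)) powr (B / A) = n0 powr (-B)"
    unfolding n0' using A by (simp add: powr_powr)
  show "(\<delta> / L powr \<mu>) powr (B / A) = N0 powr (-B)"
    unfolding N0 using A by (simp add: powr_powr)
  have "n0 powr (-A) = \<delta> * L powr (-\<kappa>)"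
    unfolding n0' using A(1) \<delta> Lp by (simp add: powr_powr)
  thus "\<delta> = n0 powr (-A) * L powr \<kappa>" using Lp by (simp add: mult.assoc flip: powr_add)
  have "N0 = (\<delta> * L powr (-\<mu>)) powr (- 1 / A)" by (simp add: N0 powr_minus_divide)
  \<comment> \<open>Since \<mu> = \<kappa> + A, the additional factor is L^(-A), which the power
    -1/A turns into a single L.\<close>
  also have "\<delta> * L powr (-\<mu>) = (\<delta> * L powr (-\<kappa>)) * L powr (-A)"
    by (simp add: A mult.assoc flip: powr_add)
  also have "\<dots> powr (- 1 / A) = n0 * L"
    using A(1) Lp by (simp add: n0' powr_mult powr_powr)
  finally show N0n0: "N0 = n0 * L" .
  have "ln N0 = (- 1 / A) * (ln \<delta> - \<mu> * ln L)"
    using \<delta> Lp by (simp add: N0 ln_powr ln_div)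
  also have "\<dots> = (L + \<mu> * ln L) / A" using \<delta> A(1) by (simp add: L(2) ln_div field_simps)
  finally show "L / A \<le> ln N0" using \<mu> L(1) A by (simp add: divide_right_mono)
qed

text \<open>Up to constants, 1 + ln n is at most L = ln (1/\<delta>). Both error terms then have the
  bound n0^(-B) L^(1-1/s), which is rewritten once through \<delta> and once through N.\<close>

lemma isotropic_truncation:
  fixes s \<mu> :: real and p :: ereal and r :: nat
  fixes A B a b a' b' :: real
  defines "A \<equiv> \<mu> - real_of_ereal (1 / p) + 1 / s"
  defines "B \<equiv> \<mu> - 2 * real r + 1 / s - 1 / 2"
  assumes s: "1 \<le> s" and p: "1 \<le> p" and r: "1 \<le> r" and B: "0 < B"
    and pos: "0 < a" "0 < b" "0 < a'" "0 < b'"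
  shows "\<exists>C>0. \<forall>\<^sub>F \<delta> in at_right 0. \<forall>(N::nat) (n::real).
          within_factors a b (real N) ((\<delta> / ln (1 / \<delta>) powr \<mu>) powr (- 1 / A)) \<and>
          within_factors a' b' n
            ((1 / \<delta> * ln (1 / \<delta>) powr (real_of_ereal (1 / p) - 1 / s)) powr (1 / A)) \<longrightarrow>
            finite (hyp_cross r r n 1) \<and>
            real (card (hyp_cross r r n 1)) \<le> C * real N \<and>
            truncation_error r r s \<mu> p \<delta> n 1
              \<le> ennreal (C * (real N powr (- B) * ln (real N) powr (\<mu> - 2 * real r + 1))) \<and>
            truncation_error r r s \<mu> p \<delta> n 1
              \<le> ennreal (C * ((\<delta> * ln (1 / \<delta>) powr (1 / s - real_of_ereal (1 / p))) powr (B / A)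
                              * ln (1 / \<delta>) powr (3 / 2 - 1 / s)))"
proof -
  define q where "q = real_of_ereal (1 / p)"
  define \<kappa> where "\<kappa> = q - 1 / s"
  define e where "e = 2 * real r + 1 / 2 - q"
  define E where "E = \<mu> - 2 * real r + 1"
  have q: "0 \<le> q" "q \<le> 1" using real_of_ereal_inverse_bounds[OF p] by (auto simp: q_def)
  have s1: "0 < 1 / s" "1 / s \<le> 1" using s by auto
  have \<kappa>: "- 1 \<le> \<kappa>" "\<kappa> \<le> 1" unfolding \<kappa>_def using q s1 by linarith+
  have e: "0 < e" "A = B + e" using r q by (auto simp: e_def A_def B_def q_def)
  have A: "0 < A" "A = \<mu> - \<kappa>" using e B by (auto simp: A_def \<kappa>_def q_def)
  have E: "0 < E" "E = B + (3 / 2 - 1 / s)"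
    unfolding E_def B_def using B[unfolded B_def] s1 by linarith+
  have \<mu>: "0 \<le> \<mu>" using B r s1 unfolding B_def by linarith
  obtain C0 where C0: "0 < C0" "\<And>n \<delta>. 1 \<le> n \<Longrightarrow> 0 < \<delta> \<Longrightarrow> truncation_error r r s \<mu> p \<delta> n 1
      \<le> ennreal (C0 * (n powr (- B) * (1 + ln n) powr (1 - 1 / s) + \<delta> * n powr e * (1 + ln n) powr (1 - q)))"
    using truncation_error_isotropic_le[OF s p r B[unfolded B_def]]
    unfolding B_def e_def q_def by blast
  \<comment> \<open>From ln n \<le> ln b' + ln n0, with ln n0 \<le> 2L/A and L \<ge> 1.\<close>
  define C1 where "C1 = 1 + \<bar>ln b'\<bar> + 2 / A"
  have C1: "0 < C1" using A by (simp add: C1_def add_pos_nonneg)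
  define C2 where "C2 = C0 * (a' powr (-B) * C1 powr (1 - 1 / s) + b' powr e * C1 powr (1 - q))"
  define C3 where "C3 = C2 * (b powr B * (2 * A) powr E)"
  define C where "C = b' * C1 / a + C2 + C3"
  have C2: "0 < C2" using C0 C1 pos by (simp add: C2_def add_pos_pos)
  have C3: "0 < C3" using C2 pos A by (simp add: C3_def)
  have C: "0 < C" "b' * C1 / a \<le> C" "C2 \<le> C" "C3 \<le> C"
    using C1 C2 C3 pos by (auto simp: C_def intro!: add_pos_pos)
  \<comment> \<open>The first entry gives n \<ge> 1. The second makes |ln a| at most L/(2A), so that
    ln N \<ge> ln a + L/A still exceeds L/(2A).\<close>
  define M where "M = max (1 / a') (2 * A * \<bar>ln a\<bar>)"
  have "\<forall>\<^sub>F \<delta> in at_right 0. 0 < \<delta> \<and> 1 \<le> ln (1 / \<delta>) \<and> M \<le> ln (1 / \<delta>) \<and>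
    M \<le> (1 / \<delta> * ln (1 / \<delta>) powr \<kappa>) powr (1 / A) \<and>
    ln ((1 / \<delta> * ln (1 / \<delta>) powr \<kappa>) powr (1 / A)) \<le> 2 / A * ln (1 / \<delta>)"
    by (rule isotropic_scale_eventually[OF A(1) \<kappa>])
  hence "\<forall>\<^sub>F \<delta> in at_right 0. \<forall>(N::nat) (n::real).
          within_factors a b (real N) ((\<delta> / ln (1 / \<delta>) powr \<mu>) powr (- 1 / A)) \<and>
          within_factors a' b' n ((1 / \<delta> * ln (1 / \<delta>) powr (q - 1 / s)) powr (1 / A)) \<longrightarrow>
            finite (hyp_cross r r n 1) \<and>
            real (card (hyp_cross r r n 1)) \<le> C * real N \<and>
            truncation_error r r s \<mu> p \<delta> n 1 \<le> ennreal (C * (real N powr (- B) * ln (real N) powr E)) \<and>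
            truncation_error r r s \<mu> p \<delta> n 1
              \<le> ennreal (C * ((\<delta> * ln (1 / \<delta>) powr (1 / s - q)) powr (B / A) * ln (1 / \<delta>) powr (3 / 2 - 1 / s)))"
  proof (eventually_elim, intro allI impI, elim conjE)
    fix \<delta> n :: real and N :: nat
    define L where "L = ln (1 / \<delta>)"
    define n0 where "n0 = (1 / \<delta> * L powr \<kappa>) powr (1 / A)"
    define N0 where "N0 = (\<delta> / L powr \<mu>) powr (- 1 / A)"
    assume \<delta>: "0 < \<delta>" and "1 \<le> ln (1 / \<delta>)" "M \<le> ln (1 / \<delta>)"
      "M \<le> (1 / \<delta> * ln (1 / \<delta>) powr \<kappa>) powr (1 / A)"
      "ln ((1 / \<delta> * ln (1 / \<delta>) powr \<kappa>) powr (1 / A)) \<le> 2 / A * ln (1 / \<delta>)"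
      and "within_factors a b (real N) ((\<delta> / ln (1 / \<delta>) powr \<mu>) powr (- 1 / A))"
      "within_factors a' b' n ((1 / \<delta> * ln (1 / \<delta>) powr (q - 1 / s)) powr (1 / A))"
    hence L: "1 \<le> L" "M \<le> L" and M: "M \<le> n0" and lnn0: "ln n0 \<le> 2 / A * L"
      and N: "a * N0 \<le> real N" "real N \<le> b * N0" and n: "a' * n0 \<le> n" "n \<le> b' * n0"
      by (auto simp: L_def n0_def N0_def within_factors_def \<kappa>_def)
    note sc = isotropic_scales[OF \<delta> L(1) L_def A \<mu> n0_def N0_def]
    have "1 / a' \<le> n0" using M by (simp add: M_def)
    hence n1: "1 \<le> n" using n pos by (simp add: pos_divide_le_eq mult.commute)
    have aN0: "0 < a * N0" using pos sc(2) by simp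
    hence N1: "0 < real N" using N by linarith
    have lnn: "1 + ln n \<le> C1 * L" "0 \<le> 1 + ln n"
    proof -
      show "0 \<le> 1 + ln n" using ln_ge_zero[OF n1] by simp
      have "ln n \<le> ln (b' * n0)" using n n1 by simp
      also have "\<dots> = ln b' + ln n0" using pos sc(1) by (simp add: ln_mult_pos)
      finally have "1 + ln n \<le> 1 + \<bar>ln b'\<bar> + 2 / A * L" using lnn0 by linarith
      also have "\<dots> \<le> (1 + \<bar>ln b'\<bar>) * L + 2 / A * L"
        using mult_left_mono[OF L(1), of "1 + \<bar>ln b'\<bar>"] by simp
      finally show "1 + ln n \<le> C1 * L" by (simp add: C1_def algebra_simps)
    qed
    have lnp: "(1 + ln n) powr x \<le> C1 powr x * L powr x" if "0 \<le> x" for x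
    proof -
      have "(1 + ln n) powr x \<le> (C1 * L) powr x" using lnn that by (intro powr_mono2) auto
      thus ?thesis by (simp add: powr_mult)
    qed
    let ?Z = "n0 powr (-B) * L powr (1 - 1 / s)"
    have h1: "n powr (-B) * (1 + ln n) powr (1 - 1 / s)
        \<le> (a' powr (-B) * n0 powr (-B)) * (C1 powr (1 - 1 / s) * L powr (1 - 1 / s))"
      using pos n sc(1) B s1 by (intro mult_mono powr_neg_le_scaled lnp) auto
    have h2: "\<delta> * n powr e * (1 + ln n) powr (1 - q)
        \<le> (\<delta> * (b' powr e * n0 powr e)) * (C1 powr (1 - q) * L powr (1 - q))"
    proof (intro mult_mono lnp)
      have "n powr e \<le> (b' * n0) powr e" using n n1 e by (intro powr_mono2) auto
      thus "n powr e \<le> b' powr e * n0 powr e" by (simp add: powr_mult)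
    qed (use \<delta> q in auto)
    \<comment> \<open>Here \<kappa> does its work: \<delta> = n0^(-A) L^\<kappa> turns the
      logarithmic power 1 - q of the noise into \<kappa> + 1 - q = 1 - 1/s, that of the
      tail.\<close>
    have h5: "\<delta> * n0 powr e * L powr (1 - q) = ?Z"
    proof -
      have "\<delta> * n0 powr e * L powr (1 - q) = (n0 powr (-A) * n0 powr e) * (L powr \<kappa> * L powr (1 - q))"
        by (subst sc(4)) (simp add: mult_ac)
      also have "\<dots> = ?Z" by (simp add: e(2) \<kappa>_def flip: powr_add)
      finally show ?thesis .
    qed
    have h3: "(\<delta> * (b' powr e * n0 powr e)) * (C1 powr (1 - q) * L powr (1 - q)) = (b' powr e * C1 powr (1 - q)) * ?Z"
      unfolding h5[symmetric] by (simp only: mult_ac)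
    have h4: "(a' powr (-B) * n0 powr (-B)) * (C1 powr (1 - 1 / s) * L powr (1 - 1 / s)) = (a' powr (-B) * C1 powr (1 - 1 / s)) * ?Z"
      by (simp add: mult_ac)
    have "C0 * (n powr (-B) * (1 + ln n) powr (1 - 1 / s) + \<delta> * n powr e * (1 + ln n) powr (1 - q))
        \<le> C0 * ((a' powr (-B) * C1 powr (1 - 1 / s)) * ?Z + (b' powr e * C1 powr (1 - q)) * ?Z)"
      by (rule mult_left_mono[OF add_mono[OF h1[unfolded h4] h2[unfolded h3]] less_imp_le[OF C0(1)]])
    also have "\<dots> = C2 * ?Z" by (simp add: C2_def algebra_simps)
    finally have T: "truncation_error r r s \<mu> p \<delta> n 1 \<le> ennreal (C2 * ?Z)"
      using C0(2)[OF n1 \<delta>] by (meson ennreal_leI order_trans)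
    \<comment> \<open>The estimate carries L^(1-1/s); it is enlarged by L^(1/2), using L \<ge> 1, to
      the power in the claim.\<close>
    have Z: "?Z \<le> n0 powr (-B) * L powr (3 / 2 - 1 / s)"
      using L by (intro mult_left_mono powr_mono) auto
    have "C2 * ?Z \<le> C * (n0 powr (-B) * L powr (3 / 2 - 1 / s))"
      by (rule mult_mono[OF C(3) Z]) (use C in auto)
    moreover have "n0 powr (-B) = (\<delta> * L powr (1 / s - q)) powr (B / A)"
      using sc(5)[of B] by (simp add: \<kappa>_def)
    ultimately have T2: "truncation_error r r s \<mu> p \<delta> n 1 \<le> ennreal (C * ((\<delta> * L powr (1 / s - q)) powr (B / A) * L powr (3 / 2 - 1 / s)))"
      using T by (metis (no_types) ennreal_leI order_trans)
    \<comment> \<open>Replacing n0 by N0 / L produces L^B, so the exponent of L becomes B + 3/2 -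
      1/s = E.\<close>
    have "n0 powr (-B) * L powr (3 / 2 - 1 / s) = N0 powr (-B) * L powr E"
    proof -
      have "N0 powr (-B) * L powr E = n0 powr (-B) * (L powr (-B) * L powr E)"
        by (simp add: sc(3) powr_mult)
      also have "L powr (-B) * L powr E = L powr (3 / 2 - 1 / s)" by (simp add: E flip: powr_add)
      finally show ?thesis ..
    qed
    also have "\<dots> \<le> (b powr B * real N powr (-B)) * ((2 * A) powr E * ln (real N) powr E)"
    proof (intro mult_mono)
      show "N0 powr (-B) \<le> b powr B * real N powr (-B)"
        using pos N1 sc(2) N B by (intro scaled_powr_neg_le) auto
      have "ln (a * N0) \<le> ln (real N)" using N aN0 N1 by (subst ln_le_cancel_iff) auto
      hence "ln a + L / A \<le> ln (real N)" using sc(7) pos sc(2) by (simp add: ln_mult_pos)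
      moreover have "- (L / (2 * A)) \<le> ln a"
      proof -
        have "2 * A * \<bar>ln a\<bar> \<le> L" using L(2) by (simp add: M_def)
        hence "\<bar>ln a\<bar> \<le> L / (2 * A)" using A(1) by (simp add: pos_le_divide_eq mult.commute)
        thus ?thesis by linarith
      qed
      moreover have "L / A = L / (2 * A) + L / (2 * A)" by simp
      ultimately have "L / (2 * A) \<le> ln (real N)" by linarith
      hence "L \<le> 2 * A * ln (real N)" using A(1) by (simp add: pos_divide_le_eq mult.commute)
      hence "L powr E \<le> (2 * A * ln (real N)) powr E" using L E by (intro powr_mono2) auto
      thus "L powr E \<le> (2 * A) powr E * ln (real N) powr E" by (simp add: powr_mult)
    qed auto
    finally have "C2 * ?Z \<le> C2 * ((b powr B * real N powr (-B)) * ((2 * A) powr E * ln (real N) powr E))"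
      using Z C2 by (intro mult_left_mono) auto
    also have "\<dots> = C3 * (real N powr (-B) * ln (real N) powr E)" by (simp add: C3_def mult_ac)
    also have "\<dots> \<le> C * (real N powr (-B) * ln (real N) powr E)" using C by (intro mult_right_mono) auto
    finally have T1: "truncation_error r r s \<mu> p \<delta> n 1 \<le> ennreal (C * (real N powr (-B) * ln (real N) powr E))"
      using T by (meson ennreal_leI order_trans)
    have "real (card (hyp_cross r r n 1)) \<le> n * (1 + ln n)" by (rule card_hyp_cross_isotropic[OF r r n1])
    also have "\<dots> \<le> (b' * n0) * (C1 * L)" using n n1 lnn by (intro mult_mono) auto
    also have "\<dots> = b' * C1 * N0" by (simp add: sc(3))
    also have "\<dots> \<le> b' * C1 * (real N / a)"
      using N pos C1 by (intro mult_left_mono) (auto simp: pos_le_divide_eq mult.commute)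
    also have "\<dots> = (b' * C1 / a) * real N" by simp
    also have "\<dots> \<le> C * real N" using C by (intro mult_right_mono) auto
    finally have T3: "real (card (hyp_cross r r n 1)) \<le> C * real N" .
    have "finite (hyp_cross r r n 1)" using r by (intro finite_hyp_cross) auto
    with T1 T2 T3 show "finite (hyp_cross r r n 1) \<and>
            real (card (hyp_cross r r n 1)) \<le> C * real N \<and>
            truncation_error r r s \<mu> p \<delta> n 1 \<le> ennreal (C * (real N powr (- B) * ln (real N) powr E)) \<and>
            truncation_error r r s \<mu> p \<delta> n 1
              \<le> ennreal (C * ((\<delta> * ln (1 / \<delta>) powr (1 / s - q)) powr (B / A) * ln (1 / \<delta>) powr (3 / 2 - 1 / s)))"
      by (simp add: L_def)
  qed
  with C(1) show ?thesis unfolding q_def E_def by blast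
qed

lemma isotropic_radius:
  fixes s \<mu> :: real and p :: ereal and r :: nat
  fixes A B a b :: real
  defines "A \<equiv> \<mu> - real_of_ereal (1 / p) + 1 / s"
  defines "B \<equiv> \<mu> - 2 * real r + 1 / s - 1 / 2"
  assumes s: "1 \<le> s" and p: "1 \<le> p" and r: "1 \<le> r" and B: "0 < B"
    and pos: "0 < a" "0 < b"
  shows "\<exists>c>0. \<exists>C>0. \<forall>\<^sub>F \<delta> in at_right 0. \<forall>N::nat.
          within_factors a b (real N) ((\<delta> / ln (1 / \<delta>) powr \<mu>) powr (- 1 / A)) \<longrightarrow>
            ennreal (c * real N powr (- B)) \<le> minimal_radius r r s \<mu> p N \<delta> \<and>
            minimal_radius r r s \<mu> p N \<delta>
              \<le> ennreal (C * (real N powr (- B) * ln (real N) powr (\<mu> - 2 * real r + 1))) \<and>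
            ennreal (c * (\<delta> / ln (1 / \<delta>) powr \<mu>) powr (B / A))
              \<le> minimal_radius r r s \<mu> p N \<delta> \<and>
            minimal_radius r r s \<mu> p N \<delta>
              \<le> ennreal (C * ((\<delta> * ln (1 / \<delta>) powr (1 / s - real_of_ereal (1 / p))) powr (B / A)
                              * ln (1 / \<delta>) powr (3 / 2 - 1 / s)))"
proof -
  define q where "q = real_of_ereal (1 / p)"
  define \<kappa> where "\<kappa> = q - 1 / s"
  have q: "0 \<le> q" "q \<le> 1" using real_of_ereal_inverse_bounds[OF p] by (auto simp: q_def)
  have s1: "0 < 1 / s" "1 / s \<le> 1" using s by auto
  have \<kappa>: "- 1 \<le> \<kappa>" "\<kappa> \<le> 1" unfolding \<kappa>_def using q s1 by linarith+
  have A: "0 < A" "A = \<mu> - \<kappa>" using B q r by (auto simp: A_def B_def \<kappa>_def q_def)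
  have \<mu>: "0 \<le> \<mu>" using B r s1 unfolding B_def by linarith
  \<comment> \<open>The cross with parameter c0 n0 has at most c0 n0 (1 + 2/A) L points, which is at
    most a N0 and so at most N; c0 \<le> 1 makes ln c0 nonpositive in this count.\<close>
  define c0 where "c0 = min 1 (a / (1 + 2 / A))"
  have c0: "0 < c0" "c0 \<le> 1" "c0 * (1 + 2 / A) \<le> a"
  proof -
    have "0 < 1 + 2 / A" using A by (simp add: add_pos_pos)
    thus "0 < c0" "c0 \<le> 1" "c0 * (1 + 2 / A) \<le> a"
      using pos by (auto simp: c0_def pos_le_divide_eq[symmetric])
  qed
  obtain Cu where Cu: "0 < Cu" "\<forall>\<^sub>F \<delta> in at_right 0. \<forall>(N::nat) (n::real).
          within_factors a b (real N) ((\<delta> / ln (1 / \<delta>) powr \<mu>) powr (- 1 / A)) \<and>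
          within_factors c0 c0 n ((1 / \<delta> * ln (1 / \<delta>) powr \<kappa>) powr (1 / A)) \<longrightarrow>
            finite (hyp_cross r r n 1) \<and>
            real (card (hyp_cross r r n 1)) \<le> Cu * real N \<and>
            truncation_error r r s \<mu> p \<delta> n 1
              \<le> ennreal (Cu * (real N powr (- B) * ln (real N) powr (\<mu> - 2 * real r + 1))) \<and>
            truncation_error r r s \<mu> p \<delta> n 1
              \<le> ennreal (Cu * ((\<delta> * ln (1 / \<delta>) powr (1 / s - real_of_ereal (1 / p))) powr (B / A)
                              * ln (1 / \<delta>) powr (3 / 2 - 1 / s)))"
    using isotropic_truncation[OF s p r B[unfolded B_def] pos c0(1) c0(1)]
    unfolding A_def B_def \<kappa>_def q_def by blast
  obtain cl where cl: "0 < cl" "\<And>N \<delta>. 1 \<le> N \<Longrightarrow> 0 < \<delta> \<Longrightarrow> ennreal (cl * real N powr (- B)) \<le> minimal_radius r r s \<mu> p N \<delta>"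
    using minimal_radius_ge[of s r r \<mu> p] s r \<mu> unfolding B_def by auto
  \<comment> \<open>The first entry serves the bound in N; the second translates it into \<delta>
    through N \<le> b N0.\<close>
  define c where "c = min cl (cl * inverse (b powr B))"
  have c: "0 < c" "c \<le> cl" "c \<le> cl * inverse (b powr B)"
    using cl pos by (auto simp: c_def)
  define M where "M = max (1 / c0) (2 * A * \<bar>ln a\<bar>)"
  have "\<forall>\<^sub>F \<delta> in at_right 0. 0 < \<delta> \<and> 1 \<le> ln (1 / \<delta>) \<and> M \<le> ln (1 / \<delta>) \<and>
    M \<le> (1 / \<delta> * ln (1 / \<delta>) powr \<kappa>) powr (1 / A) \<and>
    ln ((1 / \<delta> * ln (1 / \<delta>) powr \<kappa>) powr (1 / A)) \<le> 2 / A * ln (1 / \<delta>)"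
    by (rule isotropic_scale_eventually[OF A(1) \<kappa>])
  hence "\<forall>\<^sub>F \<delta> in at_right 0. \<forall>N::nat.
          within_factors a b (real N) ((\<delta> / ln (1 / \<delta>) powr \<mu>) powr (- 1 / A)) \<longrightarrow>
            ennreal (c * real N powr (- B)) \<le> minimal_radius r r s \<mu> p N \<delta> \<and>
            minimal_radius r r s \<mu> p N \<delta>
              \<le> ennreal (Cu * (real N powr (- B) * ln (real N) powr (\<mu> - 2 * real r + 1))) \<and>
            ennreal (c * (\<delta> / ln (1 / \<delta>) powr \<mu>) powr (B / A))
              \<le> minimal_radius r r s \<mu> p N \<delta> \<and>
            minimal_radius r r s \<mu> p N \<delta>
              \<le> ennreal (Cu * ((\<delta> * ln (1 / \<delta>) powr (1 / s - real_of_ereal (1 / p))) powr (B / A)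
                              * ln (1 / \<delta>) powr (3 / 2 - 1 / s)))"
    using Cu(2)
  proof (eventually_elim, intro allI impI, elim conjE)
    fix \<delta> :: real and N :: nat
    define L where "L = ln (1 / \<delta>)"
    define n0 where "n0 = (1 / \<delta> * L powr \<kappa>) powr (1 / A)"
    define N0 where "N0 = (\<delta> / L powr \<mu>) powr (- 1 / A)"
    let ?U1 = "ennreal (Cu * (real N powr (- B) * ln (real N) powr (\<mu> - 2 * real r + 1)))"
    let ?U2 = "ennreal (Cu * ((\<delta> * ln (1 / \<delta>) powr (1 / s - real_of_ereal (1 / p))) powr (B / A)
                              * ln (1 / \<delta>) powr (3 / 2 - 1 / s)))"
    assume up: "\<forall>(N::nat) (n::real).
          within_factors a b (real N) ((\<delta> / ln (1 / \<delta>) powr \<mu>) powr (- 1 / A)) \<and>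
          within_factors c0 c0 n ((1 / \<delta> * ln (1 / \<delta>) powr \<kappa>) powr (1 / A)) \<longrightarrow>
            finite (hyp_cross r r n 1) \<and>
            real (card (hyp_cross r r n 1)) \<le> Cu * real N \<and>
            truncation_error r r s \<mu> p \<delta> n 1
              \<le> ennreal (Cu * (real N powr (- B) * ln (real N) powr (\<mu> - 2 * real r + 1))) \<and>
            truncation_error r r s \<mu> p \<delta> n 1
              \<le> ennreal (Cu * ((\<delta> * ln (1 / \<delta>) powr (1 / s - real_of_ereal (1 / p))) powr (B / A)
                              * ln (1 / \<delta>) powr (3 / 2 - 1 / s)))"
      and wN: "within_factors a b (real N) ((\<delta> / ln (1 / \<delta>) powr \<mu>) powr (- 1 / A))"
      and \<delta>: "0 < \<delta>" and "1 \<le> ln (1 / \<delta>)" "M \<le> ln (1 / \<delta>)"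
      "M \<le> (1 / \<delta> * ln (1 / \<delta>) powr \<kappa>) powr (1 / A)"
      "ln ((1 / \<delta> * ln (1 / \<delta>) powr \<kappa>) powr (1 / A)) \<le> 2 / A * ln (1 / \<delta>)"
    hence L: "1 \<le> L" and M: "M \<le> n0" and lnn0: "ln n0 \<le> 2 / A * L"
      and N: "a * N0 \<le> real N" "real N \<le> b * N0"
      by (auto simp: L_def n0_def N0_def within_factors_def)
    note sc = isotropic_scales[OF \<delta> L(1) L_def A \<mu> n0_def N0_def]
    have "0 < a * N0" using pos sc(2) by simp
    hence Np: "0 < real N" using N by linarith
    hence N1: "1 \<le> N" by simp
    have "1 / c0 \<le> n0" using M by (simp add: M_def)
    hence n1: "1 \<le> c0 * n0" using c0 by (simp add: pos_divide_le_eq mult.commute)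
    have wn: "within_factors c0 c0 (c0 * n0) ((1 / \<delta> * ln (1 / \<delta>) powr \<kappa>) powr (1 / A))"
      by (simp add: within_factors_def n0_def L_def)
    have "real (card (hyp_cross r r (c0 * n0) 1)) \<le> c0 * n0 * (1 + ln (c0 * n0))"
      by (rule card_hyp_cross_isotropic[OF r r n1])
    also have "\<dots> \<le> c0 * n0 * ((1 + 2 / A) * L)"
    proof (rule mult_left_mono)
      have "ln c0 \<le> 0" using c0 by simp
      moreover have "ln (c0 * n0) = ln c0 + ln n0" using c0 sc(1) by (intro ln_mult_pos)
      ultimately have "1 + ln (c0 * n0) \<le> 1 + 2 / A * L" using lnn0 by linarith
      also have "\<dots> \<le> (1 + 2 / A) * L" using L by (simp add: algebra_simps)
      finally show "1 + ln (c0 * n0) \<le> (1 + 2 / A) * L" .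
    qed (use n1 in auto)
    also have "\<dots> = (c0 * (1 + 2 / A)) * N0" by (simp add: sc(3))
    also have "\<dots> \<le> a * N0" using c0 sc(2) by (intro mult_right_mono) auto
    finally have "card (hyp_cross r r (c0 * n0) 1) \<le> N" using N by linarith
    hence mr: "minimal_radius r r s \<mu> p N \<delta> \<le> truncation_error r r s \<mu> p \<delta> (c0 * n0) 1"
      using up wN wn by (intro minimal_radius_le_truncation_error) auto
    have U: "minimal_radius r r s \<mu> p N \<delta> \<le> ?U1" "minimal_radius r r s \<mu> p N \<delta> \<le> ?U2"
      using up wN wn order_trans[OF mr] by blast+
    have l0: "ennreal (cl * real N powr (- B)) \<le> minimal_radius r r s \<mu> p N \<delta>"
      by (rule cl(2)[OF N1 \<delta>])
    have "c * real N powr (- B) \<le> cl * real N powr (- B)" using c by (intro mult_right_mono) auto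
    hence l1: "ennreal (c * real N powr (- B)) \<le> minimal_radius r r s \<mu> p N \<delta>"
      using l0 by (meson ennreal_leI order_trans)
    have "N0 powr (-B) \<le> b powr B * real N powr (-B)"
      using pos Np sc(2) N B by (intro scaled_powr_neg_le) auto
    hence "inverse (b powr B) * N0 powr (-B) \<le> real N powr (-B)"
      using pos by (simp add: field_simps)
    hence "cl * (inverse (b powr B) * N0 powr (-B)) \<le> cl * real N powr (-B)"
      using cl by (intro mult_left_mono) auto
    moreover have "c * N0 powr (-B) \<le> cl * inverse (b powr B) * N0 powr (-B)"
      using c by (intro mult_right_mono) auto
    ultimately have "c * N0 powr (-B) \<le> cl * real N powr (-B)" by (simp add: mult.assoc)
    hence l2: "ennreal (c * (\<delta> / ln (1 / \<delta>) powr \<mu>) powr (B / A)) \<le> minimal_radius r r s \<mu> p N \<delta>"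
      using l0 unfolding L_def[symmetric] sc(6) by (meson ennreal_leI order_trans)
    show "ennreal (c * real N powr (- B)) \<le> minimal_radius r r s \<mu> p N \<delta> \<and>
        minimal_radius r r s \<mu> p N \<delta> \<le> ?U1 \<and>
        ennreal (c * (\<delta> / ln (1 / \<delta>) powr \<mu>) powr (B / A)) \<le> minimal_radius r r s \<mu> p N \<delta> \<and>
        minimal_radius r r s \<mu> p N \<delta> \<le> ?U2"
      using U l1 l2 by blast
  qed
  with c(1) Cu(1) show ?thesis by blast
qed

theorem theorem0p4p4:
  fixes s \<mu> :: real and p :: ereal and r1 r2 :: nat
  fixes A B :: real
  defines "A \<equiv> \<mu> - real_of_ereal (1 / p) + 1 / s"
  defines "B \<equiv> \<mu> - 2 * real r1 + 1 / s - 1 / 2"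
  assumes "1 \<le> s" and "1 \<le> p" and "1 \<le> r2" and "r2 \<le> r1"
    and "\<mu> > 2 * real r1 + 1 / 2 - 1 / s"
  shows
    "(r1 = r2 \<longrightarrow>
       (\<forall>a>0. \<forall>b>0. \<exists>c>0. \<exists>C>0. \<forall>\<^sub>F \<delta> in at_right 0. \<forall>N::nat.
          within_factors a b (real N) ((\<delta> / ln (1 / \<delta>) powr \<mu>) powr (- 1 / A)) \<longrightarrow>
            ennreal (c * real N powr (- B)) \<le> minimal_radius r1 r1 s \<mu> p N \<delta> \<and>
            minimal_radius r1 r1 s \<mu> p N \<delta>
              \<le> ennreal (C * (real N powr (- B) * ln (real N) powr (\<mu> - 2 * real r1 + 1))) \<and>
            ennreal (c * (\<delta> / ln (1 / \<delta>) powr \<mu>) powr (B / A))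
              \<le> minimal_radius r1 r1 s \<mu> p N \<delta> \<and>
            minimal_radius r1 r1 s \<mu> p N \<delta>
              \<le> ennreal (C * ((\<delta> * ln (1 / \<delta>) powr (1 / s - real_of_ereal (1 / p))) powr (B / A)
                              * ln (1 / \<delta>) powr (3 / 2 - 1 / s)))) \<and>
       (\<forall>a>0. \<forall>b>0. \<forall>a'>0. \<forall>b'>0. \<exists>C>0. \<forall>\<^sub>F \<delta> in at_right 0. \<forall>(N::nat) (n::real).
          within_factors a b (real N) ((\<delta> / ln (1 / \<delta>) powr \<mu>) powr (- 1 / A)) \<and>
          within_factors a' b' n
            ((1 / \<delta> * ln (1 / \<delta>) powr (real_of_ereal (1 / p) - 1 / s)) powr (1 / A)) \<longrightarrow>
            finite (hyp_cross r1 r1 n 1) \<and>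
            real (card (hyp_cross r1 r1 n 1)) \<le> C * real N \<and>
            truncation_error r1 r1 s \<mu> p \<delta> n 1
              \<le> ennreal (C * (real N powr (- B) * ln (real N) powr (\<mu> - 2 * real r1 + 1))) \<and>
            truncation_error r1 r1 s \<mu> p \<delta> n 1
              \<le> ennreal (C * ((\<delta> * ln (1 / \<delta>) powr (1 / s - real_of_ereal (1 / p))) powr (B / A)
                              * ln (1 / \<delta>) powr (3 / 2 - 1 / s))))) \<and>
     (r2 < r1 \<longrightarrow>
       (\<forall>a>0. \<forall>b>0. \<exists>c>0. \<exists>C>0. \<forall>\<^sub>F \<delta> in at_right 0. \<forall>N::nat.
          within_factors a b (real N) (\<delta> powr (- 1 / A)) \<longrightarrow>
            ennreal (c * real N powr (- B)) \<le> minimal_radius r1 r2 s \<mu> p N \<delta> \<and>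
            minimal_radius r1 r2 s \<mu> p N \<delta> \<le> ennreal (C * real N powr (- B)) \<and>
            within_factors c C (real N powr (- B)) (\<delta> powr (B / A))) \<and>
       (\<forall>\<gamma> \<in> {1 <..< (\<mu> - 2 * real r2 + 1 / s - 1 / 2) / (\<mu> - 2 * real r1 + 1 / s + 1 / 2)}
           \<union> {(\<mu> - 2 * real r2 + 1 / s - 1 / 2) / (\<mu> - 2 * real r1 + 1 / s + 1 / 2)
               <..< (\<mu> - 2 * real r2 + 1 / s + 1 / 2) / (\<mu> - 2 * real r1 + 1 / s + 1 / 2)}
           \<union> {(\<mu> - 2 * real r2 + 1 / s + 1 / 2) / (\<mu> - 2 * real r1 + 1 / s + 1 / 2)
               <..< (\<mu> - 2 * real r2 + 1 / s - 1 / 2) / (\<mu> - 2 * real r1 + 1 / s - 1 / 2)}.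
        \<forall>a>0. \<forall>b>0. \<forall>a'>0. \<forall>b'>0. \<exists>C>0. \<forall>\<^sub>F \<delta> in at_right 0. \<forall>(N::nat) (n::real).
          within_factors a b (real N) (\<delta> powr (- 1 / A)) \<and>
          within_factors a' b' n (\<delta> powr (- 1 / A)) \<longrightarrow>
            finite (hyp_cross r1 r2 n \<gamma>) \<and>
            real (card (hyp_cross r1 r2 n \<gamma>)) \<le> C * real N \<and>
            truncation_error r1 r2 s \<mu> p \<delta> n \<gamma> \<le> ennreal (C * real N powr (- B)) \<and>
            truncation_error r1 r2 s \<mu> p \<delta> n \<gamma> \<le> ennreal (C * \<delta> powr (B / A))))"
proof -
  have "0 < B" using assms by (simp add: B_def)
  note B = this[unfolded B_def]
  have \<gamma>: "1 < \<gamma>" "\<gamma> * (\<mu> - 2 * real r1 + 1 / s - 1 / 2) < \<mu> - 2 * real r2 + 1 / s - 1 / 2"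
    if "r2 < r1" and mem: "\<gamma> \<in> {1 <..< (\<mu> - 2 * real r2 + 1 / s - 1 / 2) / (\<mu> - 2 * real r1 + 1 / s + 1 / 2)}
           \<union> {(\<mu> - 2 * real r2 + 1 / s - 1 / 2) / (\<mu> - 2 * real r1 + 1 / s + 1 / 2)
               <..< (\<mu> - 2 * real r2 + 1 / s + 1 / 2) / (\<mu> - 2 * real r1 + 1 / s + 1 / 2)}
           \<union> {(\<mu> - 2 * real r2 + 1 / s + 1 / 2) / (\<mu> - 2 * real r1 + 1 / s + 1 / 2)
               <..< (\<mu> - 2 * real r2 + 1 / s - 1 / 2) / (\<mu> - 2 * real r1 + 1 / s - 1 / 2)}" for \<gamma>
  proof -
    define B2 where "B2 = \<mu> - 2 * real r2 + 1 / s - 1 / 2"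
    have e: "\<mu> - 2 * real r1 + 1 / s + 1 / 2 = B + 1" "\<mu> - 2 * real r2 + 1 / s + 1 / 2 = B2 + 1"
      "\<mu> - 2 * real r1 + 1 / s - 1 / 2 = B" by (simp_all add: B_def B2_def)
    \<comment> \<open>Distinct integers differ by at least 1, which separates B and B2 by 2 and puts
      the first breakpoint above 1.\<close>
    have "real r2 + 1 \<le> real r1" using \<open>r2 < r1\<close> by linarith
    hence B2: "B + 2 \<le> B2" by (simp add: B_def B2_def)
    \<comment> \<open>The breakpoints are ordered between 1 and B2 / B, so each of the three
      intervals lies inside (1, B2 / B).\<close>
    have le: "1 \<le> B2 / (B + 1)" "B2 / (B + 1) \<le> (B2 + 1) / (B + 1)" "(B2 + 1) / (B + 1) \<le> B2 / B"
      using \<open>0 < B\<close> B2 by (simp_all add: field_simps)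
    from mem have "1 < \<gamma> \<and> \<gamma> < B2 / B"
      unfolding e B2_def[symmetric] using le by auto
    thus "1 < \<gamma>" "\<gamma> * (\<mu> - 2 * real r1 + 1 / s - 1 / 2) < \<mu> - 2 * real r2 + 1 / s - 1 / 2"
      using \<open>0 < B\<close> unfolding e B2_def[symmetric] by (auto simp: pos_less_divide_eq)
  qed
  have r1: "1 \<le> r1" using assms by simp
  show ?thesis
    unfolding A_def B_def
    by (intro conjI impI allI ballI)
       (rule isotropic_radius isotropic_truncation anisotropic_radius anisotropic_truncation,
        (rule assms r1 B | assumption | erule (1) \<gamma>)+)+
qed

end
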